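(* Over Bishop-style constructive mathematics, the following are equivalent: (UCT$_c$) Every function $f\colon[0,1]\to\mathbb{R}$ with a continuous modulus is uniformly continuous. (UCT$_c'$) Every function $f\colon[0,1]\to\mathbb{R}$ with a continuous ternary modulus is uniformly continuous.
   Context: The setting is constructive. Real numbers are regular sequences of rationals $\langle r_n\rangle$ with $|r_n-r_{n+1}|\le2^{-(n+1)}$. Equality is $\langle r_n\rangle\simeq\langle q_n\rangle$ iff $\forall n\,|r_{n+1}-q_{n+1}|\le2^{-n}$. Functions $[0,1]\to\mathbb{R}$ respect $\simeq$. Modulus: - Fix a bijective coding of $\mathbb{Q}$ by $\mathbb{N}$. Let $|[0,1]|$ be the set of regular sequences in $[0,1]$, viewed as a subset of $\mathbb{N}^{\mathbb{N}}$, with pointwise equality. - A modulus of $f$ is $g\colon\mathbb{N}\to|[0,1]|\to\mathbb{N}$ such that $\forall k\,\forall x,y\in[0,1]\,(|x-y|\le2^{-g_k(x)}\to|f(x)-f(y)|\le2^{-k})$. - It is continuous if each $g_k$ is pointwise continuous with respect to initial segments. Ternary modulus: - For $s\in\{0,1,2\}^*$, define $N(\langle\rangle)=1$ and $N(s*\langle i\rangle)=2N(s)+(i-1)$. - For $\alpha\in\{0,1,2\}^{\mathbb{N}}$, $\Phi(\alpha)=\langle2^{-(n+1)}N(\overline{\alpha}n)\rangle_n$. - A ternary modulus of $f$ is $g\colon\mathbb{N}\to\{0,1,2\}^{\mathbb{N}}\to\mathbb{N}$ with $\forall k\,\forall\alpha\,\forall x\in[0,1]\,(|\Phi(\alpha)-x|\le2^{-g_k(\alpha)}\to|f(\Phi(\alpha))-f(x)|\le2^{-k})$.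 - It is continuous if each $g_k$ is pointwise continuous on $\{0,1,2\}^{\mathbb{N}}$. Uniform continuity of $f$ means there is $\omega$ with $|x-y|\le2^{-\omega(k)}\to|f(x)-f(y)|\le2^{-k}$ for all $k,x,y$. *)

theory Defs
  imports Main
begin

text \<open>
  In Isabelle/HOL, which is classical, the two principles below are both theorems, so an
  equivalence between them at the level of HOL would say nothing.  ``Over Bishop-style constructive
  mathematics'' is therefore rendered as derivability in a formal system of intuitionistic
  arithmetic in all finite types (Heyting arithmetic HA-omega, in its neutral form: equality at every
  type with Leibniz's law, but neither function extensionality nor the xi-rule), presented by natural
  deduction.  The rationals are a base type, axiomatised as a discrete ordered field of fractions of
  naturals together with a bijective coding by the naturals.  No choice principle and no form of
  excluded middle is included (only the order of the rationals is decidable), so whatever is derivable here holds in every usual formal system for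
  Bishop's mathematics.
\<close>

section \<open>The formal system\<close>

subsection \<open>Syntax\<close>

datatype ty = Nat | Rat | Fun ty ty

datatype const =
    Zero | Succ
  | Rec ty                  \<comment> \<open>primitive recursion with values in the given type\<close>
  | OfNat
  | QOne | QPlus | QNeg | QTimes | QInv
  | QLeq                    \<comment> \<open>characteristic function of the order; the value zero means true\<close>
  | Code | Decode           \<comment> \<open>bijection between the rationals and the naturals\<close>

text \<open>
  Locally nameless syntax: \<open>Bnd i\<close> is a de Bruijn index, and \<open>Par a \<tau>\<close> is the \<open>a\<close>-th free variable
  of type \<open>\<tau>\<close>.
\<close>

datatype tm = Bnd nat | Par nat ty | Con const | App tm tm | Lam ty tm

datatype fm =
    Eq ty tm tm
  | Falsum
  | Conj fm fm
  | Disj fm fm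
  | Impl fm fm
  | Forall ty fm
  | Exists ty fm

primrec ctype :: "const \<Rightarrow> ty" where
  "ctype Zero = Nat"
| "ctype Succ = Fun Nat Nat"
| "ctype (Rec \<tau>) = Fun \<tau> (Fun (Fun Nat (Fun \<tau> \<tau>)) (Fun Nat \<tau>))"
| "ctype OfNat = Fun Nat Rat"
| "ctype QOne = Rat"
| "ctype QPlus = Fun Rat (Fun Rat Rat)"
| "ctype QNeg = Fun Rat Rat"
| "ctype QTimes = Fun Rat (Fun Rat Rat)"
| "ctype QInv = Fun Rat Rat"
| "ctype QLeq = Fun Rat (Fun Rat Nat)"
| "ctype Code = Fun Rat Nat"
| "ctype Decode = Fun Nat Rat"

text \<open>The list gives the types of the dangling indices; \<open>None\<close> means ill-typed.\<close>

primrec tyof :: "ty list \<Rightarrow> tm \<Rightarrow> ty option" where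
  "tyof Ts (Bnd i) = (if i < length Ts then Some (Ts ! i) else None)"
| "tyof Ts (Par a \<tau>) = Some \<tau>"
| "tyof Ts (Con c) = Some (ctype c)"
| "tyof Ts (App s t) =
     (case tyof Ts s of
        Some (Fun \<sigma> \<tau>) \<Rightarrow> if tyof Ts t = Some \<sigma> then Some \<tau> else None
      | _ \<Rightarrow> None)"
| "tyof Ts (Lam \<sigma> t) = map_option (Fun \<sigma>) (tyof (\<sigma> # Ts) t)"

primrec wff :: "ty list \<Rightarrow> fm \<Rightarrow> bool" where
  "wff Ts (Eq \<tau> s t) \<longleftrightarrow> tyof Ts s = Some \<tau> \<and> tyof Ts t = Some \<tau>"
| "wff Ts Falsum \<longleftrightarrow> True"
| "wff Ts (Conj \<phi> \<psi>) \<longleftrightarrow> wff Ts \<phi> \<and> wff Ts \<psi>"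
| "wff Ts (Disj \<phi> \<psi>) \<longleftrightarrow> wff Ts \<phi> \<and> wff Ts \<psi>"
| "wff Ts (Impl \<phi> \<psi>) \<longleftrightarrow> wff Ts \<phi> \<and> wff Ts \<psi>"
| "wff Ts (Forall \<tau> \<phi>) \<longleftrightarrow> wff (\<tau> # Ts) \<phi>"
| "wff Ts (Exists \<tau> \<phi>) \<longleftrightarrow> wff (\<tau> # Ts) \<phi>"

text \<open>
  Instantiation of an index.  It is only used with terms \<open>u\<close> that have no dangling index, so \<open>u\<close>
  need not be shifted when passing under a binder.
\<close>

primrec inst_tm :: "nat \<Rightarrow> tm \<Rightarrow> tm \<Rightarrow> tm" where
  "inst_tm k u (Bnd i) = (if i = k then u else Bnd i)"
| "inst_tm k u (Par a \<tau>) = Par a \<tau>"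
| "inst_tm k u (Con c) = Con c"
| "inst_tm k u (App s t) = App (inst_tm k u s) (inst_tm k u t)"
| "inst_tm k u (Lam \<sigma> t) = Lam \<sigma> (inst_tm (Suc k) u t)"

primrec inst :: "nat \<Rightarrow> tm \<Rightarrow> fm \<Rightarrow> fm" where
  "inst k u (Eq \<tau> s t) = Eq \<tau> (inst_tm k u s) (inst_tm k u t)"
| "inst k u Falsum = Falsum"
| "inst k u (Conj \<phi> \<psi>) = Conj (inst k u \<phi>) (inst k u \<psi>)"
| "inst k u (Disj \<phi> \<psi>) = Disj (inst k u \<phi>) (inst k u \<psi>)"
| "inst k u (Impl \<phi> \<psi>) = Impl (inst k u \<phi>) (inst k u \<psi>)"
| "inst k u (Forall \<tau> \<phi>) = Forall \<tau> (inst (Suc k) u \<phi>)"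
| "inst k u (Exists \<tau> \<phi>) = Exists \<tau> (inst (Suc k) u \<phi>)"

primrec pars_tm :: "tm \<Rightarrow> (nat \<times> ty) set" where
  "pars_tm (Bnd i) = {}"
| "pars_tm (Par a \<tau>) = {(a, \<tau>)}"
| "pars_tm (Con c) = {}"
| "pars_tm (App s t) = pars_tm s \<union> pars_tm t"
| "pars_tm (Lam \<sigma> t) = pars_tm t"

primrec pars :: "fm \<Rightarrow> (nat \<times> ty) set" where
  "pars (Eq \<tau> s t) = pars_tm s \<union> pars_tm t"
| "pars Falsum = {}"
| "pars (Conj \<phi> \<psi>) = pars \<phi> \<union> pars \<psi>"
| "pars (Disj \<phi> \<psi>) = pars \<phi> \<union> pars \<psi>"
| "pars (Impl \<phi> \<psi>) = pars \<phi> \<union> pars \<psi>"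
| "pars (Forall \<tau> \<phi>) = pars \<phi>"
| "pars (Exists \<tau> \<phi>) = pars \<phi>"

definition fresh :: "nat \<Rightarrow> ty \<Rightarrow> fm list \<Rightarrow> bool" where
  "fresh a \<tau> \<Delta> \<longleftrightarrow> (\<forall>\<phi>\<in>set \<Delta>. (a, \<tau>) \<notin> pars \<phi>)"

subsection \<open>Writing terms and formulas with HOL binders\<close>

text \<open>
  To avoid de Bruijn indices in concrete formulas, terms and formulas are written as functions of
  the number of enclosing binders: the variable bound by the binder at depth \<open>l\<close> has index
  \<open>d - Suc l\<close> when it occurs at depth \<open>d\<close>.  A closed formula is obtained by applying such a
  function to \<open>0\<close>; for instance \<open>all Nat (\<lambda>m. ex Nat (\<lambda>n. m =\<^sub>N n)) 0\<close> is
  \<open>Forall Nat (Exists Nat (Eq Nat (Bnd 1) (Bnd 0)))\<close>.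
\<close>

type_synonym btm = "nat \<Rightarrow> tm"
type_synonym bfm = "nat \<Rightarrow> fm"

definition bv :: "nat \<Rightarrow> btm" where
  "bv l = (\<lambda>d. Bnd (d - Suc l))"

definition cn :: "const \<Rightarrow> btm" where
  "cn c = (\<lambda>d. Con c)"

definition app :: "btm \<Rightarrow> btm \<Rightarrow> btm"  (infixl "\<cdot>" 90) where
  "s \<cdot> t = (\<lambda>d. App (s d) (t d))"

definition lam :: "ty \<Rightarrow> (btm \<Rightarrow> btm) \<Rightarrow> btm" where
  "lam \<tau> F = (\<lambda>d. Lam \<tau> (F (bv d) (Suc d)))"

definition eqn :: "ty \<Rightarrow> btm \<Rightarrow> btm \<Rightarrow> bfm" where
  "eqn \<tau> s t = (\<lambda>d. Eq \<tau> (s d) (t d))"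

abbreviation eqN :: "btm \<Rightarrow> btm \<Rightarrow> bfm"  (infix "=\<^sub>N" 50) where
  "s =\<^sub>N t \<equiv> eqn Nat s t"

abbreviation eqQ :: "btm \<Rightarrow> btm \<Rightarrow> bfm"  (infix "=\<^sub>Q" 50) where
  "s =\<^sub>Q t \<equiv> eqn Rat s t"

definition falsum :: bfm where
  "falsum = (\<lambda>d. Falsum)"

definition fconj :: "bfm \<Rightarrow> bfm \<Rightarrow> bfm"  (infixr "\<^bold>\<and>" 35) where
  "(A \<^bold>\<and> B) = (\<lambda>d. Conj (A d) (B d))"

definition fdisj :: "bfm \<Rightarrow> bfm \<Rightarrow> bfm"  (infixr "\<^bold>\<or>" 30) where
  "(A \<^bold>\<or> B) = (\<lambda>d. Disj (A d) (B d))"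

definition fimpl :: "bfm \<Rightarrow> bfm \<Rightarrow> bfm"  (infixr "\<^bold>\<longrightarrow>" 25) where
  "(A \<^bold>\<longrightarrow> B) = (\<lambda>d. Impl (A d) (B d))"

definition all :: "ty \<Rightarrow> (btm \<Rightarrow> bfm) \<Rightarrow> bfm" where
  "all \<tau> F = (\<lambda>d. Forall \<tau> (F (bv d) (Suc d)))"

definition ex :: "ty \<Rightarrow> (btm \<Rightarrow> bfm) \<Rightarrow> bfm" where
  "ex \<tau> F = (\<lambda>d. Exists \<tau> (F (bv d) (Suc d)))"

abbreviation iff :: "bfm \<Rightarrow> bfm \<Rightarrow> bfm"  (infixr "\<^bold>\<longleftrightarrow>" 25) where
  "A \<^bold>\<longleftrightarrow> B \<equiv> (A \<^bold>\<longrightarrow> B) \<^bold>\<and> (B \<^bold>\<longrightarrow> A)"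

abbreviation neg :: "bfm \<Rightarrow> bfm"  ("\<^bold>\<not> _" [40] 40) where
  "\<^bold>\<not> A \<equiv> A \<^bold>\<longrightarrow> falsum"

abbreviation zero :: btm where "zero \<equiv> cn Zero"
abbreviation suc :: "btm \<Rightarrow> btm" where "suc n \<equiv> cn Succ \<cdot> n"
abbreviation recur :: "ty \<Rightarrow> btm \<Rightarrow> btm \<Rightarrow> btm \<Rightarrow> btm" where
  "recur \<tau> a h n \<equiv> cn (Rec \<tau>) \<cdot> a \<cdot> h \<cdot> n"

abbreviation qnat :: "btm \<Rightarrow> btm" where "qnat n \<equiv> cn OfNat \<cdot> n"
abbreviation qzero :: btm where "qzero \<equiv> qnat zero"
abbreviation qone :: btm where "qone \<equiv> cn QOne"
abbreviation qplus :: "btm \<Rightarrow> btm \<Rightarrow> btm"  (infixl "+\<^sub>Q" 65) where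
  "p +\<^sub>Q q \<equiv> cn QPlus \<cdot> p \<cdot> q"
abbreviation qneg :: "btm \<Rightarrow> btm" where "qneg q \<equiv> cn QNeg \<cdot> q"
abbreviation qminus :: "btm \<Rightarrow> btm \<Rightarrow> btm"  (infixl "-\<^sub>Q" 65) where
  "p -\<^sub>Q q \<equiv> p +\<^sub>Q qneg q"
abbreviation qtimes :: "btm \<Rightarrow> btm \<Rightarrow> btm"  (infixl "*\<^sub>Q" 70) where
  "p *\<^sub>Q q \<equiv> cn QTimes \<cdot> p \<cdot> q"
abbreviation qinv :: "btm \<Rightarrow> btm" where "qinv q \<equiv> cn QInv \<cdot> q"
abbreviation qle :: "btm \<Rightarrow> btm \<Rightarrow> bfm"  (infix "\<le>\<^sub>Q" 50) where
  "p \<le>\<^sub>Q q \<equiv> cn QLeq \<cdot> p \<cdot> q =\<^sub>N zero"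

subsection \<open>Axioms and rules\<close>

definition nat_axioms :: "bfm set" where
  "nat_axioms =
    {all Nat (\<lambda>n. \<^bold>\<not> (suc n =\<^sub>N zero)),
     all Nat (\<lambda>m. all Nat (\<lambda>n. suc m =\<^sub>N suc n \<^bold>\<longrightarrow> m =\<^sub>N n))}"

definition rec_axioms :: "bfm set" where
  "rec_axioms =
    (\<Union>\<tau>. {all \<tau> (\<lambda>a. all (Fun Nat (Fun \<tau> \<tau>)) (\<lambda>h. eqn \<tau> (recur \<tau> a h zero) a)),
          all \<tau> (\<lambda>a. all (Fun Nat (Fun \<tau> \<tau>)) (\<lambda>h. all Nat (\<lambda>n.
            eqn \<tau> (recur \<tau> a h (suc n)) (h \<cdot> n \<cdot> recur \<tau> a h n))))})"

definition rat_axioms :: "bfm set" where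
  "rat_axioms =
    {all Rat (\<lambda>x. all Rat (\<lambda>y. all Rat (\<lambda>z. (x +\<^sub>Q y) +\<^sub>Q z =\<^sub>Q x +\<^sub>Q (y +\<^sub>Q z)))),
     all Rat (\<lambda>x. all Rat (\<lambda>y. x +\<^sub>Q y =\<^sub>Q y +\<^sub>Q x)),
     all Rat (\<lambda>x. qzero +\<^sub>Q x =\<^sub>Q x),
     all Rat (\<lambda>x. x +\<^sub>Q qneg x =\<^sub>Q qzero),
     all Rat (\<lambda>x. all Rat (\<lambda>y. all Rat (\<lambda>z. (x *\<^sub>Q y) *\<^sub>Q z =\<^sub>Q x *\<^sub>Q (y *\<^sub>Q z)))),
     all Rat (\<lambda>x. all Rat (\<lambda>y. x *\<^sub>Q y =\<^sub>Q y *\<^sub>Q x)),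
     all Rat (\<lambda>x. qone *\<^sub>Q x =\<^sub>Q x),
     all Rat (\<lambda>x. all Rat (\<lambda>y. all Rat (\<lambda>z. (x +\<^sub>Q y) *\<^sub>Q z =\<^sub>Q x *\<^sub>Q z +\<^sub>Q y *\<^sub>Q z))),
     \<^bold>\<not> (qone =\<^sub>Q qzero),
     all Rat (\<lambda>x. \<^bold>\<not> (x =\<^sub>Q qzero) \<^bold>\<longrightarrow> x *\<^sub>Q qinv x =\<^sub>Q qone),
     all Rat (\<lambda>x. all Rat (\<lambda>y. x \<le>\<^sub>Q y \<^bold>\<or> cn QLeq \<cdot> x \<cdot> y =\<^sub>N suc zero)),
     all Rat (\<lambda>x. all Rat (\<lambda>y. x \<le>\<^sub>Q y \<^bold>\<or> y \<le>\<^sub>Q x)),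
     all Rat (\<lambda>x. all Rat (\<lambda>y. x \<le>\<^sub>Q y \<^bold>\<and> y \<le>\<^sub>Q x \<^bold>\<longrightarrow> x =\<^sub>Q y)),
     all Rat (\<lambda>x. all Rat (\<lambda>y. all Rat (\<lambda>z. x \<le>\<^sub>Q y \<^bold>\<and> y \<le>\<^sub>Q z \<^bold>\<longrightarrow> x \<le>\<^sub>Q z))),
     all Rat (\<lambda>x. all Rat (\<lambda>y. all Rat (\<lambda>z. x \<le>\<^sub>Q y \<^bold>\<longrightarrow> x +\<^sub>Q z \<le>\<^sub>Q y +\<^sub>Q z))),
     all Rat (\<lambda>x. all Rat (\<lambda>y. qzero \<le>\<^sub>Q x \<^bold>\<and> qzero \<le>\<^sub>Q y \<^bold>\<longrightarrow> qzero \<le>\<^sub>Q x *\<^sub>Q y)),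
     all Nat (\<lambda>n. qnat (suc n) =\<^sub>Q qnat n +\<^sub>Q qone),
     all Rat (\<lambda>x. ex Nat (\<lambda>m. ex Nat (\<lambda>n.
       x *\<^sub>Q qnat (suc n) =\<^sub>Q qnat m \<^bold>\<or> qneg x *\<^sub>Q qnat (suc n) =\<^sub>Q qnat m))),
     all Rat (\<lambda>x. cn Decode \<cdot> (cn Code \<cdot> x) =\<^sub>Q x),
     all Nat (\<lambda>n. cn Code \<cdot> (cn Decode \<cdot> n) =\<^sub>N n)}"

definition ha_axioms :: "fm set" where
  "ha_axioms = (\<lambda>A. A 0) ` (nat_axioms \<union> rec_axioms \<union> rat_axioms)"

text \<open>
  The typing side conditions ensure that only well-typed formulas without dangling indices are
  derived from hypotheses of that kind.
\<close>

inductive derivable :: "fm list \<Rightarrow> fm \<Rightarrow> bool"  (infix "\<turnstile>" 20) where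
  D_hyp: "\<phi> \<in> set \<Delta> \<Longrightarrow> wff [] \<phi> \<Longrightarrow> \<Delta> \<turnstile> \<phi>"
| D_ax: "\<phi> \<in> ha_axioms \<Longrightarrow> \<Delta> \<turnstile> \<phi>"
| D_falsumE: "\<Delta> \<turnstile> Falsum \<Longrightarrow> wff [] \<phi> \<Longrightarrow> \<Delta> \<turnstile> \<phi>"
| D_conjI: "\<Delta> \<turnstile> \<phi> \<Longrightarrow> \<Delta> \<turnstile> \<psi> \<Longrightarrow> \<Delta> \<turnstile> Conj \<phi> \<psi>"
| D_conjE1: "\<Delta> \<turnstile> Conj \<phi> \<psi> \<Longrightarrow> \<Delta> \<turnstile> \<phi>"
| D_conjE2: "\<Delta> \<turnstile> Conj \<phi> \<psi> \<Longrightarrow> \<Delta> \<turnstile> \<psi>"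
| D_disjI1: "\<Delta> \<turnstile> \<phi> \<Longrightarrow> wff [] \<psi> \<Longrightarrow> \<Delta> \<turnstile> Disj \<phi> \<psi>"
| D_disjI2: "\<Delta> \<turnstile> \<psi> \<Longrightarrow> wff [] \<phi> \<Longrightarrow> \<Delta> \<turnstile> Disj \<phi> \<psi>"
| D_disjE: "\<Delta> \<turnstile> Disj \<phi> \<psi> \<Longrightarrow> \<phi> # \<Delta> \<turnstile> \<chi> \<Longrightarrow> \<psi> # \<Delta> \<turnstile> \<chi> \<Longrightarrow> \<Delta> \<turnstile> \<chi>"
| D_implI: "wff [] \<phi> \<Longrightarrow> \<phi> # \<Delta> \<turnstile> \<psi> \<Longrightarrow> \<Delta> \<turnstile> Impl \<phi> \<psi>"
| D_implE: "\<Delta> \<turnstile> Impl \<phi> \<psi> \<Longrightarrow> \<Delta> \<turnstile> \<phi> \<Longrightarrow> \<Delta> \<turnstile> \<psi>"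
| D_forallI: "fresh a \<tau> (\<phi> # \<Delta>) \<Longrightarrow> \<Delta> \<turnstile> inst 0 (Par a \<tau>) \<phi> \<Longrightarrow> wff [\<tau>] \<phi> \<Longrightarrow> \<Delta> \<turnstile> Forall \<tau> \<phi>"
| D_forallE: "\<Delta> \<turnstile> Forall \<tau> \<phi> \<Longrightarrow> tyof [] t = Some \<tau> \<Longrightarrow> \<Delta> \<turnstile> inst 0 t \<phi>"
| D_existsI: "tyof [] t = Some \<tau> \<Longrightarrow> wff [\<tau>] \<phi> \<Longrightarrow> \<Delta> \<turnstile> inst 0 t \<phi> \<Longrightarrow> \<Delta> \<turnstile> Exists \<tau> \<phi>"
| D_existsE: "\<Delta> \<turnstile> Exists \<tau> \<phi> \<Longrightarrow> fresh a \<tau> (\<psi> # \<phi> # \<Delta>) \<Longrightarrow>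
    inst 0 (Par a \<tau>) \<phi> # \<Delta> \<turnstile> \<psi> \<Longrightarrow> \<Delta> \<turnstile> \<psi>"
| D_refl: "tyof [] t = Some \<tau> \<Longrightarrow> \<Delta> \<turnstile> Eq \<tau> t t"
| D_leibniz: "\<Delta> \<turnstile> Eq \<tau> s t \<Longrightarrow> wff [\<tau>] \<phi> \<Longrightarrow> \<Delta> \<turnstile> inst 0 s \<phi> \<Longrightarrow> \<Delta> \<turnstile> inst 0 t \<phi>"
| D_beta: "tyof [] (App (Lam \<sigma> b) t) = Some \<tau> \<Longrightarrow>
    \<Delta> \<turnstile> Eq \<tau> (App (Lam \<sigma> b) t) (inst_tm 0 t b)"
| D_induct: "wff [Nat] \<phi> \<Longrightarrow> fresh a Nat (\<phi> # \<Delta>) \<Longrightarrow> \<Delta> \<turnstile> inst 0 (Con Zero) \<phi> \<Longrightarrow>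
    inst 0 (Par a Nat) \<phi> # \<Delta> \<turnstile> inst 0 (App (Con Succ) (Par a Nat)) \<phi> \<Longrightarrow>
    \<Delta> \<turnstile> Forall Nat \<phi>"

section \<open>Real numbers, moduli, and the two principles\<close>

text \<open>\<open>pw n\<close> is the rational $2^{-n}$.\<close>

definition pw :: "btm \<Rightarrow> btm" where
  "pw n = recur Rat qone (lam Nat (\<lambda>m. lam Rat (\<lambda>r. qinv (qone +\<^sub>Q qone) *\<^sub>Q r))) n"

text \<open>Recursion on the value of \<open>QLeq\<close> acts as a case distinction: zero means that \<open>q\<close> is
  nonnegative.\<close>

definition qabs :: "btm \<Rightarrow> btm" where
  "qabs q = recur Rat q (lam Nat (\<lambda>m. lam Rat (\<lambda>r. qneg q))) (cn QLeq \<cdot> qzero \<cdot> q)"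

abbreviation Seq :: ty where "Seq \<equiv> Fun Nat Rat"
abbreviation NSeq :: ty where "NSeq \<equiv> Fun Nat Nat"

definition regular :: "btm \<Rightarrow> bfm" where
  "regular x = all Nat (\<lambda>n. qabs (x \<cdot> n -\<^sub>Q x \<cdot> suc n) \<le>\<^sub>Q pw (suc n))"

definition real_eq :: "btm \<Rightarrow> btm \<Rightarrow> bfm"  (infix "\<simeq>" 50) where
  "(x \<simeq> y) = all Nat (\<lambda>n. qabs (x \<cdot> suc n -\<^sub>Q y \<cdot> suc n) \<le>\<^sub>Q pw n)"

text \<open>
  Order, subtraction and absolute value of regular sequences in the standard way; the index shift
  in \<open>rsub\<close> makes the result regular again, and \<open>x \<simeq> y\<close> amounts to \<open>rle x y \<^bold>\<and> rle y x\<close>.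
\<close>

definition rle :: "btm \<Rightarrow> btm \<Rightarrow> bfm" where
  "rle x y = all Nat (\<lambda>n. x \<cdot> suc n \<le>\<^sub>Q y \<cdot> suc n +\<^sub>Q pw n)"

definition rconst :: "btm \<Rightarrow> btm" where
  "rconst q = lam Nat (\<lambda>n. q)"

definition rsub :: "btm \<Rightarrow> btm \<Rightarrow> btm" where
  "rsub x y = lam Nat (\<lambda>n. x \<cdot> suc n -\<^sub>Q y \<cdot> suc n)"

definition rabs :: "btm \<Rightarrow> btm" where
  "rabs x = lam Nat (\<lambda>n. qabs (x \<cdot> n))"

text \<open>\<open>near k x y\<close> is $|x - y| \<le> 2^{-k}$ for real numbers.\<close>

definition near :: "btm \<Rightarrow> btm \<Rightarrow> btm \<Rightarrow> bfm" where
  "near k x y = rle (rabs (rsub x y)) (rconst (pw k))"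

definition unit_interval :: "btm \<Rightarrow> bfm" where
  "unit_interval x = (regular x \<^bold>\<and> rle (rconst qzero) x \<^bold>\<and> rle x (rconst qone))"

abbreviation all_unit :: "(btm \<Rightarrow> bfm) \<Rightarrow> bfm" where
  "all_unit F \<equiv> all Seq (\<lambda>x. unit_interval x \<^bold>\<longrightarrow> F x)"

text \<open>
  All functionals are total, so a function on the unit interval is a functional about whose values
  elsewhere nothing is required; likewise for moduli below.
\<close>

definition real_function :: "btm \<Rightarrow> bfm" where
  "real_function f =
    (all_unit (\<lambda>x. regular (f \<cdot> x)) \<^bold>\<and>
     all_unit (\<lambda>x. all_unit (\<lambda>y. x \<simeq> y \<^bold>\<longrightarrow> f \<cdot> x \<simeq> f \<cdot> y)))"

definition unif_continuous :: "btm \<Rightarrow> bfm" where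
  "unif_continuous f = ex NSeq (\<lambda>\<omega>. all Nat (\<lambda>k. all_unit (\<lambda>x. all_unit (\<lambda>y.
     near (\<omega> \<cdot> k) x y \<^bold>\<longrightarrow> near k (f \<cdot> x) (f \<cdot> y)))))"

text \<open>\<open>nless i n\<close> holds iff \<open>n = Suc (i + d)\<close> for some \<open>d\<close>.\<close>

definition nplus :: "btm \<Rightarrow> btm \<Rightarrow> btm" where
  "nplus m n = recur Nat m (lam Nat (\<lambda>i. lam Nat (\<lambda>r. suc r))) n"

definition nless :: "btm \<Rightarrow> btm \<Rightarrow> bfm" where
  "nless i n = ex Nat (\<lambda>d. n =\<^sub>N suc (nplus i d))"

subsection \<open>Moduli on the unit interval\<close>

definition modulus :: "btm \<Rightarrow> btm \<Rightarrow> bfm" where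
  "modulus f g = all Nat (\<lambda>k. all_unit (\<lambda>x. all_unit (\<lambda>y.
     near (g \<cdot> k \<cdot> x) x y \<^bold>\<longrightarrow> near k (f \<cdot> x) (f \<cdot> y))))"

text \<open>\<open>extensional\<close> says that \<open>g \<cdot> k\<close> is a function on a set whose equality is pointwise equality.
  Through \<open>Code\<close>, a sequence of rationals is viewed as a sequence of naturals.\<close>

definition extensional :: "btm \<Rightarrow> bfm" where
  "extensional g = all Nat (\<lambda>k. all_unit (\<lambda>x. all_unit (\<lambda>y.
     all Nat (\<lambda>i. cn Code \<cdot> (x \<cdot> i) =\<^sub>N cn Code \<cdot> (y \<cdot> i)) \<^bold>\<longrightarrow> g \<cdot> k \<cdot> x =\<^sub>N g \<cdot> k \<cdot> y)))"

definition continuous :: "btm \<Rightarrow> bfm" where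
  "continuous g = all Nat (\<lambda>k. all_unit (\<lambda>x. ex Nat (\<lambda>n. all_unit (\<lambda>y.
     all Nat (\<lambda>i. nless i n \<^bold>\<longrightarrow> cn Code \<cdot> (x \<cdot> i) =\<^sub>N cn Code \<cdot> (y \<cdot> i)) \<^bold>\<longrightarrow>
     g \<cdot> k \<cdot> x =\<^sub>N g \<cdot> k \<cdot> y))))"

definition UCTc :: bfm where
  "UCTc = all (Fun Seq Seq) (\<lambda>f. real_function f \<^bold>\<longrightarrow>
     ex (Fun Nat (Fun Seq Nat)) (\<lambda>g. extensional g \<^bold>\<and> modulus f g \<^bold>\<and> continuous g) \<^bold>\<longrightarrow>
     unif_continuous f)"

subsection \<open>Ternary moduli\<close>

definition ternary :: "btm \<Rightarrow> bfm" where
  "ternary \<alpha> = all Nat (\<lambda>n.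
     \<alpha> \<cdot> n =\<^sub>N zero \<^bold>\<or> \<alpha> \<cdot> n =\<^sub>N suc zero \<^bold>\<or> \<alpha> \<cdot> n =\<^sub>N suc (suc zero))"

abbreviation all_ternary :: "(btm \<Rightarrow> bfm) \<Rightarrow> bfm" where
  "all_ternary F \<equiv> all NSeq (\<lambda>\<alpha>. ternary \<alpha> \<^bold>\<longrightarrow> F \<alpha>)"

text \<open>\<open>tern_N \<alpha> n\<close> is the number $N(\overline{\alpha}n)$ of the initial segment of \<open>\<alpha>\<close> of length \<open>n\<close>, as a
  rational: the last entry of the segment of length \<open>m + 1\<close> is \<open>\<alpha> m\<close>, so the value there is
  $2N(\overline{\alpha}m) + (\alpha(m) - 1)$.\<close>

definition tern_N :: "btm \<Rightarrow> btm \<Rightarrow> btm" where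
  "tern_N \<alpha> n = recur Rat qone
     (lam Nat (\<lambda>m. lam Rat (\<lambda>r. (qone +\<^sub>Q qone) *\<^sub>Q r +\<^sub>Q (qnat (\<alpha> \<cdot> m) -\<^sub>Q qone)))) n"

definition Phi :: "btm \<Rightarrow> btm" where
  "Phi \<alpha> = lam Nat (\<lambda>n. pw (suc n) *\<^sub>Q tern_N \<alpha> n)"

definition ternary_modulus :: "btm \<Rightarrow> btm \<Rightarrow> bfm" where
  "ternary_modulus f g = all Nat (\<lambda>k. all_ternary (\<lambda>\<alpha>. all_unit (\<lambda>x.
     near (g \<cdot> k \<cdot> \<alpha>) (Phi \<alpha>) x \<^bold>\<longrightarrow> near k (f \<cdot> Phi \<alpha>) (f \<cdot> x))))"

definition ternary_extensional :: "btm \<Rightarrow> bfm" where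
  "ternary_extensional g = all Nat (\<lambda>k. all_ternary (\<lambda>\<alpha>. all_ternary (\<lambda>\<beta>.
     all Nat (\<lambda>i. \<alpha> \<cdot> i =\<^sub>N \<beta> \<cdot> i) \<^bold>\<longrightarrow> g \<cdot> k \<cdot> \<alpha> =\<^sub>N g \<cdot> k \<cdot> \<beta>)))"

definition ternary_continuous :: "btm \<Rightarrow> bfm" where
  "ternary_continuous g = all Nat (\<lambda>k. all_ternary (\<lambda>\<alpha>. ex Nat (\<lambda>n. all_ternary (\<lambda>\<beta>.
     all Nat (\<lambda>i. nless i n \<^bold>\<longrightarrow> \<alpha> \<cdot> i =\<^sub>N \<beta> \<cdot> i) \<^bold>\<longrightarrow> g \<cdot> k \<cdot> \<alpha> =\<^sub>N g \<cdot> k \<cdot> \<beta>))))"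

definition UCTc' :: bfm where
  "UCTc' = all (Fun Seq Seq) (\<lambda>f. real_function f \<^bold>\<longrightarrow>
     ex (Fun Nat (Fun NSeq Nat))
       (\<lambda>g. ternary_extensional g \<^bold>\<and> ternary_modulus f g \<^bold>\<and> ternary_continuous g) \<^bold>\<longrightarrow>
     unif_continuous f)"

subsection \<open>Both principles are well-typed sentences\<close>

lemmas builder_defs =
  bv_def cn_def app_def lam_def eqn_def falsum_def fconj_def fdisj_def fimpl_def all_def ex_def

lemmas notion_defs =
  pw_def qabs_def regular_def real_eq_def rle_def rconst_def rsub_def rabs_def near_def
  unit_interval_def real_function_def unif_continuous_def nplus_def nless_def modulus_def
  extensional_def continuous_def ternary_def tern_N_def Phi_def ternary_modulus_def
  ternary_extensional_def ternary_continuous_def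

lemma wff_UCTc: "wff [] (UCTc 0)"
  by (simp add: UCTc_def notion_defs builder_defs)

lemma wff_UCTc': "wff [] (UCTc' 0)"
  by (simp add: UCTc'_def notion_defs builder_defs)

lemma wff_ha_axioms: "\<phi> \<in> ha_axioms \<Longrightarrow> wff [] \<phi>"
  by (auto simp: ha_axioms_def nat_axioms_def rec_axioms_def rat_axioms_def builder_defs)

lemma pars_UCTc: "pars (UCTc 0) = {}" "pars (UCTc' 0) = {}"
  by (simp_all add: UCTc_def UCTc'_def notion_defs builder_defs)

end

theory Submission
  imports Defs
begin

text \<open>
  If \<open>g\<close> is a continuous modulus of \<open>f\<close>, then $h_k(\alpha) = g_k(\Phi(\alpha))$ is a continuous ternary
  modulus, because the entry of $\Phi(\alpha)$ at \<open>n\<close> depends only on the first \<open>n\<close> digits. Conversely, a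
  regular sequence \<open>x\<close> in the unit interval is turned into a ternary sequence $\alpha_x$ by comparing, at
  stage \<open>n\<close>, the entry of \<open>x\<close> at \<open>n + 3\<close> with $c_n = 2^{-(n+1)} N(\overline{\alpha_x} n)$ up to
  $2^{-(n+3)}$; rational comparison is decidable, so no choice is needed. This keeps
  $|x_{j+1} - c_n| \le 2^{-(n+1)} + 2^{-j}$ for all \<open>j\<close>, hence $\Phi(\alpha_x) \simeq x$, and
  $h_k(x) = g_k(\alpha_x)$ is a continuous modulus.
\<close>

section \<open>Metatheory of the calculus\<close>

text \<open>Three candidate intervals suffice for a decidable choice. With p = 2^{-(n+3)}, the real
  x lies within 4p of c_n, and the digits 0, 1, 2 offer the radius 2p around c_n - 2p, c_n and c_n +
  2p. Neighbouring intervals overlap in length 2p, so comparing an entry of error p with c_n - p and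
  c_n + p always selects a correct one; two halves meeting in a point would require an exact
  comparison of reals. The extra 2^{-j} is the error that the order of the reals tolerates at entry
  j + 1.

  All of this has to be derived inside the calculus. To argue in HOL, contexts are treated like the
  worlds of a Kripke model: facts persist in larger contexts, and disjunctions and existentials are
  eliminated towards a derivable goal. Rational terms are calculated with modulo provable equality.

  Since neither function extensionality nor the xi-rule is present, the sequences built from
  pointwise equal arguments are equal only entry by entry. The extensionality clause of the given
  modulus bridges this gap.\<close>

abbreviation closed :: "tm \<Rightarrow> ty \<Rightarrow> bool" where
  "closed t \<tau> \<equiv> tyof [] t = Some \<tau>"

notation App (infixl "$" 200)

section \<open>Typing and instantiation of indices\<close>

lemma tyof_App:
  "tyof Ts (s $ t) = Some \<tau> \<longleftrightarrow> (\<exists>\<sigma>. tyof Ts s = Some (Fun \<sigma> \<tau>) \<and> tyof Ts t = Some \<sigma>)"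
proof (cases "tyof Ts s")
  case (Some \<rho>)
  then show ?thesis by (cases \<rho>) auto
qed simp

lemma tyof_append: "tyof Ts t = Some \<tau> \<Longrightarrow> tyof (Ts @ Us) t = Some \<tau>"
proof (induction t arbitrary: Ts \<tau>)
  case (App s t)
  from App.prems obtain \<sigma> where "tyof Ts s = Some (Fun \<sigma> \<tau>)" "tyof Ts t = Some \<sigma>"
    unfolding tyof_App by blast
  from App.IH(1)[OF this(1)] App.IH(2)[OF this(2)] show ?case unfolding tyof_App by blast
next
  case (Lam \<sigma> t)
  from Lam.prems obtain \<tau>' where "tyof (\<sigma> # Ts) t = Some \<tau>'" "\<tau> = Fun \<sigma> \<tau>'" by auto
  with Lam.IH[of "\<sigma> # Ts" \<tau>'] show ?case by simp
qed (auto simp: nth_append split: if_splits)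

lemma tyof_closed: "closed t \<tau> \<Longrightarrow> tyof Ts t = Some \<tau>"
  using tyof_append[of "[]" t \<tau> Ts] by simp

lemma tyof_Cons_closed [simp]: "closed t \<tau> \<Longrightarrow> tyof (\<sigma> # Ts) t = Some \<tau>"
  by (rule tyof_closed)

lemma inst_tm_above: "tyof Ts t = Some \<tau> \<Longrightarrow> length Ts \<le> k \<Longrightarrow> inst_tm k u t = t"
proof (induction t arbitrary: Ts \<tau> k)
  case (App s t)
  from App.prems(1) obtain \<sigma> where "tyof Ts s = Some (Fun \<sigma> \<tau>)" "tyof Ts t = Some \<sigma>"
    unfolding tyof_App by blast
  then show ?case using App.IH App.prems(2) by simp
next
  case (Lam \<sigma> t)
  from Lam.prems obtain \<tau>' where "tyof (\<sigma> # Ts) t = Some \<tau>'" by auto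
  from Lam.IH[OF this] Lam.prems show ?case by simp
qed (auto split: if_splits)

lemma inst_tm_closed [simp]: "closed t \<tau> \<Longrightarrow> inst_tm k u t = t"
  by (rule inst_tm_above[of "[]"]) simp_all

text \<open>The index being instantiated is the outermost dangling one, last in the list of types,
  hence its number is \<open>length Ts\<close>. This form survives the passage under binders, which
  put new types in front.\<close>

lemma tyof_inst_tm:
  "tyof (Ts @ [\<sigma>]) t = Some \<tau> \<Longrightarrow> closed u \<sigma> \<Longrightarrow> tyof Ts (inst_tm (length Ts) u t) = Some \<tau>"
proof (induction t arbitrary: Ts \<tau>)
  case (Bnd i)
  then show ?case by (auto simp: nth_append intro: tyof_closed split: if_splits)
next
  case (App s t)
  from App.prems(1) obtain \<rho> where "tyof (Ts @ [\<sigma>]) s = Some (Fun \<rho> \<tau>)" "tyof (Ts @ [\<sigma>]) t = Some \<rho>"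
    unfolding tyof_App by blast
  from App.IH(1)[OF this(1) App.prems(2)] App.IH(2)[OF this(2) App.prems(2)]
  show ?case by simp
next
  case (Lam \<rho> t)
  from Lam.prems obtain \<tau>' where "tyof ((\<rho> # Ts) @ [\<sigma>]) t = Some \<tau>'" "\<tau> = Fun \<rho> \<tau>'"
    by auto
  with Lam.IH[of "\<rho> # Ts" \<tau>'] Lam.prems(2) show ?case by simp
qed auto

lemma wff_inst:
  "wff (Ts @ [\<sigma>]) \<phi> \<Longrightarrow> closed u \<sigma> \<Longrightarrow> wff Ts (inst (length Ts) u \<phi>)"
proof (induction \<phi> arbitrary: Ts)
  case (Forall \<tau> \<phi>)
  then show ?case using Forall.IH[of "\<tau> # Ts"] by simp
next
  case (Exists \<tau> \<phi>)
  then show ?case using Exists.IH[of "\<tau> # Ts"] by simp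
qed (auto simp: tyof_inst_tm)

lemma wff_inst_0: "wff [\<sigma>] \<phi> \<Longrightarrow> closed u \<sigma> \<Longrightarrow> wff [] (inst 0 u \<phi>)"
  using wff_inst[of "[]"] by simp

lemma derivable_wff: "\<Delta> \<turnstile> \<phi> \<Longrightarrow> wff [] \<phi>"
proof (induction rule: derivable.induct)
  case (D_ax \<phi> \<Delta>)
  then show ?case by (rule wff_ha_axioms)
next
  case (D_beta \<sigma> b t \<tau> \<Delta>)
  then obtain \<tau>' where "tyof [\<sigma>] b = Some \<tau>'" "\<tau> = \<tau>'" "closed t \<sigma>"
    by (auto split: option.splits ty.splits if_splits)
  then show ?case using D_beta tyof_inst_tm[of "[]" \<sigma> b \<tau> t] by auto
next
  case (D_leibniz \<Delta> \<tau> s t \<phi>)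
  then show ?case by (auto intro: wff_inst_0)
qed (auto intro: wff_inst_0)

section \<open>Substitution for parameters, and weakening\<close>

primrec psub_tm :: "(nat \<Rightarrow> ty \<Rightarrow> tm) \<Rightarrow> tm \<Rightarrow> tm" where
  "psub_tm \<sigma> (Bnd i) = Bnd i"
| "psub_tm \<sigma> (Par a \<tau>) = \<sigma> a \<tau>"
| "psub_tm \<sigma> (Con c) = Con c"
| "psub_tm \<sigma> (App s t) = App (psub_tm \<sigma> s) (psub_tm \<sigma> t)"
| "psub_tm \<sigma> (Lam \<tau> t) = Lam \<tau> (psub_tm \<sigma> t)"

primrec psub :: "(nat \<Rightarrow> ty \<Rightarrow> tm) \<Rightarrow> fm \<Rightarrow> fm" where
  "psub \<sigma> (Eq \<tau> s t) = Eq \<tau> (psub_tm \<sigma> s) (psub_tm \<sigma> t)"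
| "psub \<sigma> Falsum = Falsum"
| "psub \<sigma> (Conj \<phi> \<psi>) = Conj (psub \<sigma> \<phi>) (psub \<sigma> \<psi>)"
| "psub \<sigma> (Disj \<phi> \<psi>) = Disj (psub \<sigma> \<phi>) (psub \<sigma> \<psi>)"
| "psub \<sigma> (Impl \<phi> \<psi>) = Impl (psub \<sigma> \<phi>) (psub \<sigma> \<psi>)"
| "psub \<sigma> (Forall \<tau> \<phi>) = Forall \<tau> (psub \<sigma> \<phi>)"
| "psub \<sigma> (Exists \<tau> \<phi>) = Exists \<tau> (psub \<sigma> \<phi>)"

definition psubst :: "(nat \<Rightarrow> ty \<Rightarrow> tm) \<Rightarrow> bool" where
  "psubst \<sigma> \<longleftrightarrow> (\<forall>a \<tau>. closed (\<sigma> a \<tau>) \<tau>)"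

lemma tyof_psub: "psubst \<sigma> \<Longrightarrow> tyof Ts (psub_tm \<sigma> t) = tyof Ts t"
proof (induction t arbitrary: Ts)
  case (Par a \<tau>)
  then have "closed (\<sigma> a \<tau>) \<tau>" by (simp add: psubst_def)
  from tyof_closed[OF this] show ?case by simp
next
  case (App s t)
  then show ?case by (simp only: psub_tm.simps tyof.simps)
qed simp_all

lemma wff_psub: "psubst \<sigma> \<Longrightarrow> wff Ts (psub \<sigma> \<phi>) = wff Ts \<phi>"
  by (induction \<phi> arbitrary: Ts) (auto simp: tyof_psub)

lemma psub_tm_inst_tm:
  "psubst \<sigma> \<Longrightarrow> psub_tm \<sigma> (inst_tm k u t) = inst_tm k (psub_tm \<sigma> u) (psub_tm \<sigma> t)"
proof (induction t arbitrary: k)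
  case (Par a \<tau>)
  then have "closed (\<sigma> a \<tau>) \<tau>" by (simp add: psubst_def)
  then show ?case by simp
qed auto

lemma psub_inst: "psubst \<sigma> \<Longrightarrow> psub \<sigma> (inst k u \<phi>) = inst k (psub_tm \<sigma> u) (psub \<sigma> \<phi>)"
  by (induction \<phi> arbitrary: k) (auto simp: psub_tm_inst_tm)

lemma psub_tm_cong: "(\<And>a \<tau>. (a, \<tau>) \<in> pars_tm t \<Longrightarrow> \<sigma> a \<tau> = \<sigma>' a \<tau>) \<Longrightarrow> psub_tm \<sigma> t = psub_tm \<sigma>' t"
  by (induction t) auto

lemma psub_cong: "(\<And>a \<tau>. (a, \<tau>) \<in> pars \<phi> \<Longrightarrow> \<sigma> a \<tau> = \<sigma>' a \<tau>) \<Longrightarrow> psub \<sigma> \<phi> = psub \<sigma>' \<phi>"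
  by (induction \<phi>) (auto cong: psub_tm_cong intro!: psub_tm_cong)

lemma psub_tm_Par: "psub_tm Par t = t"
  by (induction t) auto

lemma psub_Par: "psub Par \<phi> = \<phi>"
  by (induction \<phi>) (auto simp: psub_tm_Par)

lemma psub_no_pars: "pars \<phi> = {} \<Longrightarrow> psub \<sigma> \<phi> = \<phi>"
  using psub_cong[of \<phi> \<sigma> Par] by (simp add: psub_Par)

lemma pars_ha_axioms: "\<phi> \<in> ha_axioms \<Longrightarrow> pars \<phi> = {}"
  by (auto simp: ha_axioms_def nat_axioms_def rec_axioms_def rat_axioms_def builder_defs)

lemma finite_pars: "finite (pars \<phi>)"
proof -
  have "finite (pars_tm t)" for t by (induction t) auto
  then show ?thesis by (induction \<phi>) auto
qed

lemma fresh_exists: "\<exists>a. fresh a \<tau> \<Delta>"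
proof -
  have "finite (\<Union>\<phi>\<in>set \<Delta>. fst ` pars \<phi>)" by (simp add: finite_pars)
  then obtain a where "a \<notin> (\<Union>\<phi>\<in>set \<Delta>. fst ` pars \<phi>)"
    using ex_new_if_finite infinite_UNIV_nat by blast
  then have "fresh a \<tau> \<Delta>" by (force simp: fresh_def)
  then show ?thesis ..
qed

text \<open>Weakening alone is too weak an induction statement, since an eigenvariable that is fresh
  for the small context may occur in the large one. With an arbitrary simultaneous substitution, the
  induction hypothesis can also rename the eigenvariable to one that is fresh for the target
  context.\<close>

lemma derivable_psub:
  "\<Delta> \<turnstile> \<phi> \<Longrightarrow> psubst \<sigma> \<Longrightarrow> psub \<sigma> ` set \<Delta> \<subseteq> set \<Delta>' \<Longrightarrow> \<Delta>' \<turnstile> psub \<sigma> \<phi>"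
proof (induction arbitrary: \<sigma> \<Delta>' rule: derivable.induct)
  case (D_hyp \<phi> \<Delta>)
  then show ?case by (auto intro!: derivable.D_hyp simp: wff_psub)
next
  case (D_ax \<phi> \<Delta>)
  then show ?case by (simp add: psub_no_pars pars_ha_axioms derivable.D_ax)
next
  case (D_falsumE \<Delta> \<phi>)
  then show ?case by (auto intro: derivable.D_falsumE simp: wff_psub)
next
  case (D_conjI \<Delta> \<phi> \<psi>)
  then show ?case by (simp add: derivable.D_conjI)
next
  case (D_conjE1 \<Delta> \<phi> \<psi>)
  then show ?case by (auto intro: derivable.D_conjE1)
next
  case (D_conjE2 \<Delta> \<phi> \<psi>)
  then show ?case by (auto intro: derivable.D_conjE2)
next
  case (D_disjI1 \<Delta> \<phi> \<psi>)
  then show ?case by (auto intro: derivable.D_disjI1 simp: wff_psub)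
next
  case (D_disjI2 \<Delta> \<psi> \<phi>)
  then show ?case by (auto intro: derivable.D_disjI2 simp: wff_psub)
next
  case (D_disjE \<Delta> \<phi> \<psi> \<chi>)
  have "\<Delta>' \<turnstile> Disj (psub \<sigma> \<phi>) (psub \<sigma> \<psi>)" using D_disjE by simp
  moreover have "psub \<sigma> \<phi> # \<Delta>' \<turnstile> psub \<sigma> \<chi>"
    using D_disjE.prems by (intro D_disjE.IH(2)) (auto simp: image_subset_iff)
  moreover have "psub \<sigma> \<psi> # \<Delta>' \<turnstile> psub \<sigma> \<chi>"
    using D_disjE.prems by (intro D_disjE.IH(3)) (auto simp: image_subset_iff)
  ultimately show ?case by (rule derivable.D_disjE)
next
  case (D_implI \<phi> \<Delta> \<psi>)
  have "psub \<sigma> \<phi> # \<Delta>' \<turnstile> psub \<sigma> \<psi>" using D_implI.prems by (intro D_implI.IH) (auto simp: image_subset_iff)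
  then show ?case using D_implI by (auto intro: derivable.D_implI simp: wff_psub)
next
  case (D_implE \<Delta> \<phi> \<psi>)
  then have "\<Delta>' \<turnstile> Impl (psub \<sigma> \<phi>) (psub \<sigma> \<psi>)" "\<Delta>' \<turnstile> psub \<sigma> \<phi>" by simp_all
  then show ?case by (rule derivable.D_implE)
next
  case (D_forallI a \<tau> \<phi> \<Delta>)
  obtain b where b: "fresh b \<tau> (psub \<sigma> \<phi> # \<Delta>')" using fresh_exists by blast
  \<comment> \<open>Redirecting the eigenvariable to \<open>b\<close> changes nothing in
    \<open>\<phi>\<close> and the context, where it does not occur; only the instance of
    \<open>\<phi>\<close> at the eigenvariable is affected.\<close>
  define \<sigma>' where "\<sigma>' = \<sigma>(a := (\<sigma> a)(\<tau> := Par b \<tau>))"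
  have s: "psubst \<sigma>'" using D_forallI by (auto simp: psubst_def \<sigma>'_def)
  have eq: "psub \<sigma>' \<psi> = psub \<sigma> \<psi>" if "\<psi> \<in> set (\<phi> # \<Delta>)" for \<psi>
    by (rule psub_cong) (use that D_forallI in \<open>auto simp: \<sigma>'_def fresh_def\<close>)
  have "psub \<sigma>' ` set \<Delta> \<subseteq> set \<Delta>'" using eq D_forallI.prems by (auto simp: image_subset_iff)
  then have "\<Delta>' \<turnstile> psub \<sigma>' (inst 0 (Par a \<tau>) \<phi>)" using D_forallI.IH s by blast
  then have "\<Delta>' \<turnstile> inst 0 (Par b \<tau>) (psub \<sigma> \<phi>)"
    using eq[of \<phi>] by (simp add: psub_inst s) (simp add: \<sigma>'_def)
  then show ?case using b D_forallI by (auto intro: derivable.D_forallI simp: wff_psub)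
next
  case (D_forallE \<Delta> \<tau> \<phi> t)
  have "\<Delta>' \<turnstile> Forall \<tau> (psub \<sigma> \<phi>)" using D_forallE by simp
  from derivable.D_forallE[OF this, of "psub_tm \<sigma> t"] show ?case
    using D_forallE by (simp add: tyof_psub psub_inst)
next
  case (D_existsI t \<tau> \<phi> \<Delta>)
  have "\<Delta>' \<turnstile> inst 0 (psub_tm \<sigma> t) (psub \<sigma> \<phi>)" using D_existsI by (simp add: psub_inst[symmetric])
  then show ?case
    using D_existsI derivable.D_existsI[of "psub_tm \<sigma> t"] by (simp add: tyof_psub wff_psub)
next
  case (D_existsE \<Delta> \<tau> \<phi> a \<psi>)
  obtain b where b: "fresh b \<tau> (psub \<sigma> \<psi> # psub \<sigma> \<phi> # \<Delta>')" using fresh_exists by blast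
  define \<sigma>' where "\<sigma>' = \<sigma>(a := (\<sigma> a)(\<tau> := Par b \<tau>))"
  have s: "psubst \<sigma>'" using D_existsE by (auto simp: psubst_def \<sigma>'_def)
  have eq: "psub \<sigma>' \<chi> = psub \<sigma> \<chi>" if "\<chi> \<in> set (\<psi> # \<phi> # \<Delta>)" for \<chi>
    by (rule psub_cong) (use that D_existsE in \<open>auto simp: \<sigma>'_def fresh_def\<close>)
  have "psub \<sigma>' (inst 0 (Par a \<tau>) \<phi>) = inst 0 (Par b \<tau>) (psub \<sigma> \<phi>)"
    using eq[of \<phi>] by (simp add: psub_inst s) (simp add: \<sigma>'_def)
  moreover have "psub \<sigma>' ` set \<Delta> \<subseteq> set \<Delta>'"
    using eq D_existsE.prems by (auto simp: image_subset_iff)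
  ultimately have "psub \<sigma>' ` set (inst 0 (Par a \<tau>) \<phi> # \<Delta>)
      \<subseteq> set (inst 0 (Par b \<tau>) (psub \<sigma> \<phi>) # \<Delta>')" by auto
  then have "inst 0 (Par b \<tau>) (psub \<sigma> \<phi>) # \<Delta>' \<turnstile> psub \<sigma> \<psi>"
    using D_existsE.IH(2) s eq[of \<psi>] by fastforce
  moreover have "\<Delta>' \<turnstile> Exists \<tau> (psub \<sigma> \<phi>)" using D_existsE by simp
  ultimately show ?case using b by (blast intro: derivable.D_existsE)
next
  case (D_refl t \<tau> \<Delta>)
  then show ?case by (simp add: derivable.D_refl tyof_psub)
next
  case (D_leibniz \<Delta> \<tau> s t \<phi>)
  have "\<Delta>' \<turnstile> Eq \<tau> (psub_tm \<sigma> s) (psub_tm \<sigma> t)" using D_leibniz by simp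
  moreover have "wff [\<tau>] (psub \<sigma> \<phi>)" using D_leibniz by (simp add: wff_psub)
  moreover have "\<Delta>' \<turnstile> inst 0 (psub_tm \<sigma> s) (psub \<sigma> \<phi>)"
    using D_leibniz by (simp add: psub_inst[symmetric])
  ultimately have "\<Delta>' \<turnstile> inst 0 (psub_tm \<sigma> t) (psub \<sigma> \<phi>)" by (rule derivable.D_leibniz)
  then show ?case using D_leibniz by (simp add: psub_inst)
next
  case (D_beta \<rho> b t \<tau> \<Delta>)
  have "tyof [] (psub_tm \<sigma> (Lam \<rho> b $ t)) = Some \<tau>"
    using D_beta by (simp only: tyof_psub)
  then show ?case using D_beta derivable.D_beta[of \<rho> "psub_tm \<sigma> b" "psub_tm \<sigma> t" \<tau> \<Delta>']
    by (simp only: psub.simps psub_tm.simps psub_tm_inst_tm)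
next
  case (D_induct \<phi> a \<Delta>)
  obtain b where b: "fresh b Nat (psub \<sigma> \<phi> # \<Delta>')" using fresh_exists by blast
  define \<sigma>' where "\<sigma>' = \<sigma>(a := (\<sigma> a)(Nat := Par b Nat))"
  have s: "psubst \<sigma>'" using D_induct by (auto simp: psubst_def \<sigma>'_def)
  have eq: "psub \<sigma>' \<chi> = psub \<sigma> \<chi>" if "\<chi> \<in> set (\<phi> # \<Delta>)" for \<chi>
    by (rule psub_cong) (use that D_induct in \<open>auto simp: \<sigma>'_def fresh_def\<close>)
  have e1: "psub \<sigma>' (inst 0 (Par a Nat) \<phi>) = inst 0 (Par b Nat) (psub \<sigma> \<phi>)"
    and e2: "psub \<sigma>' (inst 0 (Con Succ $ Par a Nat) \<phi>) = inst 0 (Con Succ $ Par b Nat) (psub \<sigma> \<phi>)"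
    using eq[of \<phi>] by (simp_all add: psub_inst s) (simp_all add: \<sigma>'_def)
  have "psub \<sigma>' ` set (inst 0 (Par a Nat) \<phi> # \<Delta>) \<subseteq> set (inst 0 (Par b Nat) (psub \<sigma> \<phi>) # \<Delta>')"
    using eq D_induct.prems e1 by (auto simp: image_subset_iff)
  from D_induct.IH(2)[OF s this]
  have "inst 0 (Par b Nat) (psub \<sigma> \<phi>) # \<Delta>' \<turnstile> inst 0 (Con Succ $ Par b Nat) (psub \<sigma> \<phi>)"
    by (simp only: e2)
  moreover have "\<Delta>' \<turnstile> inst 0 (Con Zero) (psub \<sigma> \<phi>)"
    using D_induct.IH(1)[OF D_induct.prems] D_induct.prems by (simp add: psub_inst)
  ultimately show ?case using b D_induct by (auto intro: derivable.D_induct simp: wff_psub)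
qed

lemma weaken: "\<Delta> \<turnstile> \<phi> \<Longrightarrow> set \<Delta> \<subseteq> set \<Delta>' \<Longrightarrow> \<Delta>' \<turnstile> \<phi>"
  using derivable_psub[of \<Delta> \<phi> Par \<Delta>'] by (simp add: psubst_def psub_Par)

lemma weaken_Nil: "[] \<turnstile> \<phi> \<Longrightarrow> \<Delta> \<turnstile> \<phi>"
  by (erule weaken) simp

section \<open>Derivability as forcing\<close>

text \<open>
  A second notation that binds tighter than the connectives of HOL. Universal formulas and
  implications are read as HOL quantifications, the latter over all larger contexts.
\<close>

notation derivable (infix "\<tturnstile>" 50)

lemma hyp_Cons: "wff [] \<phi> \<Longrightarrow> \<phi> # \<Delta> \<tturnstile> \<phi>"
  by (simp add: D_hyp)

text \<open>\<open>closed\<close> excludes dangling indices but allows parameters, so a fresh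
  parameter is itself one of the terms quantified over, and its instance yields the universal
  formula.\<close>

lemma forall_iff:
  "wff [\<tau>] \<phi> \<Longrightarrow> \<Delta> \<tturnstile> Forall \<tau> \<phi> \<longleftrightarrow> (\<forall>t. closed t \<tau> \<longrightarrow> \<Delta> \<tturnstile> inst 0 t \<phi>)"
  using fresh_exists[of \<tau> "\<phi> # \<Delta>"] D_forallE[of \<Delta> \<tau> \<phi>] D_forallI[of _ \<tau> \<phi> \<Delta>] by force

text \<open>From right to left, the extension \<open>\<phi> # \<Delta>\<close> is the decisive one;
  from left to right, the implication is carried to the larger context by
  \<open>weaken\<close>.\<close>

lemma impl_iff:
  "wff [] \<phi> \<Longrightarrow> \<Delta> \<tturnstile> Impl \<phi> \<psi> \<longleftrightarrow> (\<forall>\<Delta>'. set \<Delta> \<subseteq> set \<Delta>' \<longrightarrow> \<Delta>' \<tturnstile> \<phi> \<longrightarrow> \<Delta>' \<tturnstile> \<psi>)"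
proof safe
  fix \<Delta>' assume "\<Delta> \<tturnstile> Impl \<phi> \<psi>" "set \<Delta> \<subseteq> set \<Delta>'" "\<Delta>' \<tturnstile> \<phi>"
  then show "\<Delta>' \<tturnstile> \<psi>" using D_implE weaken by blast
next
  assume *: "\<forall>\<Delta>'. set \<Delta> \<subseteq> set \<Delta>' \<longrightarrow> \<Delta>' \<tturnstile> \<phi> \<longrightarrow> \<Delta>' \<tturnstile> \<psi>" and w: "wff [] \<phi>"
  have "\<phi> # \<Delta> \<tturnstile> \<psi>" using *[rule_format, of "\<phi> # \<Delta>"] w
    by (simp add: subset_insertI hyp_Cons)
  then show "\<Delta> \<tturnstile> Impl \<phi> \<psi>" by (rule D_implI[OF w])
qed

lemma conj_iff: "\<Delta> \<tturnstile> Conj \<phi> \<psi> \<longleftrightarrow> \<Delta> \<tturnstile> \<phi> \<and> \<Delta> \<tturnstile> \<psi>"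
  using D_conjI D_conjE1 D_conjE2 by blast

text \<open>A derivable disjunction need not have a derivable disjunct, so there is no HOL
  equivalence as for conjunction. What remains is elimination towards a derivable goal, each case in
  a context that knows its disjunct; the same holds for existence.\<close>

lemma disj_cases:
  assumes "\<Delta> \<tturnstile> Disj \<phi> \<psi>"
    and "\<And>\<Delta>'. set \<Delta> \<subseteq> set \<Delta>' \<Longrightarrow> \<Delta>' \<tturnstile> \<phi> \<Longrightarrow> \<Delta>' \<tturnstile> \<chi>"
    and "\<And>\<Delta>'. set \<Delta> \<subseteq> set \<Delta>' \<Longrightarrow> \<Delta>' \<tturnstile> \<psi> \<Longrightarrow> \<Delta>' \<tturnstile> \<chi>"
  shows "\<Delta> \<tturnstile> \<chi>"
proof -
  have "wff [] \<phi>" "wff [] \<psi>" using derivable_wff[OF assms(1)] by auto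
  then have "\<phi> # \<Delta> \<tturnstile> \<chi>" "\<psi> # \<Delta> \<tturnstile> \<chi>" 
    using assms(2)[of "\<phi> # \<Delta>"] assms(3)[of "\<psi> # \<Delta>"]
    by (simp_all add: subset_insertI hyp_Cons)
  then show ?thesis by (rule D_disjE[OF assms(1)])
qed

lemma exists_cases:
  assumes "\<Delta> \<tturnstile> Exists \<tau> \<phi>"
    and "\<And>\<Delta>' t. set \<Delta> \<subseteq> set \<Delta>' \<Longrightarrow> closed t \<tau> \<Longrightarrow> \<Delta>' \<tturnstile> inst 0 t \<phi> \<Longrightarrow> \<Delta>' \<tturnstile> \<psi>"
  shows "\<Delta> \<tturnstile> \<psi>"
proof -
  obtain a where a: "fresh a \<tau> (\<psi> # \<phi> # \<Delta>)" using fresh_exists by blast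
  have "wff [] (inst 0 (Par a \<tau>) \<phi>)" using derivable_wff[OF assms(1)] by (auto intro: wff_inst_0)
  then have "inst 0 (Par a \<tau>) \<phi> # \<Delta> \<tturnstile> \<psi>" by (intro assms(2)[of _ "Par a \<tau>"]) (auto intro: D_hyp)
  then show ?thesis by (rule D_existsE[OF assms(1) a])
qed

lemma nat_induction:
  assumes "closed n Nat" "wff [Nat] \<phi>" "\<Delta> \<tturnstile> inst 0 (Con Zero) \<phi>"
    and "\<And>\<Delta>' m. set \<Delta> \<subseteq> set \<Delta>' \<Longrightarrow> closed m Nat \<Longrightarrow> \<Delta>' \<tturnstile> inst 0 m \<phi> \<Longrightarrow>
      \<Delta>' \<tturnstile> inst 0 (Con Succ $ m) \<phi>"
  shows "\<Delta> \<tturnstile> inst 0 n \<phi>"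
proof -
  obtain a where a: "fresh a Nat (\<phi> # \<Delta>)" using fresh_exists by blast
  have "inst 0 (Par a Nat) \<phi> # \<Delta> \<tturnstile> inst 0 (Con Succ $ Par a Nat) \<phi>"
    by (intro assms(4)) (auto intro!: D_hyp wff_inst_0 assms(2))
  from D_forallE[OF D_induct[OF assms(2) a assms(3) this] assms(1)] show ?thesis .
qed

section \<open>Equality and congruence in the calculus\<close>

lemma eq_closed: "\<Delta> \<tturnstile> Eq \<tau> s t \<Longrightarrow> closed s \<tau> \<and> closed t \<tau>"
  using derivable_wff[of \<Delta> "Eq \<tau> s t"] by simp

lemma eq_sym: "\<Delta> \<tturnstile> Eq \<tau> s t \<Longrightarrow> \<Delta> \<tturnstile> Eq \<tau> t s"
  using D_leibniz[of \<Delta> \<tau> s t "Eq \<tau> (Bnd 0) s"] eq_closed[of \<Delta> \<tau> s t] D_refl[of s \<tau> \<Delta>] by simp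

lemma eq_trans [trans]: "\<Delta> \<tturnstile> Eq \<tau> s t \<Longrightarrow> \<Delta> \<tturnstile> Eq \<tau> t u \<Longrightarrow> \<Delta> \<tturnstile> Eq \<tau> s u"
  using D_leibniz[of \<Delta> \<tau> t u "Eq \<tau> s (Bnd 0)"] eq_closed[of \<Delta> \<tau> s t] by simp

lemma eq_arg: "\<Delta> \<tturnstile> Eq \<sigma> s t \<Longrightarrow> closed f (Fun \<sigma> \<tau>) \<Longrightarrow> \<Delta> \<tturnstile> Eq \<tau> (f $ s) (f $ t)"
  using D_leibniz[of \<Delta> \<sigma> s t "Eq \<tau> (f $ s) (f $ Bnd 0)"] eq_closed[of \<Delta> \<sigma> s t]
    D_refl[of "f $ s" \<tau> \<Delta>] by simp

lemma eq_fun: "\<Delta> \<tturnstile> Eq (Fun \<sigma> \<tau>) f g \<Longrightarrow> closed t \<sigma> \<Longrightarrow> \<Delta> \<tturnstile> Eq \<tau> (f $ t) (g $ t)"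
  using D_leibniz[of \<Delta> "Fun \<sigma> \<tau>" f g "Eq \<tau> (f $ t) (Bnd 0 $ t)"]
    eq_closed[of \<Delta> "Fun \<sigma> \<tau>" f g] D_refl[of "f $ t" \<tau> \<Delta>] by simp

lemma eq_app:
  "\<Delta> \<tturnstile> Eq (Fun \<sigma> \<tau>) f g \<Longrightarrow> \<Delta> \<tturnstile> Eq \<sigma> s t \<Longrightarrow> \<Delta> \<tturnstile> Eq \<tau> (f $ s) (g $ t)"
  by (rule eq_trans[OF eq_fun eq_arg]) (auto dest: eq_closed)

lemma eq_beta:
  "closed (Lam \<sigma> b $ t) \<tau> \<Longrightarrow> inst_tm 0 t b = r \<Longrightarrow> \<Delta> \<tturnstile> Eq \<tau> (Lam \<sigma> b $ t) r"
  using D_beta by blast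

section \<open>Rational arithmetic\<close>

abbreviation sucT :: "tm \<Rightarrow> tm" where "sucT n \<equiv> Con Succ $ n"
abbreviation natT :: "tm \<Rightarrow> tm" where "natT n \<equiv> Con OfNat $ n"
abbreviation addT :: "tm \<Rightarrow> tm \<Rightarrow> tm" where "addT s t \<equiv> Con QPlus $ s $ t"
abbreviation negT :: "tm \<Rightarrow> tm" where "negT s \<equiv> Con QNeg $ s"
abbreviation mulT :: "tm \<Rightarrow> tm \<Rightarrow> tm" where "mulT s t \<equiv> Con QTimes $ s $ t"
abbreviation leqT :: "tm \<Rightarrow> tm \<Rightarrow> tm" where "leqT s t \<equiv> Con QLeq $ s $ t"
abbreviation leF :: "tm \<Rightarrow> tm \<Rightarrow> fm" where "leF s t \<equiv> Eq Nat (leqT s t) (Con Zero)"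
abbreviation recT :: "ty \<Rightarrow> tm \<Rightarrow> tm \<Rightarrow> tm \<Rightarrow> tm" where "recT \<tau> a h n \<equiv> Con (Rec \<tau>) $ a $ h $ n"
abbreviation twoT :: tm where "twoT \<equiv> addT (Con QOne) (Con QOne)"
abbreviation halfT :: tm where "halfT \<equiv> Con QInv $ twoT"

lemma axiom: "A \<in> nat_axioms \<union> rec_axioms \<union> rat_axioms \<Longrightarrow> \<Delta> \<tturnstile> A 0"
  by (auto simp: ha_axioms_def intro: D_ax)

lemma rat_axioms_derivable: "\<forall>A\<in>rat_axioms. \<Delta> \<tturnstile> A 0"
  by (simp add: axiom)

lemma rat_ring:
  assumes [simp]: "closed x Rat" "closed y Rat"
  shows "\<Delta> \<tturnstile> Eq Rat (addT x y) (addT y x)"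
    and "\<Delta> \<tturnstile> Eq Rat (mulT x y) (mulT y x)"
    and "closed z Rat \<Longrightarrow> \<Delta> \<tturnstile> Eq Rat (addT (addT x y) z) (addT x (addT y z))"
    and "closed z Rat \<Longrightarrow> \<Delta> \<tturnstile> Eq Rat (mulT (mulT x y) z) (mulT x (mulT y z))"
    and "closed z Rat \<Longrightarrow> \<Delta> \<tturnstile> Eq Rat (mulT (addT x y) z) (addT (mulT x z) (mulT y z))"
  using rat_axioms_derivable[of \<Delta>]
  by (simp_all add: rat_axioms_def builder_defs forall_iff)

lemma rat_unit:
  assumes [simp]: "closed x Rat"
  shows "\<Delta> \<tturnstile> Eq Rat (addT (natT (Con Zero)) x) x"
    and "\<Delta> \<tturnstile> Eq Rat (mulT (Con QOne) x) x"
    and "\<Delta> \<tturnstile> Eq Rat (addT x (negT x)) (natT (Con Zero))"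
  using rat_axioms_derivable[of \<Delta>]
  by (simp_all add: rat_axioms_def builder_defs forall_iff)

lemma rat_order:
  assumes [simp]: "closed x Rat" "closed y Rat"
  shows leF_decidable: "\<Delta> \<tturnstile> Disj (leF x y) (Eq Nat (leqT x y) (sucT (Con Zero)))"
    and leF_linear: "\<Delta> \<tturnstile> Disj (leF x y) (leF y x)"
    and "\<Delta> \<tturnstile> Impl (Conj (leF x y) (leF y x)) (Eq Rat x y)"
    and "closed z Rat \<Longrightarrow> \<Delta> \<tturnstile> Impl (Conj (leF x y) (leF y z)) (leF x z)"
    and "closed z Rat \<Longrightarrow> \<Delta> \<tturnstile> Impl (leF x y) (leF (addT x z) (addT y z))"
    and "\<Delta> \<tturnstile> Impl (Conj (leF (natT (Con Zero)) x) (leF (natT (Con Zero)) y))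
      (leF (natT (Con Zero)) (mulT x y))"
  using rat_axioms_derivable[of \<Delta>]
  by (simp_all add: rat_axioms_def builder_defs forall_iff)

lemmas leF_antisym = D_implE[OF rat_order(3) D_conjI]
lemmas leF_trans = D_implE[OF rat_order(4) D_conjI]
lemmas leF_add = D_implE[OF rat_order(5)]
lemmas leF_mult = D_implE[OF rat_order(6) D_conjI]

lemma rat_field:
  shows "\<Delta> \<tturnstile> Impl (Eq Rat (Con QOne) (natT (Con Zero))) Falsum"
    and "closed x Rat \<Longrightarrow> \<Delta> \<tturnstile> Impl (Impl (Eq Rat x (natT (Con Zero))) Falsum)
      (Eq Rat (mulT x (Con QInv $ x)) (Con QOne))"
  using rat_axioms_derivable[of \<Delta>]
  by (simp_all add: rat_axioms_def builder_defs forall_iff)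

lemma ofnat_suc: "closed n Nat \<Longrightarrow> \<Delta> \<tturnstile> Eq Rat (natT (sucT n)) (addT (natT n) (Con QOne))"
  using rat_axioms_derivable[of \<Delta>]
  by (simp add: rat_axioms_def builder_defs forall_iff)

lemma decode_code: "closed x Rat \<Longrightarrow> \<Delta> \<tturnstile> Eq Rat (Con Decode $ (Con Code $ x)) x"
  using rat_axioms_derivable[of \<Delta>]
  by (simp add: rat_axioms_def builder_defs forall_iff)

lemma suc_not_zero: "closed n Nat \<Longrightarrow> \<Delta> \<tturnstile> Impl (Eq Nat (sucT n) (Con Zero)) Falsum"
proof -
  assume [simp]: "closed n Nat"
  have "\<forall>A\<in>nat_axioms. \<Delta> \<tturnstile> A 0" by (simp add: axiom)
  then show ?thesis by (simp add: nat_axioms_def builder_defs forall_iff)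
qed

lemma
  assumes [simp]: "closed a \<tau>" "closed h (Fun Nat (Fun \<tau> \<tau>))"
  shows rec_zero: "\<Delta> \<tturnstile> Eq \<tau> (recT \<tau> a h (Con Zero)) a"
    and rec_suc: "closed n Nat \<Longrightarrow> \<Delta> \<tturnstile> Eq \<tau> (recT \<tau> a h (sucT n)) (h $ n $ recT \<tau> a h n)"
proof -
  have "\<Delta> \<tturnstile> all \<tau> (\<lambda>a. all (Fun Nat (Fun \<tau> \<tau>)) (\<lambda>h. eqn \<tau> (recur \<tau> a h zero) a)) 0"
    "\<Delta> \<tturnstile> all \<tau> (\<lambda>a. all (Fun Nat (Fun \<tau> \<tau>)) (\<lambda>h. all Nat (\<lambda>n.
            eqn \<tau> (recur \<tau> a h (suc n)) (h \<cdot> n \<cdot> recur \<tau> a h n)))) 0"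
    by (rule axiom, force simp: rec_axioms_def)+
  then show "\<Delta> \<tturnstile> Eq \<tau> (recT \<tau> a h (Con Zero)) a"
    "closed n Nat \<Longrightarrow> \<Delta> \<tturnstile> Eq \<tau> (recT \<tau> a h (sucT n)) (h $ n $ recT \<tau> a h n)"
    by (simp_all add: builder_defs forall_iff)
qed

text \<open>The empty context is chosen so that a single quotient serves all contexts. An equation
  that holds only under hypotheses enters the ring as a pair of inequalities, by
  \<open>eq_leq\<close>.\<close>

definition rat_equiv :: "tm \<Rightarrow> tm \<Rightarrow> bool" where
  "rat_equiv s t \<longleftrightarrow> [] \<tturnstile> Eq Rat s t"

lemma rat_equiv_refl: "rat_equiv t t \<longleftrightarrow> closed t Rat"
  using eq_closed D_refl by (auto simp: rat_equiv_def)

text \<open>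
  Closed terms of rational type modulo provable equality form a commutative ring in HOL, so that
  the ring identities of the object theory can be left to the simplifier. The class
  \<open>comm_ring_1\<close> is out of reach, since \<open>0 \<noteq> 1\<close> would express consistency of the calculus.
\<close>

quotient_type ratq = tm / partial: rat_equiv
proof (rule part_equivpI)
  show "\<exists>t. rat_equiv t t" by (rule exI[of _ "Con QOne"]) (simp add: rat_equiv_refl)
  show "symp rat_equiv" by (auto simp: symp_def rat_equiv_def intro: eq_sym)
  show "transp rat_equiv" by (auto simp: transp_def rat_equiv_def intro: eq_trans)
qed

notation abs_ratq ("\<langle>_\<rangle>")

lemma ratq_cases: obtains t where "a = \<langle>t\<rangle>" "closed t Rat"
  by (induction a rule: ratq.abs_induct) (auto simp: rat_equiv_refl)

lemma ratq_eqI: "[] \<tturnstile> Eq Rat s t \<Longrightarrow> \<langle>s\<rangle> = \<langle>t\<rangle>"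
  using Quotient3_rel_abs[OF Quotient3_ratq] by (simp add: rat_equiv_def)

instantiation ratq :: "{comm_ring, comm_monoid_mult}"
begin

lift_definition zero_ratq :: ratq is "natT (Con Zero)" by (simp add: rat_equiv_refl)
lift_definition one_ratq :: ratq is "Con QOne" by (simp add: rat_equiv_refl)
lift_definition uminus_ratq :: "ratq \<Rightarrow> ratq" is negT
  by (auto simp: rat_equiv_def intro: eq_arg)
lift_definition plus_ratq :: "ratq \<Rightarrow> ratq \<Rightarrow> ratq" is addT
  unfolding rat_equiv_def by (rule eq_app[OF eq_arg]) simp_all
lift_definition minus_ratq :: "ratq \<Rightarrow> ratq \<Rightarrow> ratq" is "\<lambda>s t. addT s (negT t)"
  unfolding rat_equiv_def by (rule eq_app[OF eq_arg eq_arg], assumption, simp, assumption, simp)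
lift_definition times_ratq :: "ratq \<Rightarrow> ratq \<Rightarrow> ratq" is mulT
  unfolding rat_equiv_def by (rule eq_app[OF eq_arg]) simp_all

instance
proof
  fix a b c :: ratq
  show "a + b + c = a + (b + c)" "a * b * c = a * (b * c)" "(a + b) * c = a * c + b * c"
    "a + b = b + a" "a * b = b * a"
    by (transfer, simp add: rat_equiv_refl, simp add: rat_equiv_def rat_ring)+
  show "0 + a = a" "1 * a = a"
    by (transfer, simp add: rat_equiv_refl, simp add: rat_equiv_def rat_unit)+
  show "- a + a = 0"
    by (transfer, simp only: rat_equiv_refl, simp add: rat_equiv_def)
      (rule eq_trans[OF rat_ring(1) rat_unit(3)], simp_all)
  show "a - b = a + - b"
    by (transfer, simp only: rat_equiv_refl, simp add: rat_equiv_def D_refl)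
qed

end

lemma ratq_simps [simp]:
  "\<langle>natT (Con Zero)\<rangle> = 0" "\<langle>Con QOne\<rangle> = 1"
  "closed s Rat \<Longrightarrow> closed t Rat \<Longrightarrow> \<langle>addT s t\<rangle> = \<langle>s\<rangle> + \<langle>t\<rangle>"
  "closed s Rat \<Longrightarrow> closed t Rat \<Longrightarrow> \<langle>mulT s t\<rangle> = \<langle>s\<rangle> * \<langle>t\<rangle>"
  "closed s Rat \<Longrightarrow> \<langle>negT s\<rangle> = - \<langle>s\<rangle>"
  by (simp_all add: zero_ratq.abs_eq one_ratq.abs_eq plus_ratq.abs_eq times_ratq.abs_eq
      uminus_ratq.abs_eq rat_equiv_refl)

lemma ratq_natT_suc [simp]: "closed n Nat \<Longrightarrow> \<langle>natT (sucT n)\<rangle> = \<langle>natT n\<rangle> + 1"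
  using ratq_eqI[OF ofnat_suc] by simp

section \<open>The order of the rationals, relative to a context\<close>

lift_definition leq :: "fm list \<Rightarrow> ratq \<Rightarrow> ratq \<Rightarrow> bool" is "\<lambda>\<Delta> s t. \<Delta> \<tturnstile> leF s t"
proof -
  fix \<Delta> s s' t t' assume "rat_equiv s s'" "rat_equiv t t'"
  then have "[] \<tturnstile> Eq Nat (leqT s t) (leqT s' t')"
    unfolding rat_equiv_def by (intro eq_app[OF eq_arg, of _ Rat s s' _ Rat]) simp_all
  then have eq: "\<Delta> \<tturnstile> Eq Nat (leqT s t) (leqT s' t')" by (rule weaken_Nil)
  show "(\<Delta> \<tturnstile> leF s t) = (\<Delta> \<tturnstile> leF s' t')"
    using eq_trans[OF eq] eq_trans[OF eq_sym[OF eq]] by blast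
qed

lemma leq_iff: "closed s Rat \<Longrightarrow> closed t Rat \<Longrightarrow> \<Delta> \<tturnstile> leF s t \<longleftrightarrow> leq \<Delta> \<langle>s\<rangle> \<langle>t\<rangle>"
  by (simp add: leq.abs_eq rat_equiv_refl)

lemma leq_weaken: "leq \<Delta> a b \<Longrightarrow> set \<Delta> \<subseteq> set \<Delta>' \<Longrightarrow> leq \<Delta>' a b"
  by transfer (rule weaken)

lemma leq_trans [trans]: "leq \<Delta> a b \<Longrightarrow> leq \<Delta> b c \<Longrightarrow> leq \<Delta> a c"
  by transfer (simp only: rat_equiv_refl, rule leF_trans)

lemma leq_add_right: "leq \<Delta> a b \<Longrightarrow> leq \<Delta> (a + c) (b + c)"
  by transfer (simp only: rat_equiv_refl leF_add leF_mult)

lemma leq_mult_nonneg: "leq \<Delta> 0 a \<Longrightarrow> leq \<Delta> 0 b \<Longrightarrow> leq \<Delta> 0 (a * b)"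
  by transfer (simp only: rat_equiv_refl leF_add leF_mult)

lemma leq_total:
  assumes "\<And>\<Delta>'. set \<Delta> \<subseteq> set \<Delta>' \<Longrightarrow> leq \<Delta>' a b \<Longrightarrow> \<Delta>' \<tturnstile> \<phi>"
    and "\<And>\<Delta>'. set \<Delta> \<subseteq> set \<Delta>' \<Longrightarrow> leq \<Delta>' b a \<Longrightarrow> \<Delta>' \<tturnstile> \<phi>"
  shows "\<Delta> \<tturnstile> \<phi>"
proof -
  obtain s t where st: "a = \<langle>s\<rangle>" "b = \<langle>t\<rangle>" and [simp]: "closed s Rat" "closed t Rat"
    by (metis ratq_cases)
  have "\<Delta> \<tturnstile> Disj (leF s t) (leF t s)" by (simp add: leF_linear)
  then show ?thesis by (rule disj_cases) (auto intro: assms simp: leq_iff st)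
qed

text \<open>\<open>leq\<close> is itself derivability of a formula, so the case distinction of the
  calculus may be eliminated towards it.\<close>

lemma leq_totalI:
  assumes "\<And>\<Delta>'. set \<Delta> \<subseteq> set \<Delta>' \<Longrightarrow> leq \<Delta>' a b \<Longrightarrow> leq \<Delta>' c d"
    and "\<And>\<Delta>'. set \<Delta> \<subseteq> set \<Delta>' \<Longrightarrow> leq \<Delta>' b a \<Longrightarrow> leq \<Delta>' c d"
  shows "leq \<Delta> c d"
proof -
  obtain s t where "c = \<langle>s\<rangle>" "d = \<langle>t\<rangle>" "closed s Rat" "closed t Rat"
    by (metis ratq_cases)
  with leq_total[of \<Delta> a b "leF s t"] assms show ?thesis by (simp add: leq_iff)
qed

lemma leq_refl: "leq \<Delta> a a"
  by (rule leq_totalI[of _ a a])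

text \<open>An inequality depends only on the difference of its sides. This gives the pattern for
  linear arithmetic below: add up the known inequalities, then leave a ring identity to the
  simplifier.\<close>

lemma leq_shift: "leq \<Delta> a b \<Longrightarrow> b - a = d - c \<Longrightarrow> leq \<Delta> c d"
  using leq_add_right[of \<Delta> a b "c - a"] by (simp add: algebra_simps)

lemma leq_add: "leq \<Delta> a b \<Longrightarrow> leq \<Delta> c d \<Longrightarrow> leq \<Delta> (a + c) (b + d)"
  using leq_trans[of \<Delta> "a + c" "b + c" "b + d"] leq_add_right[of \<Delta> a b c] leq_add_right[of \<Delta> c d b]
  by (simp add: add.commute)

lemma leq_mult_left: "leq \<Delta> 0 c \<Longrightarrow> leq \<Delta> a b \<Longrightarrow> leq \<Delta> (c * a) (c * b)"
  by (rule leq_shift[OF leq_mult_nonneg[of _ c "b - a"]])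
    (auto intro: leq_shift simp: algebra_simps)

text \<open>If 1 \<le> 0, then 0 \<le> -1, and the product of this inequality with itself is 0 \<le>
  1.\<close>

lemma leq_zero_one: "leq \<Delta> 0 1"
proof (rule leq_totalI[of _ 0 1])
  fix \<Delta>' assume "leq \<Delta>' 1 0"
  then have "leq \<Delta>' 0 (-1)" by (rule leq_shift) simp
  from leq_mult_nonneg[OF this this] show "leq \<Delta>' 0 1" by simp
qed

lemma not_leq_one_zero: "leq \<Delta> 1 0 \<Longrightarrow> \<Delta> \<tturnstile> Falsum"
  using leq_zero_one[of \<Delta>] leF_antisym[of "Con QOne" "natT (Con Zero)" \<Delta>]
    D_implE[OF rat_field(1)[of \<Delta>]]
  by (simp add: leq_iff)

lemma eq_leq: "\<Delta> \<tturnstile> Eq Rat s t \<Longrightarrow> leq \<Delta> \<langle>s\<rangle> \<langle>t\<rangle>"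
proof -
  assume st: "\<Delta> \<tturnstile> Eq Rat s t"
  then have [simp]: "closed s Rat" "closed t Rat" by (auto dest: eq_closed)
  have "\<Delta> \<tturnstile> Eq Nat (leqT s s) (leqT s t)" using st by (rule eq_arg) simp
  then have "\<Delta> \<tturnstile> Eq Nat (leqT s t) (leqT s s)" by (rule eq_sym)
  moreover have "\<Delta> \<tturnstile> leF s s" by (simp add: leq_iff leq_refl)
  ultimately have "\<Delta> \<tturnstile> leF s t" by (rule eq_trans)
  then show ?thesis by (simp add: leq_iff)
qed

text \<open>The field axiom inverts 2 only after 2 = 0 has been refuted: adding 0 \<le> 1 to 2 \<le>
  0 gives 1 \<le> 0.\<close>

lemma half_add_half: "\<langle>halfT\<rangle> + \<langle>halfT\<rangle> = 1"
proof -
  have "[] \<tturnstile> Impl (Eq Rat twoT (natT (Con Zero))) Falsum"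
  proof (simp add: impl_iff, safe)
    fix \<Delta> assume "\<Delta> \<tturnstile> Eq Rat twoT (natT (Con Zero))"
    then have "leq \<Delta> (1 + 1) 0" using eq_leq by fastforce
    from leq_add[OF this leq_zero_one[of \<Delta>]] have "leq \<Delta> 1 0"
      by (rule leq_shift) simp
    then show "\<Delta> \<tturnstile> Falsum" by (rule not_leq_one_zero)
  qed
  then have "[] \<tturnstile> Eq Rat (mulT twoT halfT) (Con QOne)"
    by (intro D_implE[OF rat_field(2)]) simp_all
  from ratq_eqI[OF this] show ?thesis by (simp add: algebra_simps)
qed

lemma half_nonneg: "leq \<Delta> 0 \<langle>halfT\<rangle>"
proof (rule leq_totalI[of _ 0 "\<langle>halfT\<rangle>"])
  fix \<Delta>' assume "leq \<Delta>' \<langle>halfT\<rangle> 0"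
  from leq_add[OF this this] have "leq \<Delta>' 1 0" by (simp add: half_add_half)
  from not_leq_one_zero[OF this] have "\<Delta>' \<tturnstile> leF (natT (Con Zero)) halfT"
    by (rule D_falsumE) simp
  then show "leq \<Delta>' 0 \<langle>halfT\<rangle>" by (simp add: leq_iff)
qed

text \<open>The value 1 of the characteristic function is incompatible with the value 0, so
  linearity leaves the converse inequality.\<close>

lemma not_leqD:
  assumes "closed s Rat" "closed t Rat" "\<Delta> \<tturnstile> Eq Nat (leqT s t) (sucT (Con Zero))"
  shows "leq \<Delta> \<langle>t\<rangle> \<langle>s\<rangle>"
proof (rule leq_totalI[of _ "\<langle>s\<rangle>" "\<langle>t\<rangle>"])
  fix \<Delta>' assume sub: "set \<Delta> \<subseteq> set \<Delta>'" and "leq \<Delta>' \<langle>s\<rangle> \<langle>t\<rangle>"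
  then have "\<Delta>' \<tturnstile> leF s t" using assms by (simp add: leq_iff)
  then have "\<Delta>' \<tturnstile> Eq Nat (sucT (Con Zero)) (Con Zero)"
    by (rule eq_trans[OF eq_sym[OF weaken[OF assms(3) sub]]])
  from D_implE[OF suc_not_zero this] have "\<Delta>' \<tturnstile> Falsum" by simp
  then have "\<Delta>' \<tturnstile> leF t s" by (rule D_falsumE) (simp add: assms)
  then show "leq \<Delta>' \<langle>t\<rangle> \<langle>s\<rangle>" by (simp add: leq_iff assms)
qed

lemma leq_disj_cases:
  assumes "\<Delta> \<tturnstile> Disj \<phi> \<psi>"
    and "\<And>\<Delta>'. set \<Delta> \<subseteq> set \<Delta>' \<Longrightarrow> \<Delta>' \<tturnstile> \<phi> \<Longrightarrow> leq \<Delta>' a b"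
    and "\<And>\<Delta>'. set \<Delta> \<subseteq> set \<Delta>' \<Longrightarrow> \<Delta>' \<tturnstile> \<psi> \<Longrightarrow> leq \<Delta>' a b"
  shows "leq \<Delta> a b"
proof -
  obtain s t where "a = \<langle>s\<rangle>" "b = \<langle>t\<rangle>" "closed s Rat" "closed t Rat"
    by (metis ratq_cases)
  with disj_cases[OF assms(1), of "leF s t"] assms(2,3) show ?thesis by (simp add: leq_iff)
qed

text \<open>The outer reduction takes place in function position, where congruence is available, so
  no reduction under an abstraction is required.\<close>

lemma eq_beta2:
  assumes "closed (Lam \<sigma> (Lam \<rho> b)) (Fun \<sigma> (Fun \<rho> \<tau>))" "closed s \<sigma>" "closed t \<rho>"
  shows "\<Delta> \<tturnstile> Eq \<tau> (Lam \<sigma> (Lam \<rho> b) $ s $ t) (inst_tm 0 t (inst_tm (Suc 0) s b))"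
proof -
  have c: "closed (Lam \<rho> (inst_tm (Suc 0) s b)) (Fun \<rho> \<tau>)"
    using assms tyof_inst_tm[of "[\<rho>]" \<sigma> b \<tau> s] by auto
  have "\<Delta> \<tturnstile> Eq (Fun \<rho> \<tau>) (Lam \<sigma> (Lam \<rho> b) $ s) (Lam \<rho> (inst_tm (Suc 0) s b))"
    using assms by (intro eq_beta) auto
  from eq_fun[OF this assms(3)] show ?thesis
    by (rule eq_trans) (rule eq_beta, use c assms in auto)
qed

lemma rec_lam_suc:
  assumes "closed a \<tau>" "closed (Lam Nat (Lam \<tau> b)) (Fun Nat (Fun \<tau> \<tau>))" "closed n Nat"
    and "inst_tm 0 (recT \<tau> a (Lam Nat (Lam \<tau> b)) n) (inst_tm (Suc 0) n b) = r"
  shows "\<Delta> \<tturnstile> Eq \<tau> (recT \<tau> a (Lam Nat (Lam \<tau> b)) (sucT n)) r"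
  using eq_trans[OF rec_suc[OF assms(1-3)] eq_beta2[OF assms(2,3)]] assms by auto

lemma ratq_beta [simp]: "closed (Lam \<sigma> b $ t) Rat \<Longrightarrow> \<langle>Lam \<sigma> b $ t\<rangle> = \<langle>inst_tm 0 t b\<rangle>"
  by (intro ratq_eqI eq_beta) simp_all

section \<open>Powers of one half\<close>

definition pwT :: "tm \<Rightarrow> tm" where
  "pwT n = recT Rat (Con QOne) (Lam Nat (Lam Rat (mulT halfT (Bnd 0)))) n"

lemma pw_eq: "pw n d = pwT (n d)"
  by (simp add: pw_def pwT_def builder_defs)

lemma pwT_syntax [simp]:
  "tyof Ts n = Some Nat \<Longrightarrow> tyof Ts (pwT n) = Some Rat"
  "inst_tm k u (pwT n) = pwT (inst_tm k u n)"
  by (simp_all add: pwT_def)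

lemma pwT_zero [simp]: "\<langle>pwT (Con Zero)\<rangle> = 1"
  unfolding pwT_def by (subst ratq_eqI[OF rec_zero]) simp_all

lemma pwT_suc: "closed n Nat \<Longrightarrow> \<langle>pwT (sucT n)\<rangle> = \<langle>halfT\<rangle> * \<langle>pwT n\<rangle>"
  unfolding pwT_def by (subst ratq_eqI[OF rec_lam_suc[OF _ _ _ refl]]) simp_all

lemma pwT_double: "closed n Nat \<Longrightarrow> \<langle>pwT n\<rangle> = \<langle>pwT (sucT n)\<rangle> + \<langle>pwT (sucT n)\<rangle>"
  by (simp add: pwT_suc distrib_right[symmetric] half_add_half)

lemma pwT_nonneg: "closed n Nat \<Longrightarrow> leq \<Delta> 0 \<langle>pwT n\<rangle>"
  using nat_induction[of n "leF (natT (Con Zero)) (pwT (Bnd 0))" \<Delta>]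
  by (simp add: leq_iff leq_zero_one pwT_suc leq_mult_nonneg half_nonneg)

text \<open>
  \<open>qabs q\<close> and the notions that use it mention their arguments at two binding depths; the
  definitions below keep the two occurrences apart.
\<close>

definition absT2 :: "tm \<Rightarrow> tm \<Rightarrow> tm" where
  "absT2 q q' = recT Rat q (Lam Nat (Lam Rat (negT q'))) (leqT (natT (Con Zero)) q)"

abbreviation absT :: "tm \<Rightarrow> tm" where "absT q \<equiv> absT2 q q"

lemma qabs_eq: "qabs q d = absT2 (q d) (q (Suc (Suc d)))"
  by (simp add: qabs_def absT2_def builder_defs)

lemma absT2_syntax [simp]:
  "tyof Ts q = Some Rat \<Longrightarrow> tyof (Rat # Nat # Ts) q' = Some Rat \<Longrightarrow> tyof Ts (absT2 q q') = Some Rat"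
  "inst_tm k u (absT2 q q') = absT2 (inst_tm k u q) (inst_tm (Suc (Suc k)) u q')"
  by (simp_all add: absT2_def)

lemma absT_nonneg:
  assumes [simp]: "closed q Rat" and "\<Delta> \<tturnstile> leF (natT (Con Zero)) q"
  shows "\<Delta> \<tturnstile> Eq Rat (absT q) q"
  unfolding absT2_def by (rule eq_trans[OF eq_arg[OF assms(2)] rec_zero]) simp_all

lemma absT_nonpos:
  assumes [simp]: "closed q Rat" and "\<Delta> \<tturnstile> Eq Nat (leqT (natT (Con Zero)) q) (sucT (Con Zero))"
  shows "\<Delta> \<tturnstile> Eq Rat (absT q) (negT q)"
proof -
  let ?h = "Lam Nat (Lam Rat (negT q))"
  have "\<Delta> \<tturnstile> Eq Rat (absT q) (recT Rat q ?h (sucT (Con Zero)))"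
    unfolding absT2_def by (rule eq_arg[OF assms(2)]) simp
  also have "\<Delta> \<tturnstile> Eq Rat (recT Rat q ?h (sucT (Con Zero))) (negT q)"
    by (rule rec_lam_suc) simp_all
  finally show ?thesis .
qed

text \<open>The sign of \<open>q\<close> is decided here once and for all; from now on a bound on an
  absolute value is a pair of linear inequalities.\<close>

lemma leq_absT_iff:
  assumes [simp]: "closed q Rat"
  shows "leq \<Delta> \<langle>absT q\<rangle> c \<longleftrightarrow> leq \<Delta> \<langle>q\<rangle> c \<and> leq \<Delta> (- \<langle>q\<rangle>) c"
proof -
  \<comment> \<open>The equation for the absolute value holds only in the context of the respective
    case, so it is passed on as two inequalities.\<close>
  have cases: "leq \<Delta> a b"
    if 1: "\<And>\<Delta>'. set \<Delta> \<subseteq> set \<Delta>' \<Longrightarrow> leq \<Delta>' 0 \<langle>q\<rangle> \<Longrightarrow> leq \<Delta>' \<langle>absT q\<rangle> \<langle>q\<rangle> \<Longrightarrow>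
          leq \<Delta>' \<langle>q\<rangle> \<langle>absT q\<rangle> \<Longrightarrow> leq \<Delta>' a b"
      and 2: "\<And>\<Delta>'. set \<Delta> \<subseteq> set \<Delta>' \<Longrightarrow> leq \<Delta>' \<langle>q\<rangle> 0 \<Longrightarrow> leq \<Delta>' \<langle>absT q\<rangle> (- \<langle>q\<rangle>) \<Longrightarrow>
          leq \<Delta>' (- \<langle>q\<rangle>) \<langle>absT q\<rangle> \<Longrightarrow> leq \<Delta>' a b" for a b
  proof (rule leq_disj_cases[OF leF_decidable[of "natT (Con Zero)" q]])
    fix \<Delta>' assume sub: "set \<Delta> \<subseteq> set \<Delta>'" and le: "\<Delta>' \<tturnstile> leF (natT (Con Zero)) q"
    from absT_nonneg[OF _ le] have "\<Delta>' \<tturnstile> Eq Rat (absT q) q" by simp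
    from 1[OF sub _ eq_leq[OF this] eq_leq[OF eq_sym[OF this]]] le show "leq \<Delta>' a b"
      by (simp add: leq_iff)
  next
    fix \<Delta>' assume sub: "set \<Delta> \<subseteq> set \<Delta>'"
      and gt: "\<Delta>' \<tturnstile> Eq Nat (leqT (natT (Con Zero)) q) (sucT (Con Zero))"
    from absT_nonpos[OF _ gt] have "\<Delta>' \<tturnstile> Eq Rat (absT q) (negT q)" by simp
    from 2[OF sub _ _ ] eq_leq[OF this] eq_leq[OF eq_sym[OF this]] not_leqD[OF _ _ gt]
    show "leq \<Delta>' a b" by simp
  qed simp_all
  have neg: "leq \<Delta>' (- \<langle>q\<rangle>) \<langle>q\<rangle>" if "leq \<Delta>' 0 \<langle>q\<rangle>" for \<Delta>'
    by (rule leq_shift[OF leq_add[OF that that]]) simp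
  have pos: "leq \<Delta>' \<langle>q\<rangle> (- \<langle>q\<rangle>)" if "leq \<Delta>' \<langle>q\<rangle> 0" for \<Delta>'
    by (rule leq_shift[OF leq_add[OF that that]]) simp
  have "leq \<Delta> \<langle>q\<rangle> \<langle>absT q\<rangle>" by (rule cases) (assumption, blast intro: leq_trans pos)
  moreover have "leq \<Delta> (- \<langle>q\<rangle>) \<langle>absT q\<rangle>" by (rule cases) (blast intro: leq_trans neg, assumption)
  moreover have "leq \<Delta> \<langle>absT q\<rangle> c" if "leq \<Delta> \<langle>q\<rangle> c" "leq \<Delta> (- \<langle>q\<rangle>) c"
    by (rule cases) (blast intro: leq_trans that leq_weaken)+
  ultimately show ?thesis by (blast intro: leq_trans)
qed

section \<open>Addition of naturals\<close>

definition nplusT :: "tm \<Rightarrow> tm \<Rightarrow> tm" where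
  "nplusT m n = recT Nat m (Lam Nat (Lam Nat (sucT (Bnd 0)))) n"

lemma nplus_eq: "nplus m n d = nplusT (m d) (n d)"
  by (simp add: nplus_def nplusT_def builder_defs)

lemma nplusT_syntax [simp]:
  "tyof Ts m = Some Nat \<Longrightarrow> tyof Ts n = Some Nat \<Longrightarrow> tyof Ts (nplusT m n) = Some Nat"
  "inst_tm k u (nplusT m n) = nplusT (inst_tm k u m) (inst_tm k u n)"
  by (simp_all add: nplusT_def)

lemma nplusT_zero: "closed m Nat \<Longrightarrow> \<Delta> \<tturnstile> Eq Nat (nplusT m (Con Zero)) m"
  unfolding nplusT_def by (rule rec_zero) simp_all

lemma nplusT_suc:
  "closed m Nat \<Longrightarrow> closed n Nat \<Longrightarrow> \<Delta> \<tturnstile> Eq Nat (nplusT m (sucT n)) (sucT (nplusT m n))"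
  unfolding nplusT_def by (rule rec_lam_suc) simp_all

lemma eq_suc: "\<Delta> \<tturnstile> Eq Nat m n \<Longrightarrow> \<Delta> \<tturnstile> Eq Nat (sucT m) (sucT n)"
  by (erule eq_arg) simp

lemma nplusT_zero_left: "closed n Nat \<Longrightarrow> \<Delta> \<tturnstile> Eq Nat (nplusT (Con Zero) n) n"
  using nat_induction[of n "Eq Nat (nplusT (Con Zero) (Bnd 0)) (Bnd 0)" \<Delta>]
    eq_trans[OF nplusT_suc eq_suc, of "Con Zero"] by (simp add: nplusT_zero)

lemma nplusT_suc_left:
  assumes [simp]: "closed m Nat" "closed n Nat"
  shows "\<Delta> \<tturnstile> Eq Nat (nplusT (sucT m) n) (sucT (nplusT m n))"
proof -
  have "\<Delta> \<tturnstile> inst 0 n (Eq Nat (nplusT (sucT m) (Bnd 0)) (sucT (nplusT m (Bnd 0))))"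
  proof (rule nat_induction)
    show "\<Delta> \<tturnstile> inst 0 (Con Zero) (Eq Nat (nplusT (sucT m) (Bnd 0)) (sucT (nplusT m (Bnd 0))))"
      using eq_trans[OF nplusT_zero eq_suc[OF eq_sym[OF nplusT_zero]]] by simp
  next
    fix \<Delta>' i assume [simp]: "closed i Nat"
      and "\<Delta>' \<tturnstile> inst 0 i (Eq Nat (nplusT (sucT m) (Bnd 0)) (sucT (nplusT m (Bnd 0))))"
    then have "\<Delta>' \<tturnstile> Eq Nat (nplusT (sucT m) i) (sucT (nplusT m i))" by simp
    then have "\<Delta>' \<tturnstile> Eq Nat (sucT (nplusT (sucT m) i)) (sucT (sucT (nplusT m i)))" by (rule eq_suc)
    also have "\<Delta>' \<tturnstile> Eq Nat (sucT (sucT (nplusT m i))) (sucT (nplusT m (sucT i)))"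
      by (rule eq_suc[OF eq_sym[OF nplusT_suc]]) simp_all
    finally have "\<Delta>' \<tturnstile> Eq Nat (sucT (nplusT (sucT m) i)) (sucT (nplusT m (sucT i)))" .
    with nplusT_suc[of "sucT m" i \<Delta>']
    show "\<Delta>' \<tturnstile> inst 0 (sucT i) (Eq Nat (nplusT (sucT m) (Bnd 0)) (sucT (nplusT m (Bnd 0))))"
      by (simp add: eq_trans[of _ _ _ "sucT (nplusT (sucT m) i)"])
  qed simp_all
  then show ?thesis by simp
qed

lemma nplusT_commute:
  assumes [simp]: "closed m Nat" "closed n Nat"
  shows "\<Delta> \<tturnstile> Eq Nat (nplusT m n) (nplusT n m)"
proof -
  have "\<Delta> \<tturnstile> inst 0 n (Eq Nat (nplusT m (Bnd 0)) (nplusT (Bnd 0) m))"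
  proof (rule nat_induction)
    show "\<Delta> \<tturnstile> inst 0 (Con Zero) (Eq Nat (nplusT m (Bnd 0)) (nplusT (Bnd 0) m))"
      using eq_trans[OF nplusT_zero eq_sym[OF nplusT_zero_left]] by simp
  next
    fix \<Delta>' i assume [simp]: "closed i Nat"
      and "\<Delta>' \<tturnstile> inst 0 i (Eq Nat (nplusT m (Bnd 0)) (nplusT (Bnd 0) m))"
    then have "\<Delta>' \<tturnstile> Eq Nat (nplusT m i) (nplusT i m)" by simp
    from eq_trans[OF nplusT_suc eq_trans[OF eq_suc[OF this] eq_sym[OF nplusT_suc_left]]]
    show "\<Delta>' \<tturnstile> inst 0 (sucT i) (Eq Nat (nplusT m (Bnd 0)) (nplusT (Bnd 0) m))" by simp
  qed simp_all
  then show ?thesis by simp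
qed

section \<open>The notions of the two principles\<close>

abbreviation K :: "tm \<Rightarrow> btm" where "K t \<equiv> \<lambda>d. t"

definition regF :: "tm \<Rightarrow> tm \<Rightarrow> fm" where
  "regF x x' = Forall Nat (leF (absT2 (addT (x $ Bnd 0) (negT (x $ sucT (Bnd 0))))
     (addT (x' $ Bnd 2) (negT (x' $ sucT (Bnd 2))))) (pwT (sucT (Bnd 0))))"

definition equivF :: "tm \<Rightarrow> tm \<Rightarrow> tm \<Rightarrow> tm \<Rightarrow> fm" where
  "equivF x x' y y' = Forall Nat (leF (absT2 (addT (x $ sucT (Bnd 0)) (negT (y $ sucT (Bnd 0))))
     (addT (x' $ sucT (Bnd 2)) (negT (y' $ sucT (Bnd 2))))) (pwT (Bnd 0)))"

definition unitF :: "tm \<Rightarrow> tm \<Rightarrow> fm" where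
  "unitF x x' = Conj (regF x x')
     (Conj (Forall Nat (leF (Lam Nat (natT (Con Zero)) $ sucT (Bnd 0)) (addT (x $ sucT (Bnd 0)) (pwT (Bnd 0)))))
       (Forall Nat (leF (x $ sucT (Bnd 0)) (addT (Lam Nat (Con QOne) $ sucT (Bnd 0)) (pwT (Bnd 0))))))"

definition nearF :: "tm \<Rightarrow> tm \<Rightarrow> tm \<Rightarrow> tm \<Rightarrow> tm \<Rightarrow> fm" where
  "nearF k x x' y y' = Forall Nat (leF
     (Lam Nat (absT2 (Lam Nat (addT (x $ sucT (Bnd 0)) (negT (y $ sucT (Bnd 0)))) $ Bnd 0)
       (Lam Nat (addT (x' $ sucT (Bnd 0)) (negT (y' $ sucT (Bnd 0)))) $ Bnd 2)) $ sucT (Bnd 0))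
     (addT (Lam Nat (pwT k) $ sucT (Bnd 0)) (pwT (Bnd 0))))"

text \<open>A single argument suffices here and in \<open>nlessF\<close>, because all occurrences of
  each argument lie at the same binding depth.\<close>

definition ternF :: "tm \<Rightarrow> fm" where "ternF a = ternary (K a) 0"
definition nlessF :: "tm \<Rightarrow> tm \<Rightarrow> fm" where "nlessF i n = nless (K i) (K n) 0"

text \<open>The offsets count binders: one for the quantifier of the notion, one for each
  abstraction in \<open>rconst\<close>, \<open>rabs\<close> and \<open>rsub\<close>, and two more
  for the copy inside the negative branch of \<open>qabs\<close>.\<close>

lemma formula_eq:
  "regular x d = regF (x (d + 1)) (x (d + 3))"
  "(x \<simeq> y) d = equivF (x (d + 1)) (x (d + 3)) (y (d + 1)) (y (d + 3))"
  "unit_interval x d = unitF (x (d + 1)) (x (d + 3))"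
  "near k x y d = nearF (k (d + 2)) (x (d + 3)) (x (d + 5)) (y (d + 3)) (y (d + 5))"
  "ternary a d = ternF (a (d + 1))"
  "nless i n d = nlessF (i (d + 1)) (n (d + 1))"
  by (simp_all add: regF_def equivF_def unitF_def nearF_def ternF_def nlessF_def regular_def
      real_eq_def unit_interval_def near_def ternary_def nless_def rle_def rsub_def rabs_def
      rconst_def pw_eq qabs_eq nplus_eq builder_defs eval_nat_numeral)

lemmas formula_defs = regF_def equivF_def unitF_def nearF_def ternF_def nlessF_def ternary_def
  nless_def nplus_eq builder_defs

lemma formula_inst [simp]:
  "inst k u (regF x x') = regF (inst_tm (k + 1) u x) (inst_tm (k + 3) u x')"
  "inst k u (equivF x x' y y') = equivF (inst_tm (k + 1) u x) (inst_tm (k + 3) u x')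
     (inst_tm (k + 1) u y) (inst_tm (k + 3) u y')"
  "inst k u (unitF x x') = unitF (inst_tm (k + 1) u x) (inst_tm (k + 3) u x')"
  "inst k u (nearF n x x' y y') = nearF (inst_tm (k + 2) u n) (inst_tm (k + 3) u x)
     (inst_tm (k + 5) u x') (inst_tm (k + 3) u y) (inst_tm (k + 5) u y')"
  "inst k u (ternF x) = ternF (inst_tm (k + 1) u x)"
  "inst k u (nlessF x y) = nlessF (inst_tm (k + 1) u x) (inst_tm (k + 1) u y)"
  by (simp_all add: formula_defs eval_nat_numeral)

lemma formula_wff [simp]:
  "tyof (Nat # Ts) x = Some Seq \<Longrightarrow> tyof (Rat # Nat # Nat # Ts) x' = Some Seq \<Longrightarrow> wff Ts (regF x x')"
  "tyof (Nat # Ts) x = Some Seq \<Longrightarrow> tyof (Rat # Nat # Nat # Ts) x' = Some Seq \<Longrightarrow>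
   tyof (Nat # Ts) y = Some Seq \<Longrightarrow> tyof (Rat # Nat # Nat # Ts) y' = Some Seq \<Longrightarrow> wff Ts (equivF x x' y y')"
  "tyof (Nat # Ts) x = Some Seq \<Longrightarrow> tyof (Rat # Nat # Nat # Ts) x' = Some Seq \<Longrightarrow> wff Ts (unitF x x')"
  "tyof (Nat # Nat # Ts) k = Some Nat \<Longrightarrow>
   tyof (Nat # Nat # Nat # Ts) x = Some Seq \<Longrightarrow> tyof (Nat # Rat # Nat # Nat # Nat # Ts) x' = Some Seq \<Longrightarrow>
   tyof (Nat # Nat # Nat # Ts) y = Some Seq \<Longrightarrow> tyof (Nat # Rat # Nat # Nat # Nat # Ts) y' = Some Seq \<Longrightarrow>
   wff Ts (nearF k x x' y y')"
  "tyof (Nat # Ts) a = Some NSeq \<Longrightarrow> wff Ts (ternF a)"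
  "tyof (Nat # Ts) i = Some Nat \<Longrightarrow> tyof (Nat # Ts) n = Some Nat \<Longrightarrow> wff Ts (nlessF i n)"
  by (simp_all add: formula_defs)

section \<open>The notions read as statements about closed terms\<close>

definition within :: "fm list \<Rightarrow> ratq \<Rightarrow> ratq \<Rightarrow> ratq \<Rightarrow> bool" where
  "within \<Delta> e a b \<longleftrightarrow> leq \<Delta> (a - b) e \<and> leq \<Delta> (b - a) e"

lemma leF_absT_iff:
  "closed s Rat \<Longrightarrow> closed t Rat \<Longrightarrow> closed e Rat \<Longrightarrow>
    \<Delta> \<tturnstile> leF (absT (addT s (negT t))) e \<longleftrightarrow> within \<Delta> \<langle>e\<rangle> \<langle>s\<rangle> \<langle>t\<rangle>"
  by (simp add: leq_iff leq_absT_iff within_def)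

lemma regF_iff:
  "closed x Seq \<Longrightarrow> \<Delta> \<tturnstile> regF x x \<longleftrightarrow>
    (\<forall>n. closed n Nat \<longrightarrow> within \<Delta> \<langle>pwT (sucT n)\<rangle> \<langle>x $ n\<rangle> \<langle>x $ sucT n\<rangle>)"
  by (simp add: regF_def forall_iff leF_absT_iff)

lemma equivF_iff:
  "closed x Seq \<Longrightarrow> closed y Seq \<Longrightarrow> \<Delta> \<tturnstile> equivF x x y y \<longleftrightarrow>
    (\<forall>n. closed n Nat \<longrightarrow> within \<Delta> \<langle>pwT n\<rangle> \<langle>x $ sucT n\<rangle> \<langle>y $ sucT n\<rangle>)"
  by (simp add: equivF_def forall_iff leF_absT_iff)

lemma unitF_iff:
  "closed x Seq \<Longrightarrow> \<Delta> \<tturnstile> unitF x x \<longleftrightarrow> \<Delta> \<tturnstile> regF x x \<and>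
    (\<forall>n. closed n Nat \<longrightarrow> leq \<Delta> 0 (\<langle>x $ sucT n\<rangle> + \<langle>pwT n\<rangle>) \<and> leq \<Delta> \<langle>x $ sucT n\<rangle> (1 + \<langle>pwT n\<rangle>))"
  by (auto simp: unitF_def forall_iff conj_iff leq_iff)

text \<open>\<open>rle\<close> and \<open>rsub\<close> each shift the index by one, which is why the
  entries compared are those at \<open>n + 2\<close>.\<close>

lemma nearF_iff:
  "closed k Nat \<Longrightarrow> closed x Seq \<Longrightarrow> closed y Seq \<Longrightarrow> \<Delta> \<tturnstile> nearF k x x y y \<longleftrightarrow>
    (\<forall>n. closed n Nat \<longrightarrow>
      within \<Delta> (\<langle>pwT k\<rangle> + \<langle>pwT n\<rangle>) \<langle>x $ sucT (sucT n)\<rangle> \<langle>y $ sucT (sucT n)\<rangle>)"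
  by (simp add: nearF_def forall_iff leq_iff leq_absT_iff within_def)

lemma nlessF_I:
  "closed i Nat \<Longrightarrow> closed d Nat \<Longrightarrow> \<Delta> \<tturnstile> Eq Nat n (sucT (nplusT i d)) \<Longrightarrow> \<Delta> \<tturnstile> nlessF i n"
  using eq_closed[of \<Delta> Nat n "sucT (nplusT i d)"]
  by (auto simp: nlessF_def nless_def nplus_eq builder_defs intro!: D_existsI[of d])

lemma nlessF_cases:
  assumes "\<Delta> \<tturnstile> nlessF i n" and [simp]: "closed i Nat" "closed n Nat"
    and "\<And>\<Delta>' d. set \<Delta> \<subseteq> set \<Delta>' \<Longrightarrow> closed d Nat \<Longrightarrow> \<Delta>' \<tturnstile> Eq Nat n (sucT (nplusT i d)) \<Longrightarrow> \<Delta>' \<tturnstile> \<phi>"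
  shows "\<Delta> \<tturnstile> \<phi>"
  using assms(1) unfolding nlessF_def nless_def ex_def
  by (rule exists_cases) (auto intro: assms(4) simp: nplus_eq builder_defs)

lemma nlessF_suc: "closed i Nat \<Longrightarrow> \<Delta> \<tturnstile> nlessF i (sucT i)"
  by (rule nlessF_I[of _ "Con Zero"]) (simp_all add: eq_suc eq_sym nplusT_zero)

lemma nlessF_sucD:
  assumes [simp]: "closed i Nat" "closed n Nat" and "\<Delta> \<tturnstile> nlessF (sucT i) n"
  shows "\<Delta> \<tturnstile> nlessF i n"
  using assms(3)
proof (rule nlessF_cases)
  fix \<Delta>' d assume [simp]: "closed d Nat" and *: "\<Delta>' \<tturnstile> Eq Nat n (sucT (nplusT (sucT i) d))"
  show "\<Delta>' \<tturnstile> nlessF i n"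
    by (rule nlessF_I[of _ "sucT d"], simp_all)
      (rule eq_trans[OF * eq_suc[OF eq_trans[OF nplusT_suc_left eq_sym[OF nplusT_suc]]]], simp_all)
qed simp_all

lemma nlessF_sucI:
  assumes [simp]: "closed i Nat" "closed n Nat" and "\<Delta> \<tturnstile> nlessF i n"
  shows "\<Delta> \<tturnstile> nlessF (sucT i) (sucT n)"
  using assms(3)
proof (rule nlessF_cases)
  fix \<Delta>' d assume [simp]: "closed d Nat" and *: "\<Delta>' \<tturnstile> Eq Nat n (sucT (nplusT i d))"
  show "\<Delta>' \<tturnstile> nlessF (sucT i) (sucT n)"
    by (rule nlessF_I[of _ d], simp_all)
      (rule eq_suc[OF eq_trans[OF * eq_sym[OF nplusT_suc_left]]], simp_all)
qed simp_all

text \<open>\<open>Decode\<close> undoes \<open>Code\<close>, so agreement of codes in the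
  definitions of extensionality and continuity becomes agreement of rational entries.\<close>

lemma code_eq_iff:
  assumes [simp]: "closed s Rat" "closed t Rat"
  shows "\<Delta> \<tturnstile> Eq Nat (Con Code $ s) (Con Code $ t) \<longleftrightarrow> \<Delta> \<tturnstile> Eq Rat s t"
proof
  assume "\<Delta> \<tturnstile> Eq Nat (Con Code $ s) (Con Code $ t)"
  then have "\<Delta> \<tturnstile> Eq Rat (Con Decode $ (Con Code $ s)) (Con Decode $ (Con Code $ t))"
    by (rule eq_arg) simp
  from eq_trans[OF eq_sym[OF decode_code] eq_trans[OF this decode_code]]
  show "\<Delta> \<tturnstile> Eq Rat s t" by simp
qed (rule eq_arg, assumption, simp)

lemma nearF_cong:
  assumes "\<Delta> \<tturnstile> Eq Nat k k'" and [simp]: "closed x Seq" "closed y Seq"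
    and "\<Delta> \<tturnstile> nearF k x x y y"
  shows "\<Delta> \<tturnstile> nearF k' x x y y"
  using D_leibniz[OF assms(1), of "nearF (Bnd 2) x x y y"] assms(4) by simp

definition ternT :: "tm \<Rightarrow> tm \<Rightarrow> tm" where
  "ternT a n = recT Rat (Con QOne) (Lam Nat (Lam Rat
     (addT (mulT twoT (Bnd 0)) (addT (natT (a $ Bnd 1)) (negT (Con QOne)))))) n"

definition PhiT :: "tm \<Rightarrow> tm" where
  "PhiT a = Lam Nat (mulT (pwT (sucT (Bnd 0))) (ternT a (Bnd 0)))"

lemma Phi_eq: "Phi a d = PhiT (a (d + 3))"
  by (simp add: Phi_def PhiT_def tern_N_def ternT_def pw_eq builder_defs eval_nat_numeral)

lemma ternT_syntax [simp]:
  "tyof (Rat # Nat # Ts) a = Some NSeq \<Longrightarrow> tyof Ts n = Some Nat \<Longrightarrow> tyof Ts (ternT a n) = Some Rat"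
  "inst_tm k u (ternT a n) = ternT (inst_tm (k + 2) u a) (inst_tm k u n)"
  "tyof (Rat # Nat # Nat # Ts) a = Some NSeq \<Longrightarrow> tyof Ts (PhiT a) = Some Seq"
  "inst_tm k u (PhiT a) = PhiT (inst_tm (k + 3) u a)"
  by (simp_all add: ternT_def PhiT_def eval_nat_numeral)

text \<open>This is the forced reading of the agreement of two initial segments. That an index lies
  below \<open>n\<close> may become known only in a larger context, hence the quantification over
  \<open>\<Delta>'\<close>.\<close>

definition agree :: "ty \<Rightarrow> fm list \<Rightarrow> tm \<Rightarrow> tm \<Rightarrow> tm \<Rightarrow> bool" where
  "agree \<tau> \<Delta> n x y \<longleftrightarrow> (\<forall>\<Delta>' i. set \<Delta> \<subseteq> set \<Delta>' \<longrightarrow> closed i Nat \<longrightarrow>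
     \<Delta>' \<tturnstile> nlessF i n \<longrightarrow> \<Delta>' \<tturnstile> Eq \<tau> (x $ i) (y $ i))"

text \<open>In \<open>unitF\<close> the quantified sequence is met below one and below three further
  binders. A bound \<open>n\<close> quantified just outside is to be passed as \<open>Bnd 3\<close>:
  it is used below the sequence, the position, and the difference hidden in
  \<open>nlessF\<close>.\<close>

definition contF :: "tm \<Rightarrow> tm \<Rightarrow> tm \<Rightarrow> tm \<Rightarrow> fm" where
  "contF g k x n = Forall Seq (Impl (unitF (Bnd 1) (Bnd 3))
     (Impl (Forall Nat (Impl (nlessF (Bnd 1) n)
         (Eq Nat (Con Code $ (x $ Bnd 0)) (Con Code $ (Bnd 1 $ Bnd 0)))))
       (Eq Nat (g $ k $ x) (g $ k $ Bnd 0))))"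

definition tcontF :: "tm \<Rightarrow> tm \<Rightarrow> tm \<Rightarrow> tm \<Rightarrow> fm" where
  "tcontF g k a n = Forall NSeq (Impl (ternF (Bnd 1))
     (Impl (Forall Nat (Impl (nlessF (Bnd 1) n) (Eq Nat (a $ Bnd 0) (Bnd 1 $ Bnd 0))))
       (Eq Nat (g $ k $ a) (g $ k $ Bnd 0))))"

text \<open>Unfolding produces a growing chain of contexts, one for each implication. Facts of
  earlier contexts persist, so the chain collapses to its last member. Most of the readings below
  follow this pattern.\<close>

lemma contF_iff:
  assumes "closed g (Fun Nat (Fun Seq Nat))" "closed k Nat" "closed x Seq" "closed n Nat"
  shows "\<Delta> \<tturnstile> contF g k x n \<longleftrightarrow> (\<forall>\<Delta>' y. set \<Delta> \<subseteq> set \<Delta>' \<longrightarrow> closed y Seq \<longrightarrow> \<Delta>' \<tturnstile> unitF y y \<longrightarrow>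
    agree Rat \<Delta>' n x y \<longrightarrow> \<Delta>' \<tturnstile> Eq Nat (g $ k $ x) (g $ k $ y))" (is "_ = ?R")
proof -
  have "\<Delta> \<tturnstile> contF g k x n \<longleftrightarrow> (\<forall>y. closed y Seq \<longrightarrow> (\<forall>\<Delta>1. set \<Delta> \<subseteq> set \<Delta>1 \<longrightarrow> \<Delta>1 \<tturnstile> unitF y y \<longrightarrow>
    (\<forall>\<Delta>'. set \<Delta>1 \<subseteq> set \<Delta>' \<longrightarrow> agree Rat \<Delta>' n x y \<longrightarrow> \<Delta>' \<tturnstile> Eq Nat (g $ k $ x) (g $ k $ y))))"
    using assms by (simp add: contF_def agree_def forall_iff impl_iff code_eq_iff imp_conjL) blast
  also have "\<dots> = ?R" by (meson weaken subset_trans order_refl)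
  finally show ?thesis .
qed

lemma tcontF_iff:
  assumes "closed g (Fun Nat (Fun NSeq Nat))" "closed k Nat" "closed a NSeq" "closed n Nat"
  shows "\<Delta> \<tturnstile> tcontF g k a n \<longleftrightarrow> (\<forall>\<Delta>' b. set \<Delta> \<subseteq> set \<Delta>' \<longrightarrow> closed b NSeq \<longrightarrow> \<Delta>' \<tturnstile> ternF b \<longrightarrow>
    agree Nat \<Delta>' n a b \<longrightarrow> \<Delta>' \<tturnstile> Eq Nat (g $ k $ a) (g $ k $ b))" (is "_ = ?R")
proof -
  have "\<Delta> \<tturnstile> tcontF g k a n \<longleftrightarrow> (\<forall>b. closed b NSeq \<longrightarrow> (\<forall>\<Delta>1. set \<Delta> \<subseteq> set \<Delta>1 \<longrightarrow> \<Delta>1 \<tturnstile> ternF b \<longrightarrow>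
    (\<forall>\<Delta>'. set \<Delta>1 \<subseteq> set \<Delta>' \<longrightarrow> agree Nat \<Delta>' n a b \<longrightarrow> \<Delta>' \<tturnstile> Eq Nat (g $ k $ a) (g $ k $ b))))"
    using assms by (simp add: tcontF_def agree_def forall_iff impl_iff imp_conjL) blast
  also have "\<dots> = ?R" by (meson weaken subset_trans order_refl)
  finally show ?thesis .
qed

lemma contF_syntax [simp]:
  "closed g (Fun Nat (Fun Seq Nat)) \<Longrightarrow> closed k Nat \<Longrightarrow> closed x Seq \<Longrightarrow>
    wff [Nat] (contF g k x (Bnd 3))"
  "closed g (Fun Nat (Fun Seq Nat)) \<Longrightarrow> closed k Nat \<Longrightarrow> closed x Seq \<Longrightarrow>
    inst 0 n (contF g k x (Bnd 3)) = contF g k x n"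
  "closed h (Fun Nat (Fun NSeq Nat)) \<Longrightarrow> closed k Nat \<Longrightarrow> closed a NSeq \<Longrightarrow>
    wff [Nat] (tcontF h k a (Bnd 3))"
  "closed h (Fun Nat (Fun NSeq Nat)) \<Longrightarrow> closed k Nat \<Longrightarrow> closed a NSeq \<Longrightarrow>
    inst 0 n (tcontF h k a (Bnd 3)) = tcontF h k a n"
  by (simp_all add: contF_def tcontF_def)

lemma modulus_iff:
  assumes "closed f (Fun Seq Seq)" "closed g (Fun Nat (Fun Seq Nat))"
  shows "\<Delta> \<tturnstile> modulus (K f) (K g) 0 \<longleftrightarrow> (\<forall>\<Delta>' k x y. set \<Delta> \<subseteq> set \<Delta>' \<longrightarrow>
    closed k Nat \<longrightarrow> closed x Seq \<longrightarrow> closed y Seq \<longrightarrow> \<Delta>' \<tturnstile> unitF x x \<longrightarrow> \<Delta>' \<tturnstile> unitF y y \<longrightarrow>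
    \<Delta>' \<tturnstile> nearF (g $ k $ x) x x y y \<longrightarrow> \<Delta>' \<tturnstile> nearF k (f $ x) (f $ x) (f $ y) (f $ y))" (is "_ = ?R")
proof -
  have "\<Delta> \<tturnstile> modulus (K f) (K g) 0 \<longleftrightarrow> (\<forall>k. closed k Nat \<longrightarrow> (\<forall>x. closed x Seq \<longrightarrow>
    (\<forall>\<Delta>1. set \<Delta> \<subseteq> set \<Delta>1 \<longrightarrow> \<Delta>1 \<tturnstile> unitF x x \<longrightarrow> (\<forall>y. closed y Seq \<longrightarrow>
    (\<forall>\<Delta>2. set \<Delta>1 \<subseteq> set \<Delta>2 \<longrightarrow> \<Delta>2 \<tturnstile> unitF y y \<longrightarrow>
    (\<forall>\<Delta>'. set \<Delta>2 \<subseteq> set \<Delta>' \<longrightarrow> \<Delta>' \<tturnstile> nearF (g $ k $ x) x x y y \<longrightarrow>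
      \<Delta>' \<tturnstile> nearF k (f $ x) (f $ x) (f $ y) (f $ y)))))))"
    using assms
    by (simp add: modulus_def formula_eq builder_defs forall_iff impl_iff eval_nat_numeral)
  also have "\<dots> = ?R" by (meson weaken subset_trans order_refl)
  finally show ?thesis .
qed

lemma ternary_modulus_iff:
  assumes "closed f (Fun Seq Seq)" "closed g (Fun Nat (Fun NSeq Nat))"
  shows "\<Delta> \<tturnstile> ternary_modulus (K f) (K g) 0 \<longleftrightarrow> (\<forall>\<Delta>' k a x. set \<Delta> \<subseteq> set \<Delta>' \<longrightarrow>
    closed k Nat \<longrightarrow> closed a NSeq \<longrightarrow> closed x Seq \<longrightarrow> \<Delta>' \<tturnstile> ternF a \<longrightarrow> \<Delta>' \<tturnstile> unitF x x \<longrightarrow>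
    \<Delta>' \<tturnstile> nearF (g $ k $ a) (PhiT a) (PhiT a) x x \<longrightarrow>
    \<Delta>' \<tturnstile> nearF k (f $ PhiT a) (f $ PhiT a) (f $ x) (f $ x))" (is "_ = ?R")
proof -
  have "\<Delta> \<tturnstile> ternary_modulus (K f) (K g) 0 \<longleftrightarrow> (\<forall>k. closed k Nat \<longrightarrow> (\<forall>a. closed a NSeq \<longrightarrow>
    (\<forall>\<Delta>1. set \<Delta> \<subseteq> set \<Delta>1 \<longrightarrow> \<Delta>1 \<tturnstile> ternF a \<longrightarrow> (\<forall>x. closed x Seq \<longrightarrow>
    (\<forall>\<Delta>2. set \<Delta>1 \<subseteq> set \<Delta>2 \<longrightarrow> \<Delta>2 \<tturnstile> unitF x x \<longrightarrow>
    (\<forall>\<Delta>'. set \<Delta>2 \<subseteq> set \<Delta>' \<longrightarrow> \<Delta>' \<tturnstile> nearF (g $ k $ a) (PhiT a) (PhiT a) x x \<longrightarrow>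
      \<Delta>' \<tturnstile> nearF k (f $ PhiT a) (f $ PhiT a) (f $ x) (f $ x)))))))"
    using assms
    by (simp add: ternary_modulus_def formula_eq Phi_eq builder_defs forall_iff impl_iff
        eval_nat_numeral)
  also have "\<dots> = ?R" by (meson weaken subset_trans order_refl)
  finally show ?thesis .
qed

lemma extensional_iff:
  assumes "closed g (Fun Nat (Fun Seq Nat))"
  shows "\<Delta> \<tturnstile> extensional (K g) 0 \<longleftrightarrow> (\<forall>\<Delta>' k x y. set \<Delta> \<subseteq> set \<Delta>' \<longrightarrow>
    closed k Nat \<longrightarrow> closed x Seq \<longrightarrow> closed y Seq \<longrightarrow> \<Delta>' \<tturnstile> unitF x x \<longrightarrow> \<Delta>' \<tturnstile> unitF y y \<longrightarrow>
    (\<forall>i. closed i Nat \<longrightarrow> \<Delta>' \<tturnstile> Eq Rat (x $ i) (y $ i)) \<longrightarrow>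
    \<Delta>' \<tturnstile> Eq Nat (g $ k $ x) (g $ k $ y))" (is "_ = ?R")
proof -
  have "\<Delta> \<tturnstile> extensional (K g) 0 \<longleftrightarrow> (\<forall>k. closed k Nat \<longrightarrow> (\<forall>x. closed x Seq \<longrightarrow>
    (\<forall>\<Delta>1. set \<Delta> \<subseteq> set \<Delta>1 \<longrightarrow> \<Delta>1 \<tturnstile> unitF x x \<longrightarrow> (\<forall>y. closed y Seq \<longrightarrow>
    (\<forall>\<Delta>2. set \<Delta>1 \<subseteq> set \<Delta>2 \<longrightarrow> \<Delta>2 \<tturnstile> unitF y y \<longrightarrow>
    (\<forall>\<Delta>'. set \<Delta>2 \<subseteq> set \<Delta>' \<longrightarrow> (\<forall>i. closed i Nat \<longrightarrow> \<Delta>' \<tturnstile> Eq Rat (x $ i) (y $ i)) \<longrightarrow>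
      \<Delta>' \<tturnstile> Eq Nat (g $ k $ x) (g $ k $ y)))))))"
    using assms
    by (simp add: extensional_def formula_eq builder_defs forall_iff impl_iff code_eq_iff
        eval_nat_numeral)
  also have "\<dots> = ?R" by (meson weaken subset_trans order_refl)
  finally show ?thesis .
qed

lemma ternary_extensional_iff:
  assumes "closed g (Fun Nat (Fun NSeq Nat))"
  shows "\<Delta> \<tturnstile> ternary_extensional (K g) 0 \<longleftrightarrow> (\<forall>\<Delta>' k a b. set \<Delta> \<subseteq> set \<Delta>' \<longrightarrow>
    closed k Nat \<longrightarrow> closed a NSeq \<longrightarrow> closed b NSeq \<longrightarrow> \<Delta>' \<tturnstile> ternF a \<longrightarrow> \<Delta>' \<tturnstile> ternF b \<longrightarrow>
    (\<forall>i. closed i Nat \<longrightarrow> \<Delta>' \<tturnstile> Eq Nat (a $ i) (b $ i)) \<longrightarrow>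
    \<Delta>' \<tturnstile> Eq Nat (g $ k $ a) (g $ k $ b))" (is "_ = ?R")
proof -
  have "\<Delta> \<tturnstile> ternary_extensional (K g) 0 \<longleftrightarrow> (\<forall>k. closed k Nat \<longrightarrow> (\<forall>a. closed a NSeq \<longrightarrow>
    (\<forall>\<Delta>1. set \<Delta> \<subseteq> set \<Delta>1 \<longrightarrow> \<Delta>1 \<tturnstile> ternF a \<longrightarrow> (\<forall>b. closed b NSeq \<longrightarrow>
    (\<forall>\<Delta>2. set \<Delta>1 \<subseteq> set \<Delta>2 \<longrightarrow> \<Delta>2 \<tturnstile> ternF b \<longrightarrow>
    (\<forall>\<Delta>'. set \<Delta>2 \<subseteq> set \<Delta>' \<longrightarrow> (\<forall>i. closed i Nat \<longrightarrow> \<Delta>' \<tturnstile> Eq Nat (a $ i) (b $ i)) \<longrightarrow>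
      \<Delta>' \<tturnstile> Eq Nat (g $ k $ a) (g $ k $ b)))))))"
    using assms
    by (simp add: ternary_extensional_def formula_eq builder_defs forall_iff impl_iff
        eval_nat_numeral)
  also have "\<dots> = ?R" by (meson weaken subset_trans order_refl)
  finally show ?thesis .
qed

lemma continuous_iff:
  assumes "closed g (Fun Nat (Fun Seq Nat))"
  shows "\<Delta> \<tturnstile> continuous (K g) 0 \<longleftrightarrow> (\<forall>\<Delta>' k x. set \<Delta> \<subseteq> set \<Delta>' \<longrightarrow>
    closed k Nat \<longrightarrow> closed x Seq \<longrightarrow> \<Delta>' \<tturnstile> unitF x x \<longrightarrow> \<Delta>' \<tturnstile> Exists Nat (contF g k x (Bnd 3)))"
proof -
  have "\<Delta> \<tturnstile> continuous (K g) 0 \<longleftrightarrow> (\<forall>k. closed k Nat \<longrightarrow> (\<forall>x. closed x Seq \<longrightarrow>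
    (\<forall>\<Delta>'. set \<Delta> \<subseteq> set \<Delta>' \<longrightarrow> \<Delta>' \<tturnstile> unitF x x \<longrightarrow> \<Delta>' \<tturnstile> Exists Nat (contF g k x (Bnd 3)))))"
    using assms
    by (simp add: continuous_def contF_def formula_eq builder_defs forall_iff impl_iff
        eval_nat_numeral)
  then show ?thesis by blast
qed

lemma ternary_continuous_iff:
  assumes "closed g (Fun Nat (Fun NSeq Nat))"
  shows "\<Delta> \<tturnstile> ternary_continuous (K g) 0 \<longleftrightarrow> (\<forall>\<Delta>' k a. set \<Delta> \<subseteq> set \<Delta>' \<longrightarrow>
    closed k Nat \<longrightarrow> closed a NSeq \<longrightarrow> \<Delta>' \<tturnstile> ternF a \<longrightarrow> \<Delta>' \<tturnstile> Exists Nat (tcontF g k a (Bnd 3)))"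
proof -
  have "\<Delta> \<tturnstile> ternary_continuous (K g) 0 \<longleftrightarrow> (\<forall>k. closed k Nat \<longrightarrow> (\<forall>a. closed a NSeq \<longrightarrow>
    (\<forall>\<Delta>'. set \<Delta> \<subseteq> set \<Delta>' \<longrightarrow> \<Delta>' \<tturnstile> ternF a \<longrightarrow> \<Delta>' \<tturnstile> Exists Nat (tcontF g k a (Bnd 3)))))"
    using assms
    by (simp add: ternary_continuous_def tcontF_def formula_eq builder_defs forall_iff impl_iff
        eval_nat_numeral)
  then show ?thesis by blast
qed

lemma real_function_iff:
  assumes "closed f (Fun Seq Seq)"
  shows "\<Delta> \<tturnstile> real_function (K f) 0 \<longleftrightarrow>
    (\<forall>\<Delta>' x. set \<Delta> \<subseteq> set \<Delta>' \<longrightarrow> closed x Seq \<longrightarrow> \<Delta>' \<tturnstile> unitF x x \<longrightarrow> \<Delta>' \<tturnstile> regF (f $ x) (f $ x)) \<and>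
    (\<forall>\<Delta>' x y. set \<Delta> \<subseteq> set \<Delta>' \<longrightarrow> closed x Seq \<longrightarrow> closed y Seq \<longrightarrow> \<Delta>' \<tturnstile> unitF x x \<longrightarrow>
      \<Delta>' \<tturnstile> unitF y y \<longrightarrow> \<Delta>' \<tturnstile> equivF x x y y \<longrightarrow> \<Delta>' \<tturnstile> equivF (f $ x) (f $ x) (f $ y) (f $ y))"
    (is "_ = ?R")
proof -
  have "\<Delta> \<tturnstile> real_function (K f) 0 \<longleftrightarrow>
    (\<forall>x. closed x Seq \<longrightarrow> (\<forall>\<Delta>'. set \<Delta> \<subseteq> set \<Delta>' \<longrightarrow> \<Delta>' \<tturnstile> unitF x x \<longrightarrow> \<Delta>' \<tturnstile> regF (f $ x) (f $ x))) \<and>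
    (\<forall>x. closed x Seq \<longrightarrow> (\<forall>\<Delta>1. set \<Delta> \<subseteq> set \<Delta>1 \<longrightarrow> \<Delta>1 \<tturnstile> unitF x x \<longrightarrow>
    (\<forall>y. closed y Seq \<longrightarrow> (\<forall>\<Delta>2. set \<Delta>1 \<subseteq> set \<Delta>2 \<longrightarrow> \<Delta>2 \<tturnstile> unitF y y \<longrightarrow>
    (\<forall>\<Delta>'. set \<Delta>2 \<subseteq> set \<Delta>' \<longrightarrow> \<Delta>' \<tturnstile> equivF x x y y \<longrightarrow>
      \<Delta>' \<tturnstile> equivF (f $ x) (f $ x) (f $ y) (f $ y))))))"
    using assms
    by (simp add: real_function_def formula_eq builder_defs forall_iff impl_iff conj_iff
        eval_nat_numeral)
  also have "\<dots> = ?R" by (meson weaken subset_trans order_refl)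
  finally show ?thesis .
qed

abbreviation modTy :: ty where "modTy \<equiv> Fun Nat (Fun Seq Nat)"
abbreviation tmodTy :: ty where "tmodTy \<equiv> Fun Nat (Fun NSeq Nat)"

definition hasmodF :: "tm \<Rightarrow> fm" where
  "hasmodF f = ex modTy (\<lambda>g. extensional g \<^bold>\<and> modulus (K f) g \<^bold>\<and> continuous g) 0"

definition hastmodF :: "tm \<Rightarrow> fm" where
  "hastmodF f = ex tmodTy
     (\<lambda>g. ternary_extensional g \<^bold>\<and> ternary_modulus (K f) g \<^bold>\<and> ternary_continuous g) 0"

lemma hasmodF_I:
  assumes "closed f (Fun Seq Seq)" "closed g modTy" "\<Delta> \<tturnstile> extensional (K g) 0"
    "\<Delta> \<tturnstile> modulus (K f) (K g) 0" "\<Delta> \<tturnstile> continuous (K g) 0"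
  shows "\<Delta> \<tturnstile> hasmodF f"
  unfolding hasmodF_def ex_def
proof (rule D_existsI[OF assms(2)])
  show "wff [modTy] ((extensional (bv 0) \<^bold>\<and> modulus (K f) (bv 0) \<^bold>\<and> continuous (bv 0)) (Suc 0))"
    using assms(1) by (simp add: extensional_def modulus_def continuous_def formula_eq builder_defs)
  show "\<Delta> \<tturnstile> inst 0 g ((extensional (bv 0) \<^bold>\<and> modulus (K f) (bv 0) \<^bold>\<and> continuous (bv 0)) (Suc 0))"
    using assms
    by (simp add: extensional_def modulus_def continuous_def formula_eq builder_defs conj_iff)
qed

lemma hastmodF_I:
  assumes "closed f (Fun Seq Seq)" "closed g tmodTy" "\<Delta> \<tturnstile> ternary_extensional (K g) 0"
    "\<Delta> \<tturnstile> ternary_modulus (K f) (K g) 0" "\<Delta> \<tturnstile> ternary_continuous (K g) 0"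
  shows "\<Delta> \<tturnstile> hastmodF f"
  unfolding hastmodF_def ex_def
proof (rule D_existsI[OF assms(2)])
  show "wff [tmodTy] ((ternary_extensional (bv 0) \<^bold>\<and> ternary_modulus (K f) (bv 0) \<^bold>\<and>
      ternary_continuous (bv 0)) (Suc 0))"
    using assms(1) by (simp add: ternary_extensional_def ternary_modulus_def ternary_continuous_def
        formula_eq Phi_eq builder_defs)
  show "\<Delta> \<tturnstile> inst 0 g ((ternary_extensional (bv 0) \<^bold>\<and> ternary_modulus (K f) (bv 0) \<^bold>\<and>
      ternary_continuous (bv 0)) (Suc 0))"
    using assms by (simp add: ternary_extensional_def ternary_modulus_def ternary_continuous_def
        formula_eq Phi_eq builder_defs conj_iff)
qed

lemma hasmodF_cases:
  assumes "\<Delta> \<tturnstile> hasmodF f" "closed f (Fun Seq Seq)"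
    and "\<And>\<Delta>' g. set \<Delta> \<subseteq> set \<Delta>' \<Longrightarrow> closed g modTy \<Longrightarrow> \<Delta>' \<tturnstile> extensional (K g) 0 \<Longrightarrow>
      \<Delta>' \<tturnstile> modulus (K f) (K g) 0 \<Longrightarrow> \<Delta>' \<tturnstile> continuous (K g) 0 \<Longrightarrow> \<Delta>' \<tturnstile> \<phi>"
  shows "\<Delta> \<tturnstile> \<phi>"
  using assms(1) unfolding hasmodF_def ex_def
proof (rule exists_cases)
  fix \<Delta>' g assume "set \<Delta> \<subseteq> set \<Delta>'" "closed g modTy"
    "\<Delta>' \<tturnstile> inst 0 g ((extensional (bv 0) \<^bold>\<and> modulus (K f) (bv 0) \<^bold>\<and> continuous (bv 0)) (Suc 0))"
  then show "\<Delta>' \<tturnstile> \<phi>" using assms(2)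
    by (intro assms(3)[of \<Delta>' g])
      (simp_all add: extensional_def modulus_def continuous_def formula_eq builder_defs conj_iff)
qed

lemma hastmodF_cases:
  assumes "\<Delta> \<tturnstile> hastmodF f" "closed f (Fun Seq Seq)"
    and "\<And>\<Delta>' g. set \<Delta> \<subseteq> set \<Delta>' \<Longrightarrow> closed g tmodTy \<Longrightarrow> \<Delta>' \<tturnstile> ternary_extensional (K g) 0 \<Longrightarrow>
      \<Delta>' \<tturnstile> ternary_modulus (K f) (K g) 0 \<Longrightarrow> \<Delta>' \<tturnstile> ternary_continuous (K g) 0 \<Longrightarrow> \<Delta>' \<tturnstile> \<phi>"
  shows "\<Delta> \<tturnstile> \<phi>"
  using assms(1) unfolding hastmodF_def ex_def
proof (rule exists_cases)
  fix \<Delta>' g assume "set \<Delta> \<subseteq> set \<Delta>'" "closed g tmodTy"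
    "\<Delta>' \<tturnstile> inst 0 g ((ternary_extensional (bv 0) \<^bold>\<and> ternary_modulus (K f) (bv 0) \<^bold>\<and>
      ternary_continuous (bv 0)) (Suc 0))"
  then show "\<Delta>' \<tturnstile> \<phi>" using assms(2)
    by (intro assms(3)[of \<Delta>' g]) (simp_all add: ternary_extensional_def ternary_modulus_def
        ternary_continuous_def formula_eq Phi_eq builder_defs conj_iff)
qed

text \<open>Both principles get the same shape, so each implication between them reduces to passing
  from one kind of modulus to the other for a fixed \<open>f\<close>.\<close>

lemma UCT_iff:
  "\<Delta> \<tturnstile> UCTc 0 \<longleftrightarrow> (\<forall>f \<Delta>'. closed f (Fun Seq Seq) \<longrightarrow> set \<Delta> \<subseteq> set \<Delta>' \<longrightarrow>
     \<Delta>' \<tturnstile> real_function (K f) 0 \<longrightarrow> \<Delta>' \<tturnstile> hasmodF f \<longrightarrow> \<Delta>' \<tturnstile> unif_continuous (K f) 0)" (is ?A)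
  "\<Delta> \<tturnstile> UCTc' 0 \<longleftrightarrow> (\<forall>f \<Delta>'. closed f (Fun Seq Seq) \<longrightarrow> set \<Delta> \<subseteq> set \<Delta>' \<longrightarrow>
     \<Delta>' \<tturnstile> real_function (K f) 0 \<longrightarrow> \<Delta>' \<tturnstile> hastmodF f \<longrightarrow> \<Delta>' \<tturnstile> unif_continuous (K f) 0)" (is ?B)
proof -
  define \<phi> where "\<phi> = real_function (bv 0) (Suc 0)"
  define \<psi> where "\<psi> = ex modTy (\<lambda>g. extensional g \<^bold>\<and> modulus (bv 0) g \<^bold>\<and> continuous g) (Suc 0)"
  define \<psi>' where "\<psi>' = ex tmodTy
     (\<lambda>g. ternary_extensional g \<^bold>\<and> ternary_modulus (bv 0) g \<^bold>\<and> ternary_continuous g) (Suc 0)"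
  define \<chi> where "\<chi> = unif_continuous (bv 0) (Suc 0)"
  have U: "UCTc 0 = Forall (Fun Seq Seq) (Impl \<phi> (Impl \<psi> \<chi>))"
    "UCTc' 0 = Forall (Fun Seq Seq) (Impl \<phi> (Impl \<psi>' \<chi>))"
    by (simp_all add: \<phi>_def \<psi>_def \<psi>'_def \<chi>_def UCTc_def UCTc'_def all_def fimpl_def)
  have w: "wff [Fun Seq Seq] \<phi>" "wff [Fun Seq Seq] \<psi>" "wff [Fun Seq Seq] \<psi>'" "wff [Fun Seq Seq] \<chi>"
    using wff_UCTc wff_UCTc' by (auto simp: U)
  have i: "inst 0 f \<phi> = real_function (K f) 0" "inst 0 f \<psi> = hasmodF f"
    "inst 0 f \<psi>' = hastmodF f" "inst 0 f \<chi> = unif_continuous (K f) 0"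
    if [simp]: "closed f (Fun Seq Seq)" for f
    by (simp_all add: \<phi>_def \<psi>_def \<psi>'_def \<chi>_def real_function_def hasmodF_def hastmodF_def
        unif_continuous_def ternary_extensional_def ternary_modulus_def ternary_continuous_def
        extensional_def modulus_def continuous_def formula_eq Phi_eq builder_defs)
  have imp: "wff [] \<alpha> \<Longrightarrow> wff [] \<beta> \<Longrightarrow> \<Delta> \<tturnstile> Impl \<alpha> (Impl \<beta> \<gamma>) \<longleftrightarrow>
    (\<forall>\<Delta>'. set \<Delta> \<subseteq> set \<Delta>' \<longrightarrow> \<Delta>' \<tturnstile> \<alpha> \<longrightarrow> \<Delta>' \<tturnstile> \<beta> \<longrightarrow> \<Delta>' \<tturnstile> \<gamma>)" for \<alpha> \<beta> \<gamma>
    by (simp add: impl_iff) (meson weaken subset_trans order_refl)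
  have wi: "wff [] (real_function (K f) 0)" "wff [] (hasmodF f)" "wff [] (hastmodF f)"
    if "closed f (Fun Seq Seq)" for f
    using w(1-3)[THEN wff_inst_0, OF that] by (simp_all add: i that)
  show ?A using w by (auto simp: U forall_iff imp i wi)
  show ?B using w by (auto simp: U forall_iff imp i wi)
qed

section \<open>From ternary moduli to moduli\<close>

lemma ternT_zero [simp]: "closed a NSeq \<Longrightarrow> \<langle>ternT a (Con Zero)\<rangle> = 1"
  unfolding ternT_def by (subst ratq_eqI[OF rec_zero]) simp_all

lemma ternT_suc_eq:
  "closed a NSeq \<Longrightarrow> closed n Nat \<Longrightarrow> \<Delta> \<tturnstile> Eq Rat (ternT a (sucT n))
    (addT (mulT twoT (ternT a n)) (addT (natT (a $ n)) (negT (Con QOne))))"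
  unfolding ternT_def by (rule rec_lam_suc) simp_all

text \<open>A congruence at the level of derivations, because the digits compared later are equal
  only under hypotheses. It serves the recursions of both \<open>ternT\<close> and
  \<open>numT\<close>.\<close>

lemma eq_tern_step:
  assumes "\<Delta> \<tturnstile> Eq Rat s t" "\<Delta> \<tturnstile> Eq Nat m n"
  shows "\<Delta> \<tturnstile> Eq Rat (addT (mulT twoT s) (addT (natT m) (negT (Con QOne))))
    (addT (mulT twoT t) (addT (natT n) (negT (Con QOne))))"
  by (rule eq_app[OF eq_arg[OF eq_arg[OF assms(1)]] eq_fun[OF eq_arg[OF eq_arg[OF assms(2)]]]])
    simp_all

lemma ternT_suc: "closed a NSeq \<Longrightarrow> closed n Nat \<Longrightarrow>
    \<langle>ternT a (sucT n)\<rangle> = \<langle>ternT a n\<rangle> + \<langle>ternT a n\<rangle> + \<langle>natT (a $ n)\<rangle> - 1"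
  by (simp add: ratq_eqI[OF ternT_suc_eq] distrib_right)

lemma PhiT_app: "closed a NSeq \<Longrightarrow> closed n Nat \<Longrightarrow>
    \<langle>PhiT a $ n\<rangle> = \<langle>pwT (sucT n)\<rangle> * \<langle>ternT a n\<rangle>"
  by (simp add: PhiT_def)

text \<open>Doubling the number cancels one halving of the factor, so appending the digit i moves
  the value by (i - 1) 2^{-(n+2)}.\<close>

lemma PhiT_suc:
  assumes [simp]: "closed a NSeq" "closed n Nat"
  shows "\<langle>PhiT a $ sucT n\<rangle> =
    \<langle>PhiT a $ n\<rangle> + \<langle>pwT (sucT (sucT n))\<rangle> * \<langle>natT (a $ n)\<rangle> - \<langle>pwT (sucT (sucT n))\<rangle>"
  by (simp add: PhiT_app ternT_suc pwT_double[of "sucT n"] algebra_simps)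

lemma eq_natT:
  assumes "\<Delta> \<tturnstile> Eq Nat m n"
  shows "leq \<Delta> \<langle>natT m\<rangle> \<langle>natT n\<rangle>" "leq \<Delta> \<langle>natT n\<rangle> \<langle>natT m\<rangle>"
  using eq_arg[OF assms, of "Con OfNat" Rat] by (auto intro: eq_leq eq_sym)

lemma ternF_bounds:
  assumes a: "\<Delta> \<tturnstile> ternF a" and [simp]: "closed a NSeq" "closed n Nat"
  shows "leq \<Delta> 0 \<langle>natT (a $ n)\<rangle>" "leq \<Delta> \<langle>natT (a $ n)\<rangle> (1 + 1)"
proof -
  have one: "leq \<Delta>' 1 (1 + 1)" for \<Delta>' by (rule leq_shift[OF leq_zero_one]) simp
  have two: "leq \<Delta>' 0 (1 + 1)" for \<Delta>' using leq_trans[OF leq_zero_one one] .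
  have d: "\<Delta> \<tturnstile> Disj (Eq Nat (a $ n) (Con Zero)) (Disj (Eq Nat (a $ n) (sucT (Con Zero)))
      (Eq Nat (a $ n) (sucT (sucT (Con Zero)))))"
    using a by (simp add: ternF_def ternary_def builder_defs forall_iff)
  show "leq \<Delta> 0 \<langle>natT (a $ n)\<rangle>"
  proof (rule leq_disj_cases[OF d])
    fix \<Delta>' assume "\<Delta>' \<tturnstile> Eq Nat (a $ n) (Con Zero)"
    from eq_natT(2)[OF this] show "leq \<Delta>' 0 \<langle>natT (a $ n)\<rangle>" by simp
  next
    fix \<Delta>' assume d: "\<Delta>' \<tturnstile> Disj (Eq Nat (a $ n) (sucT (Con Zero))) (Eq Nat (a $ n) (sucT (sucT (Con Zero))))"
    show "leq \<Delta>' 0 \<langle>natT (a $ n)\<rangle>"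
      by (rule leq_disj_cases[OF d]; drule eq_natT(2); erule leq_trans[rotated])
        (simp_all add: leq_zero_one two)
  qed
  show "leq \<Delta> \<langle>natT (a $ n)\<rangle> (1 + 1)"
  proof (rule leq_disj_cases[OF d])
    fix \<Delta>' assume "\<Delta>' \<tturnstile> Eq Nat (a $ n) (Con Zero)"
    from leq_trans[OF eq_natT(1)[OF this]] show "leq \<Delta>' \<langle>natT (a $ n)\<rangle> (1 + 1)" by (simp add: two)
  next
    fix \<Delta>' assume d: "\<Delta>' \<tturnstile> Disj (Eq Nat (a $ n) (sucT (Con Zero))) (Eq Nat (a $ n) (sucT (sucT (Con Zero))))"
    show "leq \<Delta>' \<langle>natT (a $ n)\<rangle> (1 + 1)"
      by (rule leq_disj_cases[OF d]; drule eq_natT(1); erule leq_trans)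
        (simp_all add: leq_refl one)
  qed
qed

lemma PhiT_step:
  assumes "\<Delta> \<tturnstile> ternF a" and [simp]: "closed a NSeq" "closed n Nat"
  shows "leq \<Delta> 0 (\<langle>pwT (sucT (sucT n))\<rangle> * \<langle>natT (a $ n)\<rangle>)"
    "leq \<Delta> (\<langle>pwT (sucT (sucT n))\<rangle> * \<langle>natT (a $ n)\<rangle>) \<langle>pwT (sucT n)\<rangle>"
proof -
  show "leq \<Delta> 0 (\<langle>pwT (sucT (sucT n))\<rangle> * \<langle>natT (a $ n)\<rangle>)"
    using assms by (simp add: leq_mult_nonneg pwT_nonneg ternF_bounds)
  have "leq \<Delta> (\<langle>pwT (sucT (sucT n))\<rangle> * \<langle>natT (a $ n)\<rangle>) (\<langle>pwT (sucT (sucT n))\<rangle> * (1 + 1))"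
    using assms by (simp add: leq_mult_left pwT_nonneg ternF_bounds)
  then show "leq \<Delta> (\<langle>pwT (sucT (sucT n))\<rangle> * \<langle>natT (a $ n)\<rangle>) \<langle>pwT (sucT n)\<rangle>"
    by (simp add: pwT_double[of "sucT n"] distrib_left)
qed

text \<open>The margin of 2^{-(n+1)} to both ends of the interval is what carries the induction: the
  next digit moves the value by at most half of it, and the other half is the next margin.\<close>

lemma PhiT_range:
  assumes t: "\<Delta> \<tturnstile> ternF a" and [simp]: "closed a NSeq" "closed n Nat"
  shows "leq \<Delta> \<langle>pwT (sucT n)\<rangle> \<langle>PhiT a $ n\<rangle> \<and> leq \<Delta> (\<langle>PhiT a $ n\<rangle> + \<langle>pwT (sucT n)\<rangle>) 1"
proof -
  let ?\<phi> = "Conj (leF (pwT (sucT (Bnd 0))) (PhiT a $ Bnd 0))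
    (leF (addT (PhiT a $ Bnd 0) (pwT (sucT (Bnd 0)))) (Con QOne))"
  have "\<Delta> \<tturnstile> inst 0 n ?\<phi>"
  proof (rule nat_induction)
    have "leq \<Delta> \<langle>pwT (sucT (Con Zero))\<rangle> \<langle>PhiT a $ Con Zero\<rangle>"
      by (simp add: PhiT_app leq_refl)
    moreover have "leq \<Delta> (\<langle>PhiT a $ Con Zero\<rangle> + \<langle>pwT (sucT (Con Zero))\<rangle>) 1"
      using pwT_double[of "Con Zero"] by (simp add: PhiT_app leq_refl)
    ultimately show "\<Delta> \<tturnstile> inst 0 (Con Zero) ?\<phi>" by (simp add: conj_iff leq_iff)
  next
    fix \<Delta>' m assume sub: "set \<Delta> \<subseteq> set \<Delta>'" and [simp]: "closed m Nat" and IH: "\<Delta>' \<tturnstile> inst 0 m ?\<phi>"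
    note step = PhiT_step[OF weaken[OF t sub], of m, simplified]
    let ?p = "\<langle>pwT (sucT (sucT m))\<rangle>" and ?c = "\<langle>PhiT a $ m\<rangle>"
    have lo: "leq \<Delta>' (?p + ?p) ?c" and hi: "leq \<Delta>' (?c + (?p + ?p)) 1"
      using IH by (simp_all add: conj_iff leq_iff pwT_double[of "sucT m"])
    have "leq \<Delta>' ?p \<langle>PhiT a $ sucT m\<rangle>"
      by (rule leq_shift[OF leq_add[OF lo step(1)]]) (simp add: PhiT_suc algebra_simps)
    moreover have "leq \<Delta>' (\<langle>PhiT a $ sucT m\<rangle> + ?p) 1"
      by (rule leq_shift[OF leq_add[OF hi step(2)]])
        (simp add: PhiT_suc pwT_double[of "sucT m"] algebra_simps)
    ultimately show "\<Delta>' \<tturnstile> inst 0 (sucT m) ?\<phi>" by (simp add: conj_iff leq_iff)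
  qed simp_all
  then show ?thesis by (simp add: conj_iff leq_iff)
qed

lemma PhiT_unit:
  assumes t: "\<Delta> \<tturnstile> ternF a" and [simp]: "closed a NSeq"
  shows "\<Delta> \<tturnstile> unitF (PhiT a) (PhiT a)"
proof -
  have "within \<Delta> \<langle>pwT (sucT n)\<rangle> \<langle>PhiT a $ n\<rangle> \<langle>PhiT a $ sucT n\<rangle>" if [simp]: "closed n Nat" for n
  proof -
    note step = PhiT_step[OF t, of n, simplified]
    have p: "leq \<Delta> 0 \<langle>pwT (sucT (sucT n))\<rangle>" by (simp add: pwT_nonneg)
    show ?thesis unfolding within_def
      by (rule conjI; rule leq_shift[OF leq_add[OF step(1) p]] leq_shift[OF leq_add[OF step(2) p]])
        (simp_all add: PhiT_suc pwT_double[of "sucT n"] algebra_simps)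
  qed
  moreover have "leq \<Delta> 0 (\<langle>PhiT a $ sucT n\<rangle> + \<langle>pwT n\<rangle>) \<and> leq \<Delta> \<langle>PhiT a $ sucT n\<rangle> (1 + \<langle>pwT n\<rangle>)"
    if [simp]: "closed n Nat" for n
  proof -
    have p: "leq \<Delta> 0 \<langle>pwT n\<rangle>" and q: "leq \<Delta> 0 \<langle>pwT (sucT (sucT n))\<rangle>" by (simp_all add: pwT_nonneg)
    note range = PhiT_range[OF t, of "sucT n", simplified]
    have "leq \<Delta> 0 \<langle>PhiT a $ sucT n\<rangle>" using range leq_trans[OF q] by blast
    from leq_add[OF this p] have "leq \<Delta> 0 (\<langle>PhiT a $ sucT n\<rangle> + \<langle>pwT n\<rangle>)" by simp
    moreover from leq_add[OF leq_add[OF conjunct2[OF range] q] p]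
    have "leq \<Delta> \<langle>PhiT a $ sucT n\<rangle> (1 + \<langle>pwT n\<rangle>)" by (rule leq_shift) (simp add: algebra_simps)
    ultimately show ?thesis ..
  qed
  ultimately show ?thesis by (simp add: unitF_iff regF_iff)
qed

lemma eq_PhiT_app:
  "closed a NSeq \<Longrightarrow> closed n Nat \<Longrightarrow> \<Delta> \<tturnstile> Eq Rat (PhiT a $ n) (mulT (pwT (sucT n)) (ternT a n))"
  unfolding PhiT_def by (rule eq_beta) simp_all

lemma agree_weaken: "agree \<tau> \<Delta> n x y \<Longrightarrow> set \<Delta> \<subseteq> set \<Delta>' \<Longrightarrow> agree \<tau> \<Delta>' n x y"
  unfolding agree_def by (meson subset_trans)

lemma agreeD: "agree \<tau> \<Delta> n x y \<Longrightarrow> closed i Nat \<Longrightarrow> \<Delta> \<tturnstile> nlessF i n \<Longrightarrow> \<Delta> \<tturnstile> Eq \<tau> (x $ i) (y $ i)"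
  by (auto simp: agree_def)

lemma agree_pointwise:
  "\<forall>i. closed i Nat \<longrightarrow> \<Delta> \<tturnstile> Eq \<tau> (x $ i) (y $ i) \<Longrightarrow> agree \<tau> \<Delta> n x y"
  by (auto simp: agree_def intro: weaken)

lemma agree_ternT:
  assumes ag: "agree Nat \<Delta> n a b" and [simp]: "closed a NSeq" "closed b NSeq" "closed n Nat" "closed i Nat"
    and i: "\<Delta> \<tturnstile> nlessF i n"
  shows "\<Delta> \<tturnstile> Eq Rat (ternT a i) (ternT b i)"
proof -
  \<comment> \<open>The bound on the index is part of the induction formula, so that it can descend
    from \<open>m + 1\<close> to \<open>m\<close> by \<open>nlessF_sucD\<close>.\<close>
  let ?\<phi> = "Impl (nlessF (Bnd 1) n) (Eq Rat (ternT a (Bnd 0)) (ternT b (Bnd 0)))"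
  have "\<Delta> \<tturnstile> inst 0 i ?\<phi>"
  proof (rule nat_induction)
    have "\<Delta>' \<tturnstile> Eq Rat (ternT a (Con Zero)) (ternT b (Con Zero))" for \<Delta>'
      unfolding ternT_def by (rule eq_trans[OF rec_zero eq_sym[OF rec_zero]]) simp_all
    then show "\<Delta> \<tturnstile> inst 0 (Con Zero) ?\<phi>" by (simp add: impl_iff)
  next
    fix \<Delta>1 m assume sub1: "set \<Delta> \<subseteq> set \<Delta>1" and [simp]: "closed m Nat" and IH: "\<Delta>1 \<tturnstile> inst 0 m ?\<phi>"
    have "\<Delta>' \<tturnstile> Eq Rat (ternT a (sucT m)) (ternT b (sucT m))"
      if sub: "set \<Delta>1 \<subseteq> set \<Delta>'" and suc: "\<Delta>' \<tturnstile> nlessF (sucT m) n" for \<Delta>'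
    proof -
      from suc have m: "\<Delta>' \<tturnstile> nlessF m n" by (rule nlessF_sucD[rotated 2]) simp_all
      have "agree Nat \<Delta>' n a b" using ag sub1 sub by (blast intro: agree_weaken)
      from agreeD[OF this _ m] have eq: "\<Delta>' \<tturnstile> Eq Nat (a $ m) (b $ m)" by simp
      have IH': "\<Delta>' \<tturnstile> Eq Rat (ternT a m) (ternT b m)"
        using IH sub m by (simp add: impl_iff)
      from eq_trans[OF ternT_suc_eq eq_trans[OF eq_tern_step[OF IH' eq] eq_sym[OF ternT_suc_eq]]]
      show ?thesis by simp
    qed
    then show "\<Delta>1 \<tturnstile> inst 0 (sucT m) ?\<phi>" by (simp add: impl_iff)
  qed simp_all
  then show ?thesis using i by (simp add: impl_iff)
qed

lemma agree_PhiT: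
  assumes ag: "agree Nat \<Delta> n a b" and [simp]: "closed a NSeq" "closed b NSeq" "closed n Nat"
  shows "agree Rat \<Delta> n (PhiT a) (PhiT b)"
  unfolding agree_def
proof (intro allI impI)
  fix \<Delta>' i assume sub: "set \<Delta> \<subseteq> set \<Delta>'" and [simp]: "closed i Nat" and i: "\<Delta>' \<tturnstile> nlessF i n"
  have "\<Delta>' \<tturnstile> Eq Rat (ternT a i) (ternT b i)"
    by (rule agree_ternT[OF agree_weaken[OF ag sub] _ _ _ _ i]) simp_all
  then have "\<Delta>' \<tturnstile> Eq Rat (mulT (pwT (sucT i)) (ternT a i)) (mulT (pwT (sucT i)) (ternT b i))"
    by (rule eq_arg) simp
  from eq_trans[OF eq_PhiT_app eq_trans[OF this eq_sym[OF eq_PhiT_app]]]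
  show "\<Delta>' \<tturnstile> Eq Rat (PhiT a $ i) (PhiT b $ i)" by simp
qed

lemma UCTc'_imp_UCTc:
  assumes "\<Delta> \<tturnstile> UCTc' 0"
  shows "\<Delta> \<tturnstile> UCTc 0"
proof -
  have "\<Delta>0 \<tturnstile> hastmodF f" if [simp]: "closed f (Fun Seq Seq)" and "\<Delta>0 \<tturnstile> hasmodF f" for f \<Delta>0
    using that(2)
  proof (rule hasmodF_cases)
    fix \<Delta> g assume [simp]: "closed g modTy" and ext: "\<Delta> \<tturnstile> extensional (K g) 0"
      and mod: "\<Delta> \<tturnstile> modulus (K f) (K g) 0" and cont: "\<Delta> \<tturnstile> continuous (K g) 0"
    \<comment> \<open>\<open>PhiT\<close> uses its sequence below three binders, its own and the two
      of the recursion in \<open>ternT\<close>; hence \<open>Bnd 3\<close> for the bound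
      sequence.\<close>
    define h where "h = Lam Nat (Lam NSeq (g $ Bnd 1 $ PhiT (Bnd 3)))"
    have [simp]: "closed h tmodTy" by (simp add: h_def)
    have h: "\<Delta>' \<tturnstile> Eq Nat (h $ k $ a) (g $ k $ PhiT a)"
      if [simp]: "closed k Nat" "closed a NSeq" for \<Delta>' k a
      using eq_beta2[of Nat NSeq "g $ Bnd 1 $ PhiT (Bnd 3)" Nat k a \<Delta>'] by (simp add: h_def)
    have hI: "\<Delta>' \<tturnstile> Eq Nat (h $ k $ a) (h $ k $ b)"
      if [simp]: "closed k Nat" "closed a NSeq" "closed b NSeq"
        and eq: "\<Delta>' \<tturnstile> Eq Nat (g $ k $ PhiT a) (g $ k $ PhiT b)" for \<Delta>' k a b
      using eq_trans[OF h eq_trans[OF eq eq_sym[OF h]]] by simp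
    show "\<Delta> \<tturnstile> hastmodF f"
    proof (rule hastmodF_I)
      show "\<Delta> \<tturnstile> ternary_extensional (K h) 0"
      proof (simp add: ternary_extensional_iff, safe)
        fix \<Delta>' k a b assume sub: "set \<Delta> \<subseteq> set \<Delta>'" and [simp]: "closed k Nat" "closed a NSeq" "closed b NSeq"
          and t: "\<Delta>' \<tturnstile> ternF a" "\<Delta>' \<tturnstile> ternF b"
          and eq: "\<forall>i. closed i Nat \<longrightarrow> \<Delta>' \<tturnstile> Eq Nat (a $ i) (b $ i)"
        \<comment> \<open>The two images are known to be equal only entry by entry, which is what
          \<open>extensional\<close> asks for. Agreement of the digits below \<open>i + 1\<close>
          covers entry \<open>i\<close>.\<close>
        have "\<Delta>' \<tturnstile> Eq Rat (PhiT a $ i) (PhiT b $ i)" if [simp]: "closed i Nat" for i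
          using agreeD[OF agree_PhiT[OF agree_pointwise[OF eq, of "sucT i"]], of i]
          by (simp add: nlessF_suc)
        then have "\<Delta>' \<tturnstile> Eq Nat (g $ k $ PhiT a) (g $ k $ PhiT b)"
          using ext sub t by (simp add: extensional_iff PhiT_unit)
        then show "\<Delta>' \<tturnstile> Eq Nat (h $ k $ a) (h $ k $ b)" by (simp add: hI)
      qed
      show "\<Delta> \<tturnstile> ternary_modulus (K f) (K h) 0"
      proof (simp add: ternary_modulus_iff, safe)
        fix \<Delta>' k a x assume sub: "set \<Delta> \<subseteq> set \<Delta>'" and [simp]: "closed k Nat" "closed a NSeq" "closed x Seq"
          and t: "\<Delta>' \<tturnstile> ternF a" and x: "\<Delta>' \<tturnstile> unitF x x"
          and near: "\<Delta>' \<tturnstile> nearF (h $ k $ a) (PhiT a) (PhiT a) x x"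
        have "\<Delta>' \<tturnstile> nearF (g $ k $ PhiT a) (PhiT a) (PhiT a) x x"
          by (rule nearF_cong[OF h _ _ near]) simp_all
        then show "\<Delta>' \<tturnstile> nearF k (f $ PhiT a) (f $ PhiT a) (f $ x) (f $ x)"
          using mod sub t x by (simp add: modulus_iff PhiT_unit)
      qed
      show "\<Delta> \<tturnstile> ternary_continuous (K h) 0"
      proof (simp add: ternary_continuous_iff, safe)
        fix \<Delta>' k a assume sub: "set \<Delta> \<subseteq> set \<Delta>'" and [simp]: "closed k Nat" "closed a NSeq"
          and t: "\<Delta>' \<tturnstile> ternF a"
        have "\<Delta>' \<tturnstile> Exists Nat (contF g k (PhiT a) (Bnd 3))"
          using cont sub t by (simp add: continuous_iff PhiT_unit)
        then show "\<Delta>' \<tturnstile> Exists Nat (tcontF h k a (Bnd 3))"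
        proof (rule exists_cases)
          fix \<Delta>1 n assume [simp]: "closed n Nat" and "\<Delta>1 \<tturnstile> inst 0 n (contF g k (PhiT a) (Bnd 3))"
          then have c: "\<Delta>1 \<tturnstile> contF g k (PhiT a) n" by simp
          \<comment> \<open>The point of continuity is passed on unchanged: digits that agree below
            \<open>n\<close> give images that agree below \<open>n\<close>.\<close>
          have "\<Delta>2 \<tturnstile> Eq Nat (h $ k $ a) (h $ k $ b)"
            if "set \<Delta>1 \<subseteq> set \<Delta>2" "closed b NSeq" "\<Delta>2 \<tturnstile> ternF b" "agree Nat \<Delta>2 n a b" for \<Delta>2 b
            using c that by (intro hI) (simp_all add: contF_iff PhiT_unit agree_PhiT)
          then have "\<Delta>1 \<tturnstile> tcontF h k a n" by (simp add: tcontF_iff)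
          then show "\<Delta>1 \<tturnstile> Exists Nat (tcontF h k a (Bnd 3))" by (intro D_existsI[of n]) simp_all
        qed
      qed
    qed simp_all
  qed simp
  then show ?thesis using assms by (auto simp: UCT_iff)
qed

section \<open>From moduli to ternary moduli\<close>

lemma within_sym: "within \<Delta> e a b \<Longrightarrow> within \<Delta> e b a"
  by (simp add: within_def)

lemma within_trans: "within \<Delta> e a b \<Longrightarrow> within \<Delta> e' b c \<Longrightarrow> within \<Delta> (e + e') a c"
  unfolding within_def
  using leq_add[of \<Delta> "a - b" e "b - c" e'] leq_add[of \<Delta> "b - a" e "c - b" e']
  by (auto elim!: leq_shift simp: algebra_simps)

lemma within_mono: "within \<Delta> e a b \<Longrightarrow> leq \<Delta> e e' \<Longrightarrow> within \<Delta> e' a b"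
  unfolding within_def by (blast intro: leq_trans)

lemma within_weaken: "within \<Delta> e a b \<Longrightarrow> set \<Delta> \<subseteq> set \<Delta>' \<Longrightarrow> within \<Delta>' e a b"
  unfolding within_def by (blast intro: leq_weaken)

lemma eq_pwT: "\<Delta> \<tturnstile> Eq Nat m n \<Longrightarrow> \<Delta> \<tturnstile> Eq Rat (pwT m) (pwT n)"
  unfolding pwT_def by (erule eq_arg) simp

text \<open>A telescoping sum. The bound is the exact value of the geometric sum, since the rounded
  bound 2^{-i} would not survive the induction step.\<close>

lemma regF_within_plus:
  assumes reg: "\<Delta> \<tturnstile> regF x x" and [simp]: "closed x Seq" "closed i Nat" "closed d Nat"
  shows "within \<Delta> (\<langle>pwT i\<rangle> - \<langle>pwT (nplusT i d)\<rangle>) \<langle>x $ i\<rangle> \<langle>x $ nplusT i d\<rangle>"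
proof -
  let ?\<phi> = "leF (absT2 (addT (x $ i) (negT (x $ nplusT i (Bnd 0))))
    (addT (x $ i) (negT (x $ nplusT i (Bnd 2))))) (addT (pwT i) (negT (pwT (nplusT i (Bnd 0)))))"
  have inst_iff: "\<Delta> \<tturnstile> inst 0 m ?\<phi> \<longleftrightarrow>
      within \<Delta> (\<langle>pwT i\<rangle> - \<langle>pwT (nplusT i m)\<rangle>) \<langle>x $ i\<rangle> \<langle>x $ nplusT i m\<rangle>"
    if [simp]: "closed m Nat" for m \<Delta> by (simp add: leF_absT_iff)
  have "\<Delta> \<tturnstile> inst 0 d ?\<phi>"
  proof (rule nat_induction)
    have "\<langle>x $ nplusT i (Con Zero)\<rangle> = \<langle>x $ i\<rangle>"
      by (rule ratq_eqI[OF eq_arg[OF nplusT_zero]]) simp_all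
    moreover have "\<langle>pwT (nplusT i (Con Zero))\<rangle> = \<langle>pwT i\<rangle>"
      by (rule ratq_eqI[OF eq_pwT[OF nplusT_zero]]) simp
    ultimately show "\<Delta> \<tturnstile> inst 0 (Con Zero) ?\<phi>"
      by (subst inst_iff) (simp_all add: within_def leq_refl)
  next
    fix \<Delta>' m assume sub: "set \<Delta> \<subseteq> set \<Delta>'" and [simp]: "closed m Nat" and IH: "\<Delta>' \<tturnstile> inst 0 m ?\<phi>"
    have "within \<Delta>' (\<langle>pwT i\<rangle> - \<langle>pwT (nplusT i m)\<rangle>) \<langle>x $ i\<rangle> \<langle>x $ nplusT i m\<rangle>"
      using IH inst_iff[of m] by simp
    moreover have "within \<Delta>' \<langle>pwT (sucT (nplusT i m))\<rangle> \<langle>x $ nplusT i m\<rangle> \<langle>x $ sucT (nplusT i m)\<rangle>"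
      using weaken[OF reg sub] by (simp add: regF_iff)
    ultimately have "within \<Delta>' (\<langle>pwT i\<rangle> - \<langle>pwT (nplusT i m)\<rangle> + \<langle>pwT (sucT (nplusT i m))\<rangle>)
        \<langle>x $ i\<rangle> \<langle>x $ sucT (nplusT i m)\<rangle>" by (rule within_trans)
    moreover have "\<langle>x $ nplusT i (sucT m)\<rangle> = \<langle>x $ sucT (nplusT i m)\<rangle>"
      by (rule ratq_eqI[OF eq_arg[OF nplusT_suc]]) simp_all
    moreover have "\<langle>pwT (nplusT i (sucT m))\<rangle> = \<langle>pwT (sucT (nplusT i m))\<rangle>"
      by (rule ratq_eqI[OF eq_pwT[OF nplusT_suc]]) simp_all
    ultimately show "\<Delta>' \<tturnstile> inst 0 (sucT m) ?\<phi>"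
      by (subst inst_iff) (simp_all add: pwT_double[of "nplusT i m"])
  qed simp_all
  then show ?thesis using inst_iff by simp
qed

text \<open>Comparing both entries with the one at index \<open>i + j\<close> avoids deciding which index is larger.\<close>

lemma regF_within:
  assumes reg: "\<Delta> \<tturnstile> regF x x" and [simp]: "closed x Seq" "closed i Nat" "closed j Nat"
  shows "within \<Delta> (\<langle>pwT i\<rangle> + \<langle>pwT j\<rangle>) \<langle>x $ i\<rangle> \<langle>x $ j\<rangle>"
proof -
  let ?s = "nplusT i j"
  have x: "\<langle>x $ nplusT j i\<rangle> = \<langle>x $ ?s\<rangle>"
    by (rule ratq_eqI[OF eq_arg[OF nplusT_commute]]) simp_all
  have p: "\<langle>pwT (nplusT j i)\<rangle> = \<langle>pwT ?s\<rangle>"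
    by (rule ratq_eqI[OF eq_pwT[OF nplusT_commute]]) simp_all
  have "within \<Delta> (\<langle>pwT i\<rangle> - \<langle>pwT ?s\<rangle>) \<langle>x $ i\<rangle> \<langle>x $ ?s\<rangle>"
    using regF_within_plus[OF reg] by simp
  moreover have "within \<Delta> (\<langle>pwT j\<rangle> - \<langle>pwT ?s\<rangle>) \<langle>x $ ?s\<rangle> \<langle>x $ j\<rangle>"
    using regF_within_plus[OF reg, of j i] within_sym by (simp add: x p)
  ultimately have w: "within \<Delta> (\<langle>pwT i\<rangle> - \<langle>pwT ?s\<rangle> + (\<langle>pwT j\<rangle> - \<langle>pwT ?s\<rangle>)) \<langle>x $ i\<rangle> \<langle>x $ j\<rangle>"
    by (rule within_trans)
  have "leq \<Delta> 0 \<langle>pwT ?s\<rangle>" by (simp add: pwT_nonneg)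
  from leq_add[OF this this] show ?thesis
    by (intro within_mono[OF w]) (erule leq_shift, simp add: algebra_simps)
qed

lemma equivF_sym:
  "closed x Seq \<Longrightarrow> closed y Seq \<Longrightarrow> \<Delta> \<tturnstile> equivF x x y y \<Longrightarrow> \<Delta> \<tturnstile> equivF y y x x"
  by (auto simp: equivF_iff intro: within_sym)

lemma nearF_equivF:
  assumes [simp]: "closed k Nat" "closed x Seq" "closed x' Seq" "closed y Seq"
    and reg: "\<Delta> \<tturnstile> regF x' x'" "\<Delta> \<tturnstile> regF y y"
    and eq: "\<Delta> \<tturnstile> equivF x x x' x'" and near: "\<Delta> \<tturnstile> nearF k x x y y"
  shows "\<Delta> \<tturnstile> nearF k x' x' y y"
proof -
  have "within \<Delta> (\<langle>pwT k\<rangle> + \<langle>pwT n\<rangle>) \<langle>x' $ sucT (sucT n)\<rangle> \<langle>y $ sucT (sucT n)\<rangle>"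
    if [simp]: "closed n Nat" for n
  proof -
    \<comment> \<open>The detour through the entries at \<open>n + 4\<close> is chosen so that the
      errors of regularity, equality and nearness add up to exactly 2^{-k} + 2^{-n}: three times
      2^{-(n+2)}, twice 2^{-(n+4)} and once 2^{-(n+3)} make 2^{-n}.\<close>
    let ?i = "sucT (sucT n)" and ?m = "sucT (sucT (sucT (sucT n)))"
    have "within \<Delta> (\<langle>pwT ?i\<rangle> + \<langle>pwT ?m\<rangle>) \<langle>x' $ ?i\<rangle> \<langle>x' $ ?m\<rangle>"
      by (rule regF_within[OF reg(1)]) simp_all
    also have "within \<Delta> \<langle>pwT (sucT ?i)\<rangle> \<langle>x' $ ?m\<rangle> \<langle>x $ ?m\<rangle>"
      using equivF_sym[OF _ _ eq] by (simp add: equivF_iff)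
    finally (within_trans) have 1: "within \<Delta> (\<langle>pwT ?i\<rangle> + \<langle>pwT ?m\<rangle> + \<langle>pwT (sucT ?i)\<rangle>) \<langle>x' $ ?i\<rangle> \<langle>x $ ?m\<rangle>" .
    have 2: "within \<Delta> (\<langle>pwT k\<rangle> + \<langle>pwT ?i\<rangle>) \<langle>x $ ?m\<rangle> \<langle>y $ ?m\<rangle>"
      using near by (simp add: nearF_iff)
    have 3: "within \<Delta> (\<langle>pwT ?m\<rangle> + \<langle>pwT ?i\<rangle>) \<langle>y $ ?m\<rangle> \<langle>y $ ?i\<rangle>"
      by (rule regF_within[OF reg(2)]) simp_all
    show ?thesis
      by (rule within_mono[OF within_trans[OF within_trans[OF 1 2] 3]])
        (rule leq_shift[OF leq_refl[of _ 0]], simp add: pwT_double[of n] pwT_double[of "sucT n"]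
          pwT_double[of ?i] pwT_double[of "sucT ?i"])
  qed
  then show ?thesis by (simp add: nearF_iff)
qed

text \<open>
  With \<open>q\<close> the entry of \<open>x\<close> at index \<open>n + 3\<close>, $c = 2^{-(n+1)} r$ and $e = 2^{-(n+3)}$, the digit is
  the number of failures among \<open>q \<le> c + e\<close> and \<open>q \<le> c - e\<close>.
\<close>

definition digT :: "tm \<Rightarrow> tm \<Rightarrow> tm \<Rightarrow> tm" where
  "digT x n r = nplusT
    (leqT (x $ sucT (sucT (sucT n))) (addT (mulT (pwT (sucT n)) r) (pwT (sucT (sucT (sucT n))))))
    (leqT (x $ sucT (sucT (sucT n))) (addT (mulT (pwT (sucT n)) r) (negT (pwT (sucT (sucT (sucT n)))))))"

text \<open>This is the number N of the digits chosen so far. A digit depends on the earlier ones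
  only through this number, so recursion on the number alone suffices and no coding of finite
  sequences enters.\<close>

definition numT :: "tm \<Rightarrow> tm \<Rightarrow> tm" where
  "numT x n = recT Rat (Con QOne) (Lam Nat (Lam Rat
     (addT (mulT twoT (Bnd 0)) (addT (natT (digT x (Bnd 1) (Bnd 0))) (negT (Con QOne)))))) n"

text \<open>As with \<open>absT2\<close>, the sequence occurs at two binding depths.\<close>

definition alphaT2 :: "tm \<Rightarrow> tm \<Rightarrow> tm" where
  "alphaT2 x x' = Lam Nat (digT x (Bnd 0) (numT x' (Bnd 0)))"

abbreviation alphaT :: "tm \<Rightarrow> tm" where "alphaT x \<equiv> alphaT2 x x"

lemma alphaT_syntax [simp]:
  "tyof Ts x = Some Seq \<Longrightarrow> tyof Ts n = Some Nat \<Longrightarrow> tyof Ts r = Some Rat \<Longrightarrow>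
    tyof Ts (digT x n r) = Some Nat"
  "inst_tm k u (digT x n r) = digT (inst_tm k u x) (inst_tm k u n) (inst_tm k u r)"
  "tyof (Rat # Nat # Ts) x = Some Seq \<Longrightarrow> tyof Ts n = Some Nat \<Longrightarrow> tyof Ts (numT x n) = Some Rat"
  "inst_tm k u (numT x n) = numT (inst_tm (k + 2) u x) (inst_tm k u n)"
  "tyof (Nat # Ts) x = Some Seq \<Longrightarrow> tyof (Rat # Nat # Nat # Ts) x' = Some Seq \<Longrightarrow>
    tyof Ts (alphaT2 x x') = Some NSeq"
  "inst_tm k u (alphaT2 x x') = alphaT2 (inst_tm (k + 1) u x) (inst_tm (k + 3) u x')"
  by (simp_all add: digT_def numT_def alphaT2_def eval_nat_numeral)

lemma eq_nplusT: "\<Delta> \<tturnstile> Eq Nat m m' \<Longrightarrow> \<Delta> \<tturnstile> Eq Nat n n' \<Longrightarrow> \<Delta> \<tturnstile> Eq Nat (nplusT m n) (nplusT m' n')"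
  unfolding nplusT_def by (rule eq_app[OF eq_fun[OF eq_arg]]) simp_all

lemma digT_cases:
  fixes x n r
  defines "q \<equiv> \<langle>x $ sucT (sucT (sucT n))\<rangle>" and "c \<equiv> \<langle>pwT (sucT n)\<rangle> * \<langle>r\<rangle>"
    and "e \<equiv> \<langle>pwT (sucT (sucT (sucT n)))\<rangle>"
  assumes [simp]: "closed x Seq" "closed n Nat" "closed r Rat"
    and zero: "\<And>\<Delta>'. set \<Delta> \<subseteq> set \<Delta>' \<Longrightarrow> \<Delta>' \<tturnstile> Eq Nat (digT x n r) (Con Zero) \<Longrightarrow> leq \<Delta>' q (c - e) \<Longrightarrow>
      \<Delta>' \<tturnstile> \<phi>"
    and one: "\<And>\<Delta>'. set \<Delta> \<subseteq> set \<Delta>' \<Longrightarrow> \<Delta>' \<tturnstile> Eq Nat (digT x n r) (sucT (Con Zero)) \<Longrightarrow>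
      leq \<Delta>' (c - e) q \<Longrightarrow> leq \<Delta>' q (c + e) \<Longrightarrow> \<Delta>' \<tturnstile> \<phi>"
    and two: "\<And>\<Delta>'. set \<Delta> \<subseteq> set \<Delta>' \<Longrightarrow> \<Delta>' \<tturnstile> Eq Nat (digT x n r) (sucT (sucT (Con Zero))) \<Longrightarrow>
      leq \<Delta>' (c + e) q \<Longrightarrow> \<Delta>' \<tturnstile> \<phi>"
  shows "\<Delta> \<tturnstile> \<phi>"
proof -
  define u where "u = x $ sucT (sucT (sucT n))"
  define v where "v = addT (mulT (pwT (sucT n)) r) (pwT (sucT (sucT (sucT n))))"
  define w where "w = addT (mulT (pwT (sucT n)) r) (negT (pwT (sucT (sucT (sucT n)))))"
  have [simp]: "closed u Rat" "closed v Rat" "closed w Rat" by (simp_all add: u_def v_def w_def)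
  have val: "\<langle>u\<rangle> = q" "\<langle>v\<rangle> = c + e" "\<langle>w\<rangle> = c - e"
    by (simp_all add: u_def v_def w_def q_def c_def e_def)
  have dig: "digT x n r = nplusT (leqT u v) (leqT u w)" by (simp add: digT_def u_def v_def w_def)
  have wv: "leq \<Delta> (c - e) (c + e)" for \<Delta>
  proof -
    have "leq \<Delta> 0 e" by (simp add: e_def pwT_nonneg)
    from leq_add[OF this this] show ?thesis by (rule leq_shift) simp
  qed
  let ?z = "Con Zero" and ?o = "sucT (Con Zero)"
  have sums: "\<Delta> \<tturnstile> Eq Nat (nplusT m ?o) (sucT m)" if "closed m Nat" for \<Delta> m
    using eq_trans[OF nplusT_suc eq_suc[OF nplusT_zero]] that by simp
  show ?thesis
  proof (rule disj_cases[OF leF_decidable[of u v]])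
    fix \<Delta>1 assume s1: "set \<Delta> \<subseteq> set \<Delta>1" and uv1: "\<Delta>1 \<tturnstile> leF u v"
    show "\<Delta>1 \<tturnstile> \<phi>"
    proof (rule disj_cases[OF leF_decidable[of u w]])
      fix \<Delta>2 assume s2: "set \<Delta>1 \<subseteq> set \<Delta>2" and uw: "\<Delta>2 \<tturnstile> leF u w"
      have uv: "\<Delta>2 \<tturnstile> leF u v" by (rule weaken[OF uv1 s2])
      have "\<Delta>2 \<tturnstile> Eq Nat (digT x n r) ?z"
        unfolding dig by (rule eq_trans[OF eq_nplusT[OF uv uw] nplusT_zero]) simp
      then show "\<Delta>2 \<tturnstile> \<phi>" using s1 s2 uw by (intro zero) (simp_all add: leq_iff val)
    next
      fix \<Delta>2 assume s2: "set \<Delta>1 \<subseteq> set \<Delta>2" and uw: "\<Delta>2 \<tturnstile> Eq Nat (leqT u w) ?o"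
      have uv: "\<Delta>2 \<tturnstile> leF u v" by (rule weaken[OF uv1 s2])
      have "\<Delta>2 \<tturnstile> Eq Nat (digT x n r) ?o"
        unfolding dig by (rule eq_trans[OF eq_nplusT[OF uv uw] sums]) simp
      then show "\<Delta>2 \<tturnstile> \<phi>" using s1 s2 uv not_leqD[OF _ _ uw]
        by (intro one) (simp_all add: leq_iff val)
    qed simp_all
  next
    fix \<Delta>1 assume s1: "set \<Delta> \<subseteq> set \<Delta>1" and uv1: "\<Delta>1 \<tturnstile> Eq Nat (leqT u v) ?o"
    show "\<Delta>1 \<tturnstile> \<phi>"
    proof (rule disj_cases[OF leF_decidable[of u w]])
      fix \<Delta>2 assume s2: "set \<Delta>1 \<subseteq> set \<Delta>2" and uw: "\<Delta>2 \<tturnstile> leF u w"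
      have uv: "\<Delta>2 \<tturnstile> Eq Nat (leqT u v) ?o" by (rule weaken[OF uv1 s2])
      have "\<Delta>2 \<tturnstile> Eq Nat (digT x n r) ?o"
        unfolding dig by (rule eq_trans[OF eq_nplusT[OF uv uw] nplusT_zero]) simp
      \<comment> \<open>This combination of outcomes need not be refuted: through c - e \<le> c + e,
        the two inequalities c + e \<le> q and q \<le> c - e imply those required for the digit
        1.\<close>
      moreover have "leq \<Delta>2 (c + e) q" using not_leqD[OF _ _ uv] by (simp add: val)
      moreover have "leq \<Delta>2 q (c - e)" using uw by (simp add: leq_iff val)
      ultimately show "\<Delta>2 \<tturnstile> \<phi>" using s1 s2 by (intro one) (auto intro: leq_trans wv)
    next
      fix \<Delta>2 assume s2: "set \<Delta>1 \<subseteq> set \<Delta>2" and uw: "\<Delta>2 \<tturnstile> Eq Nat (leqT u w) ?o"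
      have uv: "\<Delta>2 \<tturnstile> Eq Nat (leqT u v) ?o" by (rule weaken[OF uv1 s2])
      have "\<Delta>2 \<tturnstile> Eq Nat (digT x n r) (sucT ?o)"
        unfolding dig by (rule eq_trans[OF eq_nplusT[OF uv uw] sums]) simp
      then show "\<Delta>2 \<tturnstile> \<phi>" using s1 s2 not_leqD[OF _ _ uv] by (intro two) (simp_all add: val)
    qed simp_all
  qed simp_all
qed

lemma numT_suc_eq:
  "closed x Seq \<Longrightarrow> closed n Nat \<Longrightarrow> \<Delta> \<tturnstile> Eq Rat (numT x (sucT n))
    (addT (mulT twoT (numT x n)) (addT (natT (digT x n (numT x n))) (negT (Con QOne))))"
  unfolding numT_def by (rule rec_lam_suc) simp_all

lemma eq_alphaT_app:
  "closed x Seq \<Longrightarrow> closed n Nat \<Longrightarrow> \<Delta> \<tturnstile> Eq Nat (alphaT x $ n) (digT x n (numT x n))"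
  unfolding alphaT2_def by (rule eq_beta) simp_all

text \<open>A digit is the sum of two values of a characteristic function, each 0 or 1, whatever the
  sequence is.\<close>

lemma ternF_alphaT:
  assumes [simp]: "closed x Seq"
  shows "\<Delta> \<tturnstile> ternF (alphaT x)"
proof -
  have "\<Delta> \<tturnstile> Disj (Eq Nat (alphaT x $ n) (Con Zero)) (Disj (Eq Nat (alphaT x $ n) (sucT (Con Zero)))
      (Eq Nat (alphaT x $ n) (sucT (sucT (Con Zero)))))" if [simp]: "closed n Nat" for n
    by (rule digT_cases[of x n "numT x n"])
      (simp_all add: D_disjI1 D_disjI2 eq_trans[OF eq_alphaT_app])
  then show ?thesis by (simp add: ternF_def ternary_def builder_defs forall_iff)
qed

text \<open>\<open>PhiT\<close> recomputes the number from the finished digits, whereas the digits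
  were chosen by means of the number carried along in \<open>numT\<close>; this links the two
  recursions.\<close>

lemma ternT_alphaT:
  assumes [simp]: "closed x Seq" "closed n Nat"
  shows "\<Delta> \<tturnstile> Eq Rat (ternT (alphaT x) n) (numT x n)"
proof -
  let ?\<phi> = "Eq Rat (ternT (alphaT x) (Bnd 0)) (numT x (Bnd 0))"
  have "\<Delta> \<tturnstile> inst 0 n ?\<phi>"
  proof (rule nat_induction)
    have "\<Delta> \<tturnstile> Eq Rat (ternT (alphaT x) (Con Zero)) (numT x (Con Zero))"
      unfolding ternT_def numT_def by (rule eq_trans[OF rec_zero eq_sym[OF rec_zero]]) simp_all
    then show "\<Delta> \<tturnstile> inst 0 (Con Zero) ?\<phi>" by simp
  next
    fix \<Delta>' m assume [simp]: "closed m Nat" and "\<Delta>' \<tturnstile> inst 0 m ?\<phi>"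
    then have "\<Delta>' \<tturnstile> Eq Rat (ternT (alphaT x) m) (numT x m)" by simp
    from eq_trans[OF ternT_suc_eq eq_trans[OF eq_tern_step[OF this eq_alphaT_app] eq_sym[OF numT_suc_eq]]]
    show "\<Delta>' \<tturnstile> inst 0 (sucT m) ?\<phi>" by simp
  qed simp_all
  then show ?thesis by simp
qed

text \<open>Induction on \<open>n\<close> with \<open>j\<close> fixed. Stage \<open>n\<close>
  inspects the entry at \<open>n + 3\<close>, which regularity places within 2^{-(j+1)} + 2^{-(n+3)}
  of the entry at \<open>j + 1\<close>; the first error is absorbed by the slack 2^{-j}, the second
  by the overlap of the candidate intervals.\<close>

lemma PhiT_alphaT_within:
  assumes x: "\<Delta> \<tturnstile> unitF x x" and [simp]: "closed x Seq" "closed n Nat" "closed j Nat"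
  shows "within \<Delta> (\<langle>pwT (sucT n)\<rangle> + \<langle>pwT j\<rangle>) \<langle>x $ sucT j\<rangle> \<langle>PhiT (alphaT x) $ n\<rangle>"
proof -
  let ?F = "PhiT (alphaT x)"
  let ?\<phi> = "leF (absT2 (addT (x $ sucT j) (negT (?F $ Bnd 0))) (addT (x $ sucT j) (negT (?F $ Bnd 2))))
    (addT (pwT (sucT (Bnd 0))) (pwT j))"
  have inst_iff: "\<Delta> \<tturnstile> inst 0 m ?\<phi> \<longleftrightarrow>
      within \<Delta> (\<langle>pwT (sucT m)\<rangle> + \<langle>pwT j\<rangle>) \<langle>x $ sucT j\<rangle> \<langle>?F $ m\<rangle>"
    if [simp]: "closed m Nat" for m \<Delta> by (simp add: leF_absT_iff)
  have "\<Delta> \<tturnstile> inst 0 n ?\<phi>"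
  proof (rule nat_induction)
    \<comment> \<open>The empty sequence has the number 1, so c_0 = 1/2. Membership in the unit
      interval places the entry at \<open>j + 1\<close> between -2^{-j} and 1 + 2^{-j}, which is the
      origin of the slack.\<close>
    let ?h = "\<langle>pwT (sucT (Con Zero))\<rangle>"
    have h: "1 = ?h + ?h" using pwT_double[of "Con Zero"] by simp
    have lo: "leq \<Delta> 0 (\<langle>x $ sucT j\<rangle> + \<langle>pwT j\<rangle>)" and hi: "leq \<Delta> \<langle>x $ sucT j\<rangle> (?h + ?h + \<langle>pwT j\<rangle>)"
      using x unfolding h[symmetric] by (simp_all add: unitF_iff)
    have "within \<Delta> (?h + \<langle>pwT j\<rangle>) \<langle>x $ sucT j\<rangle> ?h"
      unfolding within_def
      by (rule conjI, rule leq_shift[OF hi], simp add: algebra_simps, rule leq_shift[OF lo],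
          simp add: algebra_simps)
    then show "\<Delta> \<tturnstile> inst 0 (Con Zero) ?\<phi>"
      by (subst inst_iff) (simp_all add: PhiT_app)
  next
    fix \<Delta>1 m assume s1: "set \<Delta> \<subseteq> set \<Delta>1" and [simp]: "closed m Nat" and IH: "\<Delta>1 \<tturnstile> inst 0 m ?\<phi>"
    \<comment> \<open>Everything is expressed by p = 2^{-(m+3)} and u = 2^{-(j+1)}: the radius drops
      from 4p + 2u to 2p + 2u, and the digit d moves the centre by 2p (d - 1).\<close>
    define p where "p = \<langle>pwT (sucT (sucT (sucT m)))\<rangle>"
    define u where "u = \<langle>pwT (sucT j)\<rangle>"
    define Y where "Y = \<langle>x $ sucT j\<rangle>"
    define X where "X = \<langle>x $ sucT (sucT (sucT m))\<rangle>"
    define c where "c = \<langle>?F $ m\<rangle>"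
    define E where "E = (p + p) * \<langle>natT (digT x m (numT x m))\<rangle>"
    have p2: "\<langle>pwT (sucT (sucT m))\<rangle> = p + p" by (simp add: p_def pwT_double[of "sucT (sucT m)"])
    have p1: "\<langle>pwT (sucT m)\<rangle> = p + p + (p + p)" by (simp add: pwT_double[of "sucT m"] p2)
    have j: "\<langle>pwT j\<rangle> = u + u" by (simp add: u_def pwT_double[of j])
    have "\<langle>natT (alphaT x $ m)\<rangle> = \<langle>natT (digT x m (numT x m))\<rangle>"
      by (rule ratq_eqI[OF eq_arg[OF eq_alphaT_app]]) simp_all
    then have c': "\<langle>?F $ sucT m\<rangle> = c + E - (p + p)"
      by (simp add: PhiT_suc p2 c_def E_def)
    have c_num: "\<langle>pwT (sucT m)\<rangle> * \<langle>numT x m\<rangle> = c"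
      by (simp add: c_def PhiT_app ratq_eqI[OF ternT_alphaT])
    have goal_iff: "\<Delta> \<tturnstile> inst 0 (sucT m) ?\<phi> \<longleftrightarrow>
        leq \<Delta> (Y - (c + E - (p + p))) (p + p + (u + u)) \<and>
        leq \<Delta> (c + E - (p + p) - Y) (p + p + (u + u))" for \<Delta>
      by (subst inst_iff) (simp_all add: c' p2 j Y_def within_def)
    have far: "leq \<Delta>' (Y - c) (p + p + (p + p) + (u + u))" "leq \<Delta>' (c - Y) (p + p + (p + p) + (u + u))"
      and near: "leq \<Delta>' (Y - X) (u + p)" "leq \<Delta>' (X - Y) (u + p)"
      and u: "leq \<Delta>' 0 u" and pp: "leq \<Delta>' 0 (p + p)" if s: "set \<Delta>1 \<subseteq> set \<Delta>'" for \<Delta>'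
    proof -
      have "within \<Delta>' (p + p + (p + p) + (u + u)) Y c"
        using within_weaken[OF _ s] IH inst_iff[of m \<Delta>1] by (simp add: p1 j Y_def c_def)
      then show "leq \<Delta>' (Y - c) (p + p + (p + p) + (u + u))" "leq \<Delta>' (c - Y) (p + p + (p + p) + (u + u))"
        by (simp_all add: within_def)
      have "\<Delta>' \<tturnstile> regF x x" using weaken[OF x, of \<Delta>'] s s1 by (simp add: unitF_iff)
      from regF_within[OF this, of "sucT j" "sucT (sucT (sucT m))"]
      show "leq \<Delta>' (Y - X) (u + p)" "leq \<Delta>' (X - Y) (u + p)"
        by (simp_all add: within_def Y_def X_def u_def p_def)
      show "leq \<Delta>' 0 u" by (simp add: u_def pwT_nonneg)
      show "leq \<Delta>' 0 (p + p)" by (simp add: p2[symmetric] pwT_nonneg)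
    qed
    \<comment> \<open>The value of the digit is known only in the context of its case, so
      \<open>E\<close> is bounded from both sides instead of being rewritten.\<close>
    have E: "leq \<Delta>' E ((p + p) * \<langle>natT d\<rangle>)" "leq \<Delta>' ((p + p) * \<langle>natT d\<rangle>) E"
      if s: "set \<Delta>1 \<subseteq> set \<Delta>'" and d: "\<Delta>' \<tturnstile> Eq Nat (digT x m (numT x m)) d" for \<Delta>' d
      using eq_natT[OF d] pp[OF s] by (simp_all add: E_def leq_mult_left)
    show "\<Delta>1 \<tturnstile> inst 0 (sucT m) ?\<phi>"
    proof (rule digT_cases[of x m "numT x m"])
      fix \<Delta>' assume s: "set \<Delta>1 \<subseteq> set \<Delta>'" and d: "\<Delta>' \<tturnstile> Eq Nat (digT x m (numT x m)) (Con Zero)"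
        and "leq \<Delta>' \<langle>x $ sucT (sucT (sucT m))\<rangle>
          (\<langle>pwT (sucT m)\<rangle> * \<langle>numT x m\<rangle> - \<langle>pwT (sucT (sucT (sucT m)))\<rangle>)"
      then have hi: "leq \<Delta>' X (c - p)" by (simp add: c_num X_def p_def)
      note E = E[OF s d] and far = far[OF s] and near = near[OF s] and u = u[OF s]
      show "\<Delta>' \<tturnstile> inst 0 (sucT m) ?\<phi>" unfolding goal_iff
      proof
        \<comment> \<open>The comparison bounds the entry from above, by c + u. The lower bound is
          inherited from the previous stage, since centre and radius both decrease by 2p. The digit
          2 is the mirror image.\<close>
        show "leq \<Delta>' (Y - (c + E - (p + p))) (p + p + (u + u))"
          by (rule leq_shift[OF leq_add[OF leq_add[OF near(1) hi] leq_add[OF E(2) u]]])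
            (simp add: algebra_simps)
        show "leq \<Delta>' (c + E - (p + p) - Y) (p + p + (u + u))"
          by (rule leq_shift[OF leq_add[OF far(2) E(1)]]) (simp add: algebra_simps)
      qed
    next
      fix \<Delta>' assume s: "set \<Delta>1 \<subseteq> set \<Delta>'" and d: "\<Delta>' \<tturnstile> Eq Nat (digT x m (numT x m)) (sucT (Con Zero))"
        and "leq \<Delta>' (\<langle>pwT (sucT m)\<rangle> * \<langle>numT x m\<rangle> - \<langle>pwT (sucT (sucT (sucT m)))\<rangle>)
          \<langle>x $ sucT (sucT (sucT m))\<rangle>"
        and "leq \<Delta>' \<langle>x $ sucT (sucT (sucT m))\<rangle>
          (\<langle>pwT (sucT m)\<rangle> * \<langle>numT x m\<rangle> + \<langle>pwT (sucT (sucT (sucT m)))\<rangle>)"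
      then have lo: "leq \<Delta>' (c - p) X" and hi: "leq \<Delta>' X (c + p)" by (simp_all add: c_num X_def p_def)
      note E = E[OF s d] and near = near[OF s] and u = u[OF s]
      show "\<Delta>' \<tturnstile> inst 0 (sucT m) ?\<phi>" unfolding goal_iff
      proof
        \<comment> \<open>The centre stays at c, and the two comparisons give both bounds, each with
          error 2p + u.\<close>
        show "leq \<Delta>' (Y - (c + E - (p + p))) (p + p + (u + u))"
          by (rule leq_shift[OF leq_add[OF leq_add[OF near(1) hi] leq_add[OF E(2) u]]])
            (simp add: algebra_simps)
        show "leq \<Delta>' (c + E - (p + p) - Y) (p + p + (u + u))"
          by (rule leq_shift[OF leq_add[OF leq_add[OF near(2) lo] leq_add[OF E(1) u]]])
            (simp add: algebra_simps)
      qed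
    next
      fix \<Delta>' assume s: "set \<Delta>1 \<subseteq> set \<Delta>'"
        and d: "\<Delta>' \<tturnstile> Eq Nat (digT x m (numT x m)) (sucT (sucT (Con Zero)))"
        and "leq \<Delta>' (\<langle>pwT (sucT m)\<rangle> * \<langle>numT x m\<rangle> + \<langle>pwT (sucT (sucT (sucT m)))\<rangle>)
          \<langle>x $ sucT (sucT (sucT m))\<rangle>"
      then have lo: "leq \<Delta>' (c + p) X" by (simp add: c_num X_def p_def)
      note E = E[OF s d] and far = far[OF s] and near = near[OF s] and u = u[OF s]
      show "\<Delta>' \<tturnstile> inst 0 (sucT m) ?\<phi>" unfolding goal_iff
      proof
        show "leq \<Delta>' (Y - (c + E - (p + p))) (p + p + (u + u))"
          by (rule leq_shift[OF leq_add[OF far(1) E(2)]]) (simp add: algebra_simps)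
        show "leq \<Delta>' (c + E - (p + p) - Y) (p + p + (u + u))"
          by (rule leq_shift[OF leq_add[OF leq_add[OF near(2) lo] leq_add[OF E(1) u]]])
            (simp add: algebra_simps)
      qed
    qed simp_all
  qed simp_all
  then show ?thesis using inst_iff by simp
qed

lemma PhiT_alphaT_equivF:
  assumes x: "\<Delta> \<tturnstile> unitF x x" and [simp]: "closed x Seq"
  shows "\<Delta> \<tturnstile> equivF x x (PhiT (alphaT x)) (PhiT (alphaT x))"
proof -
  have "within \<Delta> \<langle>pwT n\<rangle> \<langle>x $ sucT n\<rangle> \<langle>PhiT (alphaT x) $ sucT n\<rangle>" if [simp]: "closed n Nat" for n
  proof -
    \<comment> \<open>The invariant with \<open>j = n\<close> would only give 2^{-(n+2)} + 2^{-n},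
      which is too large. Passing through the entry at \<open>n + 4\<close> costs 2^{-(n+1)} +
      2^{-(n+4)} + 2^{-(n+2)} + 2^{-(n+3)}, which is 2^{-n} - 2^{-(n+4)}.\<close>
    let ?m = "sucT (sucT (sucT n))"
    have "within \<Delta> (\<langle>pwT (sucT n)\<rangle> + \<langle>pwT (sucT ?m)\<rangle>) \<langle>x $ sucT n\<rangle> \<langle>x $ sucT ?m\<rangle>"
      using x by (intro regF_within) (simp_all add: unitF_iff)
    moreover have "within \<Delta> (\<langle>pwT (sucT (sucT n))\<rangle> + \<langle>pwT ?m\<rangle>) \<langle>x $ sucT ?m\<rangle>
        \<langle>PhiT (alphaT x) $ sucT n\<rangle>"
      by (rule PhiT_alphaT_within[OF x]) simp_all
    ultimately have w: "within \<Delta> (\<langle>pwT (sucT n)\<rangle> + \<langle>pwT (sucT ?m)\<rangle> + (\<langle>pwT (sucT (sucT n))\<rangle> + \<langle>pwT ?m\<rangle>))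
        \<langle>x $ sucT n\<rangle> \<langle>PhiT (alphaT x) $ sucT n\<rangle>" by (rule within_trans)
    have "leq \<Delta> 0 \<langle>pwT (sucT ?m)\<rangle>" by (simp add: pwT_nonneg)
    then show ?thesis
      by (intro within_mono[OF w]) (erule leq_shift, simp add: pwT_double[of n] pwT_double[of "sucT n"]
          pwT_double[of "sucT (sucT n)"] pwT_double[of ?m] algebra_simps)
  qed
  then show ?thesis by (simp add: equivF_iff)
qed

lemma eq_digT:
  assumes x: "\<Delta> \<tturnstile> Eq Rat (x $ sucT (sucT (sucT n))) (y $ sucT (sucT (sucT n)))"
    and r: "\<Delta> \<tturnstile> Eq Rat r s" and [simp]: "closed n Nat"
  shows "\<Delta> \<tturnstile> Eq Nat (digT x n r) (digT y n s)"
proof -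
  have c: "\<Delta> \<tturnstile> Eq Rat (mulT (pwT (sucT n)) r) (mulT (pwT (sucT n)) s)"
    by (rule eq_arg[OF r]) simp
  have "\<Delta> \<tturnstile> Eq Nat (leqT (x $ sucT (sucT (sucT n))) (addT (mulT (pwT (sucT n)) r) t))
      (leqT (y $ sucT (sucT (sucT n))) (addT (mulT (pwT (sucT n)) s) t))"
    if "closed t Rat" for t
    by (rule eq_app[OF eq_arg[OF x] eq_fun[OF eq_arg[OF c]]]) (simp_all add: that)
  then show ?thesis unfolding digT_def by (intro eq_nplusT) simp_all
qed

text \<open>The digit at \<open>i\<close> reads the entry at \<open>i + 3\<close>, and
  \<open>i < n\<close> puts this index below \<open>n + 3\<close>. It also depends on the number of
  the preceding digits, so the numbers are first shown to agree by induction.\<close>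

lemma agree_alphaT:
  assumes ag: "agree Rat \<Delta> (sucT (sucT (sucT n))) x y"
    and [simp]: "closed x Seq" "closed y Seq" "closed n Nat"
  shows "agree Nat \<Delta> n (alphaT x) (alphaT y)"
proof -
  have x: "\<Delta>' \<tturnstile> Eq Rat (x $ sucT (sucT (sucT i))) (y $ sucT (sucT (sucT i)))"
    if "set \<Delta> \<subseteq> set \<Delta>'" "closed i Nat" "\<Delta>' \<tturnstile> nlessF i n" for \<Delta>' i
    using that by (intro agreeD[OF agree_weaken[OF ag]] nlessF_sucI) simp_all
  have num: "\<Delta>' \<tturnstile> Eq Rat (numT x i) (numT y i)"
    if sub: "set \<Delta> \<subseteq> set \<Delta>'" and [simp]: "closed i Nat" and i: "\<Delta>' \<tturnstile> nlessF i n" for \<Delta>' i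
  proof -
    let ?\<phi> = "Impl (nlessF (Bnd 1) n) (Eq Rat (numT x (Bnd 0)) (numT y (Bnd 0)))"
    have "\<Delta>' \<tturnstile> inst 0 i ?\<phi>"
    proof (rule nat_induction)
      have "\<Delta>1 \<tturnstile> Eq Rat (numT x (Con Zero)) (numT y (Con Zero))" for \<Delta>1
        unfolding numT_def by (rule eq_trans[OF rec_zero eq_sym[OF rec_zero]]) simp_all
      then show "\<Delta>' \<tturnstile> inst 0 (Con Zero) ?\<phi>" by (simp add: impl_iff)
    next
      fix \<Delta>1 m assume sub1: "set \<Delta>' \<subseteq> set \<Delta>1" and [simp]: "closed m Nat" and IH: "\<Delta>1 \<tturnstile> inst 0 m ?\<phi>"
      have "\<Delta>2 \<tturnstile> Eq Rat (numT x (sucT m)) (numT y (sucT m))"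
        if sub2: "set \<Delta>1 \<subseteq> set \<Delta>2" and suc: "\<Delta>2 \<tturnstile> nlessF (sucT m) n" for \<Delta>2
      proof -
        from suc have m: "\<Delta>2 \<tturnstile> nlessF m n" by (rule nlessF_sucD[rotated 2]) simp_all
        have IH': "\<Delta>2 \<tturnstile> Eq Rat (numT x m) (numT y m)" using IH sub2 m by (simp add: impl_iff)
        have "\<Delta>2 \<tturnstile> Eq Rat (x $ sucT (sucT (sucT m))) (y $ sucT (sucT (sucT m)))"
          using sub sub1 sub2 m by (intro x) auto
        from eq_digT[OF this IH']
        have "\<Delta>2 \<tturnstile> Eq Nat (digT x m (numT x m)) (digT y m (numT y m))" by simp
        from eq_trans[OF numT_suc_eq eq_trans[OF eq_tern_step[OF IH' this] eq_sym[OF numT_suc_eq]]]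
        show ?thesis by simp
      qed
      then show "\<Delta>1 \<tturnstile> inst 0 (sucT m) ?\<phi>" by (simp add: impl_iff)
    qed simp_all
    then show ?thesis using i by (simp add: impl_iff)
  qed
  show ?thesis unfolding agree_def
  proof (intro allI impI)
    fix \<Delta>' i assume sub: "set \<Delta> \<subseteq> set \<Delta>'" and [simp]: "closed i Nat" and i: "\<Delta>' \<tturnstile> nlessF i n"
    from eq_digT[OF x[OF sub _ i] num[OF sub _ i]]
    have "\<Delta>' \<tturnstile> Eq Nat (digT x i (numT x i)) (digT y i (numT y i))" by simp
    from eq_trans[OF eq_alphaT_app eq_trans[OF this eq_sym[OF eq_alphaT_app]]]
    show "\<Delta>' \<tturnstile> Eq Nat (alphaT x $ i) (alphaT y $ i)" by simp
  qed
qed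

lemma UCTc_imp_UCTc':
  assumes "\<Delta> \<tturnstile> UCTc 0"
  shows "\<Delta> \<tturnstile> UCTc' 0"
proof -
  have "\<Delta>0 \<tturnstile> hasmodF f"
    if [simp]: "closed f (Fun Seq Seq)" and f0: "\<Delta>0 \<tturnstile> real_function (K f) 0"
      and "\<Delta>0 \<tturnstile> hastmodF f" for f \<Delta>0
    using that(3)
  proof (rule hastmodF_cases)
    fix \<Delta> g assume sub0: "set \<Delta>0 \<subseteq> set \<Delta>" and [simp]: "closed g tmodTy"
      and ext: "\<Delta> \<tturnstile> ternary_extensional (K g) 0"
      and mod: "\<Delta> \<tturnstile> ternary_modulus (K f) (K g) 0" and cont: "\<Delta> \<tturnstile> ternary_continuous (K g) 0"
    have f: "\<Delta> \<tturnstile> real_function (K f) 0" by (rule weaken[OF f0 sub0])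
    \<comment> \<open>\<open>alphaT2\<close> uses its sequence below its own binder and, within
      \<open>numT\<close>, below two more; hence \<open>Bnd 1\<close> and \<open>Bnd 3\<close> for
      the same bound sequence.\<close>
    define h where "h = Lam Nat (Lam Seq (g $ Bnd 1 $ alphaT2 (Bnd 1) (Bnd 3)))"
    have [simp]: "closed h modTy" by (simp add: h_def)
    have h: "\<Delta>' \<tturnstile> Eq Nat (h $ k $ x) (g $ k $ alphaT x)"
      if [simp]: "closed k Nat" "closed x Seq" for \<Delta>' k x
      using eq_beta2[of Nat Seq "g $ Bnd 1 $ alphaT2 (Bnd 1) (Bnd 3)" Nat k x \<Delta>']
      by (simp add: h_def)
    have hI: "\<Delta>' \<tturnstile> Eq Nat (h $ k $ x) (h $ k $ y)"
      if [simp]: "closed k Nat" "closed x Seq" "closed y Seq"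
        and eq: "\<Delta>' \<tturnstile> Eq Nat (g $ k $ alphaT x) (g $ k $ alphaT y)" for \<Delta>' k x y
      using eq_trans[OF h eq_trans[OF eq eq_sym[OF h]]] by simp
    show "\<Delta> \<tturnstile> hasmodF f"
    proof (rule hasmodF_I)
      show "\<Delta> \<tturnstile> extensional (K h) 0"
      proof (simp add: extensional_iff, safe)
        fix \<Delta>' k x y assume sub: "set \<Delta> \<subseteq> set \<Delta>'" and [simp]: "closed k Nat" "closed x Seq" "closed y Seq"
          and eq: "\<forall>i. closed i Nat \<longrightarrow> \<Delta>' \<tturnstile> Eq Rat (x $ i) (y $ i)"
        have "\<Delta>' \<tturnstile> Eq Nat (alphaT x $ i) (alphaT y $ i)" if [simp]: "closed i Nat" for i
          using agreeD[OF agree_alphaT[OF agree_pointwise[OF eq], of "sucT i"], of i]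
          by (simp add: nlessF_suc)
        then have "\<Delta>' \<tturnstile> Eq Nat (g $ k $ alphaT x) (g $ k $ alphaT y)"
          using ext sub by (simp add: ternary_extensional_iff ternF_alphaT)
        then show "\<Delta>' \<tturnstile> Eq Nat (h $ k $ x) (h $ k $ y)" by (simp add: hI)
      qed
      show "\<Delta> \<tturnstile> modulus (K f) (K h) 0"
      proof (simp add: modulus_iff, safe)
        fix \<Delta>' k x y assume sub: "set \<Delta> \<subseteq> set \<Delta>'" and [simp]: "closed k Nat" "closed x Seq" "closed y Seq"
          and x: "\<Delta>' \<tturnstile> unitF x x" and y: "\<Delta>' \<tturnstile> unitF y y"
          and near: "\<Delta>' \<tturnstile> nearF (h $ k $ x) x x y y"
        \<comment> \<open>A ternary modulus speaks only about points of the form \<Phi>(\<alpha>).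
          So \<open>x\<close> is replaced by the equal real \<open>?z\<close> in the hypothesis, the
          modulus is applied at \<open>?z\<close>, and the conclusion is carried back to
          \<open>x\<close> because \<open>f\<close> respects \<simeq>.\<close>
        let ?z = "PhiT (alphaT x)"
        have z: "\<Delta>' \<tturnstile> unitF ?z ?z" by (simp add: PhiT_unit ternF_alphaT)
        have xz: "\<Delta>' \<tturnstile> equivF x x ?z ?z" by (rule PhiT_alphaT_equivF[OF x]) simp
        have "\<Delta>' \<tturnstile> nearF (g $ k $ alphaT x) x x y y"
          by (rule nearF_cong[OF h _ _ near]) simp_all
        moreover have "\<Delta>' \<tturnstile> regF ?z ?z" "\<Delta>' \<tturnstile> regF y y"
          using y z by (simp_all add: unitF_iff)
        ultimately have "\<Delta>' \<tturnstile> nearF (g $ k $ alphaT x) ?z ?z y y"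
          using xz by (simp add: nearF_equivF[of "g $ k $ alphaT x" x ?z])
        then have fz: "\<Delta>' \<tturnstile> nearF k (f $ ?z) (f $ ?z) (f $ y) (f $ y)"
          using mod sub y by (simp add: ternary_modulus_iff ternF_alphaT)
        have reg: "\<Delta>' \<tturnstile> regF (f $ x) (f $ x)" "\<Delta>' \<tturnstile> regF (f $ y) (f $ y)"
          using f sub x y by (simp_all add: real_function_iff)
        have "\<Delta>' \<tturnstile> equivF ?z ?z x x" using equivF_sym[OF _ _ xz] by simp
        then have "\<Delta>' \<tturnstile> equivF (f $ ?z) (f $ ?z) (f $ x) (f $ x)"
          using f sub x z by (simp add: real_function_iff)
        with reg fz show "\<Delta>' \<tturnstile> nearF k (f $ x) (f $ x) (f $ y) (f $ y)"
          by (simp add: nearF_equivF[of k "f $ ?z" "f $ x"])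
      qed
      show "\<Delta> \<tturnstile> continuous (K h) 0"
      proof (simp add: continuous_iff, safe)
        fix \<Delta>' k x assume sub: "set \<Delta> \<subseteq> set \<Delta>'" and [simp]: "closed k Nat" "closed x Seq"
        have "\<Delta>' \<tturnstile> Exists Nat (tcontF g k (alphaT x) (Bnd 3))"
          using cont sub by (simp add: ternary_continuous_iff ternF_alphaT)
        then show "\<Delta>' \<tturnstile> Exists Nat (contF h k x (Bnd 3))"
        proof (rule exists_cases)
          fix \<Delta>1 n assume [simp]: "closed n Nat" and "\<Delta>1 \<tturnstile> inst 0 n (tcontF g k (alphaT x) (Bnd 3))"
          then have c: "\<Delta>1 \<tturnstile> tcontF g k (alphaT x) n" by simp
          \<comment> \<open>Each digit looks three entries ahead, so the point of continuity moves
            by three.\<close>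
          let ?n = "sucT (sucT (sucT n))"
          have "\<Delta>2 \<tturnstile> Eq Nat (h $ k $ x) (h $ k $ y)"
            if "set \<Delta>1 \<subseteq> set \<Delta>2" "closed y Seq" "agree Rat \<Delta>2 ?n x y" for \<Delta>2 y
            using c that by (intro hI) (simp_all add: tcontF_iff ternF_alphaT agree_alphaT)
          then have "\<Delta>1 \<tturnstile> contF h k x ?n" by (simp add: contF_iff)
          then show "\<Delta>1 \<tturnstile> Exists Nat (contF h k x (Bnd 3))" by (intro D_existsI[of ?n]) simp_all
        qed
      qed
    qed simp_all
  qed simp
  then show ?thesis using assms by (auto simp: UCT_iff)
qed

theorem theorem5p5:
  shows "[] \<turnstile> (UCTc \<^bold>\<longleftrightarrow> UCTc') 0"
  unfolding fconj_def fimpl_def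
  using D_implI[OF wff_UCTc UCTc_imp_UCTc'[OF hyp_Cons[OF wff_UCTc]]]
    D_implI[OF wff_UCTc' UCTc'_imp_UCTc[OF hyp_Cons[OF wff_UCTc']]]
  by (rule D_conjI)

end
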